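(* Let $G$ be a finite soluble Frobenius group whose Frobenius complement is a $\{2,3,5\}$-group with order divisible by $30$. Then $G$ does not have perfect order classes.
   Context: All groups are finite. A finite group $G$ has perfect order classes if, for every positive integer $n$, the number of elements of order $n$ in $G$ is either zero or a divisor of $|G|$. A Frobenius group is a group $G$ with a proper non-trivial subgroup $H$ (a Frobenius complement, which is unique up to conjugacy in $G$) such that $H\cap H^g = 1$ for all $g\in G\setminus H$. A $\{2,3,5\}$-group is a group whose order has no prime divisors other than $2$, $3$ and $5$. *)

theory Defs
  imports "HOL-Algebra.Solvable_Groups" "HOL-Algebra.Multiplicative_Group"
    "HOL-Computational_Algebra.Primes"
begin

definition perfect_order_classes :: "('a, 'b) monoid_scheme \<Rightarrow> bool" where
  "perfect_order_classes G \<longleftrightarrow>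
     (\<forall>n::nat. n > 0 \<longrightarrow>
        card {x \<in> carrier G. group.ord G x = n} = 0 \<or>
        card {x \<in> carrier G. group.ord G x = n} dvd order G)"

text \<open>The conjugate \<open>H\<^sup>g\<close> is \<open>g\<^sup>-\<^sup>1 H g\<close>.\<close>

definition conj_subgroup :: "('a, 'b) monoid_scheme \<Rightarrow> 'a set \<Rightarrow> 'a \<Rightarrow> 'a set" where
  "conj_subgroup G H g = (inv\<^bsub>G\<^esub> g <#\<^bsub>G\<^esub> H) #>\<^bsub>G\<^esub> g"

definition frobenius_complement :: "'a set \<Rightarrow> ('a, 'b) monoid_scheme \<Rightarrow> bool" where
  "frobenius_complement H G \<longleftrightarrow>
     subgroup H G \<and> H \<noteq> carrier G \<and> H \<noteq> {\<one>\<^bsub>G\<^esub>} \<and>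
     (\<forall>g \<in> carrier G - H. H \<inter> conj_subgroup G H g = {\<one>\<^bsub>G\<^esub>})"

definition frobenius_group :: "('a, 'b) monoid_scheme \<Rightarrow> bool" where
  "frobenius_group G \<longleftrightarrow> group G \<and> (\<exists>H. frobenius_complement H G)"

text \<open>Finiteness is required explicitly because \<^const>\<open>order\<close> is \<open>0\<close> on infinite groups.\<close>

definition prime_set_group :: "nat set \<Rightarrow> ('a, 'b) monoid_scheme \<Rightarrow> bool" where
  "prime_set_group P G \<longleftrightarrow>
     group G \<and> finite (carrier G) \<and> (\<forall>p. prime p \<and> p dvd order G \<longrightarrow> p \<in> P)"

end

theory Submission
  imports Defs "HOL-Number_Theory.Totient" "HOL-Number_Theory.Cong" "HOL-Algebra.Elementary_Groups"
    "HOL-Algebra.Sylow" "HOL-Algebra.FiniteProduct"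
begin

text \<open>
  An involution of \<open>H\<close> inverts the kernel \<open>K\<close>, which is therefore abelian.  The elements of \<open>G\<close> of
  order \<open>d > 1\<close> dividing \<open>|H|\<close> number \<open>|K|\<close> times those of \<open>H\<close>, so \<open>H\<close> inherits perfect order classes.
  As \<open>H\<close> acts freely on \<open>K\<close>, the number of elements of prime order \<open>p\<close> in \<open>K\<close> is a multiple of \<open>|H|\<close>;
  for two primes the number of elements of order \<open>pq\<close> would be a multiple of \<open>|H|\<^sup>2\<close>, which is too
  much.  Hence \<open>K\<close> is a \<open>p\<close>-group, and \<open>H\<close> acts regularly on the nonzero vectors of the space \<open>V\<close>
  of its elements of order dividing \<open>p\<close>: \<open>|H| = p\<^sup>m - 1\<close>.

  Since only 2, 3, 5 divide \<open>p\<^sup>m - 1\<close>, either \<open>m \<le> 2\<close> or \<open>p\<^sup>m = 7\<^sup>4\<close>.  A cyclic group of order \<open>n\<close> with exactly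
  these prime divisors has \<open>4n/15\<close> generators, and this divides \<open>j n\<close> only if 4 divides \<open>j\<close>; thus \<open>H\<close>
  has no commutative self-centralizing subgroup of index 1 or 2.  For \<open>m = 1\<close> this is a contradiction.
  For \<open>m = 2\<close> it makes every abelian normal subgroup scalar, and the first nonscalar term of the
  derived series from below is a Klein four group modulo scalars; this bounds \<open>p\<close>, leaves \<open>p = 11\<close> and
  \<open>|H| = 120\<close>, and there the elements of order 15 are too many.  For \<open>7\<^sup>4\<close>, solvability makes the
  subgroup of order 5 normal with centralizer of index 4, and the action of a 2-element inducing
  the full automorphism group on it is incompatible with the field structure or with the unique
  involution of \<open>H\<close>.
\<close>

section \<open>Counting\<close>

text \<open>That the kernel is a subgroup is Frobenius' theorem, in general a result of character
  theory. An involution in the complement gives an elementary route: products of two involutions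
  from different conjugates of \<open>H\<close> avoid all conjugates of \<open>H\<close>, and there
  are enough of them to fill the kernel.

  What makes \<open>H\<close> accessible is that commuting elements of the same prime order are
  powers of one another, so commutative subgroups are cyclic and their generators can be counted.
  The ratio (1/2)(2/3)(4/5) = 4/15 has numerator 4, which the index has to absorb when the count
  divides the group order. Commutative subgroups of small index come from centralizers: an element
  under which some vector generates \<open>V\<close> has a commutative centralizer, and its
  commuting conjugates are roots of one quadratic, so that at most one of them differs from the
  element itself. In a plane the coefficients are scalars; in order \<open>7 ^ 4\<close>, where 7^4
  - 1 = 2400, they lie in the field of 49 elements generated by an element of order 4.\<close>

lemma card_fibres:
  assumes "finite A" "\<And>x. x \<in> A \<Longrightarrow> card {y \<in> A. f y = f x} = k"
  shows "card A = card (f ` A) * k"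
proof -
  have "card A = (\<Sum>y\<in>f ` A. card {x \<in> A. f x = y})"
    using sum.image_gen[OF assms(1), of "\<lambda>_. 1::nat" f] by simp
  also have "\<dots> = (\<Sum>y\<in>f ` A. k)"
    using assms(2) by (intro sum.cong) auto
  finally show ?thesis by simp
qed

lemma card_le_fibres:
  assumes "finite A" "\<And>x. x \<in> A \<Longrightarrow> card {y \<in> A. f y = f x} \<le> k"
  shows "card A \<le> card (f ` A) * k"
proof -
  have "card A = (\<Sum>y\<in>f ` A. card {x \<in> A. f x = y})"
    using sum.image_gen[OF assms(1), of "\<lambda>_. 1::nat" f] by simp
  also have "\<dots> \<le> (\<Sum>y\<in>f ` A. k)"
    using assms(2) by (intro sum_mono) auto
  finally show ?thesis by simp
qed

text \<open>All orbits of a free action have \<open>order P\<close> elements. It serves for the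
  iterates of a map, for subgroups of \<open>H\<close> acting on vectors, and for the complement
  acting on the kernel.\<close>

lemma free_action_order_dvd:
  fixes P (structure) and act :: "'a \<Rightarrow> 'x \<Rightarrow> 'x"
  assumes "group P" "finite X"
    and closed: "\<And>g x. g \<in> carrier P \<Longrightarrow> x \<in> X \<Longrightarrow> act g x \<in> X"
    and mult: "\<And>g h x. g \<in> carrier P \<Longrightarrow> h \<in> carrier P \<Longrightarrow> x \<in> X \<Longrightarrow> act (g \<otimes>\<^bsub>P\<^esub> h) x = act g (act h x)"
    and one: "\<And>x. x \<in> X \<Longrightarrow> act \<one>\<^bsub>P\<^esub> x = x"
    and free: "\<And>g x. g \<in> carrier P \<Longrightarrow> x \<in> X \<Longrightarrow> act g x = x \<Longrightarrow> g = \<one>\<^bsub>P\<^esub>"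
  shows "order P dvd card X"
proof -
  interpret group P by fact
  define orb where "orb x = (\<lambda>g. act g x) ` carrier P" for x
  have orb_sub: "orb x \<subseteq> X" if "x \<in> X" for x
    using that closed by (auto simp: orb_def)
  have self: "x \<in> orb x" if "x \<in> X" for x
    using one[OF that] unfolding orb_def by force
  have inv_act: "act (inv g) (act g x) = x" if "g \<in> carrier P" "x \<in> X" for g x
    using mult[of "inv g" g x] one that by simp
  have inj: "inj_on (\<lambda>g. act g x) (carrier P)" if x: "x \<in> X" for x
  proof (rule inj_onI)
    fix g h assume g: "g \<in> carrier P" and h: "h \<in> carrier P" and eq: "act g x = act h x"
    have "act (inv h \<otimes> g) x = x"
      using mult[of "inv h" g x] g h x eq inv_act[OF h x] by simp
    then have "inv h \<otimes> g = \<one>" using free[of "inv h \<otimes> g" x] g h x by simp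
    then show "g = h" using g h by (metis inv_equality inv_inv inv_closed)
  qed
  have mem: "orb y = orb x" if x: "x \<in> X" and y: "y \<in> orb x" for x y
  proof -
    obtain g where g: "g \<in> carrier P" "y = act g x" using y by (auto simp: orb_def)
    have "act h x \<in> orb y" if h: "h \<in> carrier P" for h
    proof -
      have "act h x = act (h \<otimes> inv g) y"
        using g h x mult[of h "inv g" "act g x"] inv_act closed by simp
      then show ?thesis using g h unfolding orb_def by auto
    qed
    moreover have "act h y \<in> orb x" if h: "h \<in> carrier P" for h
      using g h x mult[of h g x] unfolding orb_def by (metis image_eqI m_closed)
    ultimately have "orb x \<subseteq> orb y" "orb y \<subseteq> orb x"
      by (auto simp: orb_def[of x] orb_def[of y] simp del: orb_def)
    then show ?thesis by blast
  qed
  have un: "\<Union>(orb ` X) = X" using orb_sub self by blast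
  have "order P dvd card (\<Union>(orb ` X))"
  proof (rule dvd_partition)
    show "finite (\<Union>(orb ` X))" using un assms(2) by simp
    show "\<forall>c\<in>orb ` X. order P dvd card c"
      using inj by (auto simp: orb_def card_image order_def)
    show "\<forall>c1\<in>orb ` X. \<forall>c2\<in>orb ` X. c1 \<noteq> c2 \<longrightarrow> c1 \<inter> c2 = {}"
      using mem by blast
  qed
  then show ?thesis using un by simp
qed

lemma funpow_fixed_coprime:
  assumes "(f ^^ k) x = x" "(f ^^ q) x = x" "coprime k q"
  shows "f x = x"
proof (cases "k = 0")
  case True
  then show ?thesis using assms by auto
next
  case False
  have iter: "(f ^^ (a * k)) x = x" if "(f ^^ k) x = x" for a k
    using that by (induction a) (auto simp: funpow_add)
  from False bezout_nat[of k q] obtain a b where "k * a = q * b + 1"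
    using assms(3) by auto
  then have "(f ^^ Suc (b * q)) x = (f ^^ (a * k)) x"
    by (simp add: mult.commute)
  then show ?thesis using iter[OF assms(1), of a] iter[OF assms(2), of b] by simp
qed

text \<open>Periodicity makes the iterates of \<open>f\<close> an action of the cyclic group of
  order \<open>q\<close>. Since \<open>q\<close> is prime, a point fixed by an iterate with exponent
  prime to \<open>q\<close> is fixed by \<open>f\<close>, so the action is free off the fixed
  points.\<close>

lemma card_nonfixed_dvd:
  fixes q :: nat
  assumes "prime q" "finite X" and closed: "\<And>x. x \<in> X \<Longrightarrow> f x \<in> X"
    and per: "\<And>x. x \<in> X \<Longrightarrow> (f ^^ q) x = x"
  shows "q dvd card {x \<in> X. f x \<noteq> x}"
proof -
  define Y where "Y = {x \<in> X. f x \<noteq> x}"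
  have q: "q > 1" using assms(1) prime_gt_1_nat by blast
  have clX: "(f ^^ n) x \<in> X" if "x \<in> X" for n x
    using that closed by (induction n) auto
  have modq: "(f ^^ (n mod q)) x = (f ^^ n) x" if "x \<in> X" for n x
    using that by (simp add: per funpow_mod_eq)
  have clY: "(f ^^ n) x \<in> Y" if "x \<in> Y" for n x
  proof -
    have x: "x \<in> X" "f x \<noteq> x" using that by (auto simp: Y_def)
    have "f ((f ^^ n) x) \<noteq> (f ^^ n) x"
    proof
      assume *: "f ((f ^^ n) x) = (f ^^ n) x"
      \<comment> \<open>\<open>f ^^ m\<close> undoes \<open>f ^^ n\<close>, because
        \<open>n + m\<close> is \<open>n * q\<close>; a fixed iterate of \<open>x\<close> would thus
        pull back to a fixed \<open>x\<close>.\<close>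
      define m where "m = n * (q - 1)"
      have m: "q dvd n + m" using q by (simp add: m_def algebra_simps)
      have "f ((f ^^ m) ((f ^^ n) x)) = (f ^^ m) ((f ^^ n) x)"
        using * by (simp add: funpow_swap1)
      moreover have "(f ^^ m) ((f ^^ n) x) = x"
        using modq[OF x(1), of "n + m"] m by (simp add: funpow_add add.commute[of n m])
      ultimately show False using x by simp
    qed
    then show ?thesis using clX x by (simp add: Y_def)
  qed
  have "order (integer_mod_group q) dvd card Y"
  proof (rule free_action_order_dvd[where act = "\<lambda>g x. (f ^^ nat g) x"])
    show "finite Y" using assms(2) by (simp add: Y_def)
    have gr: "0 \<le> g" "g < int q" if "g \<in> carrier (integer_mod_group q)" for g
      using that q by (auto simp: carrier_integer_mod_group split: if_splits)
    fix g x
    assume g: "g \<in> carrier (integer_mod_group q)" and x: "x \<in> Y"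
    show "(f ^^ nat g) x \<in> Y" using clY x .
    { fix h assume h: "h \<in> carrier (integer_mod_group q)"
      have "(f ^^ nat ((g + h) mod int q)) x = (f ^^ (nat g + nat h)) x"
        using modq[of x "nat g + nat h"] x gr[OF g] gr[OF h]
        by (simp add: Y_def nat_mod_distrib nat_add_distrib)
      then show "(f ^^ nat (g \<otimes>\<^bsub>integer_mod_group q\<^esub> h)) x = (f ^^ nat g) ((f ^^ nat h) x)"
        by (simp add: funpow_add) }
    assume fx: "(f ^^ nat g) x = x"
    show "g = \<one>\<^bsub>integer_mod_group q\<^esub>"
    proof (rule ccontr)
      assume "g \<noteq> \<one>\<^bsub>integer_mod_group q\<^esub>"
      then have "0 < nat g" "nat g < q" using gr[OF g] by auto
      then have "coprime (nat g) q"
        using assms(1) by (metis coprime_commute prime_imp_coprime nat_dvd_not_less)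
      then have "f x = x" using funpow_fixed_coprime[OF fx, of q] per[of x] x unfolding Y_def by blast
      then show False using x unfolding Y_def by blast
    qed
  qed simp_all
  then show ?thesis using q by (simp add: Y_def order_def carrier_integer_mod_group)
qed

lemma card_fixed_cong:
  fixes q :: nat
  assumes "prime q" "finite X" "\<And>x. x \<in> X \<Longrightarrow> f x \<in> X" "\<And>x. x \<in> X \<Longrightarrow> (f ^^ q) x = x"
  shows "card X mod q = card {x \<in> X. f x = x} mod q"
proof -
  have "card X = card {x \<in> X. f x = x} + card {x \<in> X. f x \<noteq> x}"
    using assms(2) by (subst card_Un_disjoint[symmetric]) (auto intro: arg_cong[where f=card])
  moreover have "q dvd card {x \<in> X. f x \<noteq> x}" using card_nonfixed_dvd[OF assms] by blast
  ultimately show ?thesis by (auto elim!: dvdE)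
qed

section \<open>Cauchy's theorem, element orders, and cyclicity from root counts\<close>

lemma (in group) cauchy:
  assumes "finite (carrier G)" "prime q" "q dvd order G"
  shows "\<exists>x\<in>carrier G. ord x = q"
proof -
  \<comment> \<open>Exponent 1, whatever the full power of \<open>q\<close> in the order:
    \<open>sylow_thm\<close> then yields a subgroup of order exactly \<open>q\<close>.\<close>
  obtain m where "order G = q ^ 1 * m" using assms(3) by auto
  then obtain H where H: "subgroup H G" "card H = q"
    using sylow_thm[OF assms(2) is_group, of 1 m] assms(1) by auto
  have "q > 1" using assms(2) prime_gt_1_nat by blast
  then obtain x where x: "x \<in> H" "x \<noteq> \<one>"
    using H subgroup.one_closed[OF H(1)] by (metis card_le_Suc0_iff_eq card.infinite not_less_eq_eq One_nat_def not_one_le_zero linorder_not_less less_or_eq_imp_le)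
  have xc: "x \<in> carrier G" using x H subgroup.mem_carrier by metis
  have sub: "generate G {x} \<subseteq> H" using x H by (simp add: generate_subgroup_incl)
  have "subgroup (generate G {x}) (G\<lparr>carrier := H\<rparr>)"
    using subgroup_incl[OF generate_is_subgroup H(1) sub] xc by simp
  then have "card (generate G {x}) dvd q"
    using group.lagrange[OF subgroup_imp_group[OF H(1)], of "generate G {x}"] H
    by (simp add: order_def) (metis dvd_triv_right)
  then have "ord x dvd q" by (simp add: generate_pow_card xc)
  moreover have "ord x \<noteq> 1" using x xc ord_eq_1 by simp
  ultimately show ?thesis using assms(2) xc prime_nat_iff by blast
qed

lemma (in group) ord_prime_iff:
  assumes "x \<in> carrier G" "prime (q::nat)"
  shows "ord x = q \<longleftrightarrow> x [^] q = \<one> \<and> x \<noteq> \<one>"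
proof
  assume "ord x = q"
  then show "x [^] q = \<one> \<and> x \<noteq> \<one>"
    using assms pow_ord_eq_1[OF assms(1)] not_prime_1 by auto
next
  assume "x [^] q = \<one> \<and> x \<noteq> \<one>"
  then have "ord x dvd q" "ord x \<noteq> 1"
    using pow_eq_id[OF assms(1), of q] ord_eq_1[OF assms(1)] by blast+
  then show "ord x = q" using assms(2) prime_nat_iff by blast
qed

lemma (in group) ord_subgroup:
  assumes "subgroup H G"
  shows "group.ord (G\<lparr>carrier := H\<rparr>) x = ord x"
proof -
  have "x [^]\<^bsub>G\<lparr>carrier := H\<rparr>\<^esub> n = x [^] n" for n :: nat
    by (rule nat_pow_consistent[symmetric])
  then show ?thesis
    unfolding group.ord_def[OF subgroup_imp_group[OF assms]] ord_def by simp
qed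

text \<open>This is the argument by which finite multiplicative subgroups of fields are cyclic: each
  order \<open>d\<close> has at most \<open>totient d\<close> elements, and both counts sum to
  \<open>order G\<close> over the divisors. Root bounds for prime exponents suffice because they
  propagate along factorizations.\<close>

lemma (in comm_group) card_generators:
  assumes fin: "finite (carrier G)"
    and roots: "\<And>q. prime q \<Longrightarrow> card {x \<in> carrier G. x [^] (q::nat) = \<one>} \<le> q"
  shows "card {x \<in> carrier G. ord x = order G} = totient (order G)"
proof -
  have le: "card {x \<in> carrier G. x [^] d = \<one>} \<le> d" if "d > 0" for d :: nat
    using that
  proof (induction d rule: prime_divisors_induct)
    case (factor q d)
    have q: "prime q" "d > 0" using factor by (auto intro: gr0I)
    let ?A = "{x \<in> carrier G. x [^] (q * d) = \<one>}"
    \<comment> \<open>The \<open>q\<close>-th power map sends solutions of exponent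
      \<open>q * d\<close> to solutions of exponent \<open>d\<close>, and each fibre injects by
      translation into the \<open>q\<close>-th roots of unity.\<close>
    have "card ?A \<le> card ((\<lambda>x. x [^] q) ` ?A) * q"
    proof (rule card_le_fibres)
      show "finite ?A" using fin by simp
      fix x assume x: "x \<in> ?A"
      have "card {y \<in> ?A. y [^] q = x [^] q} \<le> card {y \<in> carrier G. y [^] q = \<one>}"
      proof (rule card_inj_on_le[where f = "\<lambda>y. y \<otimes> inv x"])
        show "inj_on (\<lambda>y. y \<otimes> inv x) {y \<in> ?A. y [^] q = x [^] q}"
          using x by (auto intro!: inj_onI)
        show "(\<lambda>y. y \<otimes> inv x) ` {y \<in> ?A. y [^] q = x [^] q} \<subseteq> {y \<in> carrier G. y [^] q = \<one>}"
          using x by (auto simp: nat_pow_distrib nat_pow_inv)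
      qed (use fin in auto)
      then show "card {y \<in> ?A. y [^] q = x [^] q} \<le> q"
        using roots[OF q(1)] by linarith
    qed
    also have "card ((\<lambda>x. x [^] q) ` ?A) \<le> card {x \<in> carrier G. x [^] d = \<one>}"
      using fin by (intro card_mono) (auto simp: nat_pow_pow)
    then have "card ((\<lambda>x. x [^] q) ` ?A) * q \<le> d * q"
      using factor.IH q(2) by (meson le_trans mult_le_mono1)
    finally show ?case by (simp add: mult.commute)
  next
    case (unit d)
    then have "d = 1" by simp
    have "{x \<in> carrier G. x [^] (1::nat) = \<one>} \<subseteq> {\<one>}" by auto
    then show ?case using card_mono[of "{\<one>}"] \<open>d = 1\<close> by fastforce
  qed simp
  define N where "N d = card {x \<in> carrier G. ord x = d}" for d
  have pos: "order G > 0" using fin by (simp add: order_gt_0_iff_finite)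
  have Nle: "N d \<le> totient d" if d: "d dvd order G" for d
  proof (cases "\<exists>a\<in>carrier G. ord a = d")
    case False
    then have "{x \<in> carrier G. ord x = d} = {}" by blast
    then show ?thesis unfolding N_def by (metis card.empty zero_le)
  next
    case True
    then obtain a where a: "a \<in> carrier G" "ord a = d" by blast
    have dpos: "d > 0" using d pos by (auto intro: gr0I)
    have "inj_on (\<lambda>x. a [^] x) {1..d}" using ord_inj'[OF a(1)] a(2) by simp
    then have card_im: "card ((\<lambda>x. a [^] x) ` {1..d}) = d" by (simp add: card_image)
    \<comment> \<open>The \<open>d\<close> powers of \<open>a\<close> already exhaust the at most
      \<open>d\<close> solutions, so every element of order \<open>d\<close> is a power of
      \<open>a\<close>.\<close>
    have eq: "(\<lambda>x. a [^] x) ` {1..d} = {x \<in> carrier G. x [^] d = \<one>}"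
    proof (rule card_seteq)
      show "(\<lambda>x. a [^] x) ` {1..d} \<subseteq> {x \<in> carrier G. x [^] d = \<one>}"
        using a by (auto simp: nat_pow_pow pow_eq_id)
      show "card {x \<in> carrier G. x [^] d = \<one>} \<le> card ((\<lambda>x. a [^] x) ` {1..d})"
        using le[OF dpos] card_im by simp
    qed (use fin in auto)
    have "{x \<in> carrier G. ord x = d} \<subseteq> (\<lambda>x. a [^] x) ` totatives d"
    proof
      fix x assume "x \<in> {x \<in> carrier G. ord x = d}"
      then have x: "x \<in> carrier G" "ord x = d" by auto
      then have "x \<in> (\<lambda>x. a [^] x) ` {1..d}" using eq by (simp add: pow_eq_id)
      then obtain n where n: "n \<in> {1..d}" "x = a [^] n" by blast
      then have "coprime n d" using x a pow_ord_eq_ord_iff[OF fin a(1), of n] by simp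
      then show "x \<in> (\<lambda>x. a [^] x) ` totatives d" using n by (auto simp: in_totatives_iff)
    qed
    then have "N d \<le> card ((\<lambda>x. a [^] x) ` totatives d)"
      unfolding N_def by (intro card_mono) auto
    also have "\<dots> \<le> totient d" unfolding totient_def by (rule card_image_le) simp
    finally show ?thesis .
  qed
  have findiv: "finite {d. d dvd order G}" using pos by simp
  have "card (carrier G) = (\<Sum>d\<in>ord ` carrier G. N d)"
    using sum.image_gen[OF fin, of "\<lambda>_. 1::nat" ord] by (simp add: N_def)
  also have "\<dots> = (\<Sum>d | d dvd order G. N d)"
  proof (rule sum.mono_neutral_left[OF findiv])
    show "ord ` carrier G \<subseteq> {d. d dvd order G}" using ord_dvd_group_order by auto
    show "\<forall>i\<in>{d. d dvd order G} - ord ` carrier G. N i = 0"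
      unfolding N_def by (auto simp: fin card_eq_0_iff)
  qed
  finally have "(\<Sum>d | d dvd order G. N d) = (\<Sum>d | d dvd order G. totient d)"
    by (simp add: totient_divisor_sum order_def)
  \<comment> \<open>A termwise inequality between sums with equal totals is an equality in every
    term.\<close>
  then have "N (order G) = totient (order G)"
    using sum_mono_inv[of N "{d. d dvd order G}" totient "order G"] Nle findiv by auto
  then show ?thesis by (simp add: N_def)
qed

text \<open>Orbit-stabilizer for conjugation. The acting group is a subgroup that need not contain
  \<open>x\<close>, so the formula can be applied a second time inside a centralizer.\<close>

lemma (in group) card_conjugates:
  assumes fin: "finite (carrier G)" and x: "x \<in> carrier G" and M: "subgroup M G"
  shows "card M = card ((\<lambda>h. h \<otimes> x \<otimes> inv h) ` M) * card {h \<in> M. h \<otimes> x = x \<otimes> h}"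
proof (rule card_fibres)
  have Mc: "M \<subseteq> carrier G" using M subgroup.subset by blast
  show "finite M" using fin Mc finite_subset by blast
  fix g assume g: "g \<in> M"
  then have gc: "g \<in> carrier G" using Mc by blast
  have key: "h \<otimes> x \<otimes> inv h = g \<otimes> x \<otimes> inv g \<longleftrightarrow> (inv g \<otimes> h) \<otimes> x = x \<otimes> (inv g \<otimes> h)" if h: "h \<in> carrier G" for h
  proof -
    have "h \<otimes> x \<otimes> inv h = g \<otimes> x \<otimes> inv g \<longleftrightarrow> h \<otimes> x = g \<otimes> x \<otimes> inv g \<otimes> h"
      using h gc x by (metis inv_closed inv_solve_right m_closed)
    also have "\<dots> \<longleftrightarrow> inv g \<otimes> (h \<otimes> x) = x \<otimes> (inv g \<otimes> h)"
      using h gc x inv_solve_left'[of "x \<otimes> (inv g \<otimes> h)" g "h \<otimes> x"] by (simp add: m_assoc)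
    finally show ?thesis using h gc x by (simp add: m_assoc)
  qed
  show "card {y \<in> M. y \<otimes> x \<otimes> inv y = g \<otimes> x \<otimes> inv g} = card {h \<in> M. h \<otimes> x = x \<otimes> h}"
  proof (rule bij_betw_same_card[where f = "\<lambda>h. inv g \<otimes> h"], rule bij_betwI[where g = "\<lambda>h. g \<otimes> h"])
    show "(\<otimes>) (inv g) \<in> {y \<in> M. y \<otimes> x \<otimes> inv y = g \<otimes> x \<otimes> inv g} \<rightarrow> {h \<in> M. h \<otimes> x = x \<otimes> h}"
      using key Mc g M by (auto simp: subgroup.m_closed subgroup.m_inv_closed)
    show "(\<otimes>) g \<in> {h \<in> M. h \<otimes> x = x \<otimes> h} \<rightarrow> {y \<in> M. y \<otimes> x \<otimes> inv y = g \<otimes> x \<otimes> inv g}"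
    proof
      fix h assume h: "h \<in> {h \<in> M. h \<otimes> x = x \<otimes> h}"
      then have hc: "h \<in> carrier G" using Mc by auto
      have "inv g \<otimes> (g \<otimes> h) = h" using hc gc by (simp add: m_assoc[symmetric])
      then show "g \<otimes> h \<in> {y \<in> M. y \<otimes> x \<otimes> inv y = g \<otimes> x \<otimes> inv g}"
        using h key[of "g \<otimes> h"] gc hc g M by (auto simp: subgroup.m_closed)
    qed
  qed (use Mc gc in \<open>auto simp: m_assoc[symmetric]\<close>)
qed

section \<open>Prime powers \<open>p\<^sup>m\<close> with \<open>p\<^sup>m - 1\<close> free of primes above 5\<close>

text \<open>The factor is (1 - 1/2)(1 - 1/3)(1 - 1/5) = 4/15, whatever the exponents of the three
  primes.\<close>

lemma totient_235:
  fixes n :: nat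
  assumes "\<And>r. prime r \<Longrightarrow> r dvd n \<Longrightarrow> r \<in> {2, 3, 5}" "30 dvd n" "n > 0"
  shows "15 * totient n = 4 * n"
proof -
  have "2 dvd n" "3 dvd n" "5 dvd n"
    using assms(2) by (auto intro: dvd_trans[of _ 30])
  moreover have "prime (2::nat)" "prime (3::nat)" "prime (5::nat)" by simp_all
  ultimately have "prime_factors n = {2, 3, 5}"
    using assms(1,3) by (auto simp: prime_factors_dvd)
  then have "real (totient n) = real n * (4 / 15)"
    by (simp add: totient_formula2)
  then show ?thesis by linarith
qed

lemma only_prime_divisor_imp_power:
  fixes n q :: nat
  assumes "n > 0" "prime q" "\<And>r. prime r \<Longrightarrow> r dvd n \<Longrightarrow> r = q"
  shows "\<exists>k. n = q ^ k"
proof -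
  obtain u where u: "n = q ^ multiplicity q n * u" "\<not> q dvd u"
    using multiplicity_decompose'[of n q] assms(1,2) by (metis mult.commute not_prime_unit not_gr_zero)
  have "u = 1"
  proof (rule ccontr)
    assume "u \<noteq> 1"
    then obtain r where r: "prime r" "r dvd u" by (metis prime_factor_nat)
    then have "r = q" using assms(3)[of r] u(1) by (metis dvd_mult)
    then show False using r u by simp
  qed
  then show ?thesis using u(1) by auto
qed

text \<open>Base \<open>Suc Q\<close> keeps the geometric sum free of subtraction on the
  naturals.\<close>

lemma Suc_power_geometric: "Suc Q ^ n = 1 + Q * (\<Sum>i<n. Suc Q ^ i)"
proof (induction n)
  case (Suc n)
  have "Suc Q ^ Suc n = Suc Q ^ n + Q * Suc Q ^ n" by simp
  also have "\<dots> = 1 + Q * (\<Sum>i<n. Suc Q ^ i) + Q * Suc Q ^ n" using Suc by linarith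
  also have "\<dots> = 1 + Q * (\<Sum>i<Suc n. Suc Q ^ i)"
    by (simp only: sum.lessThan_Suc distrib_left add.assoc)
  finally show ?case .
qed simp

text \<open>Let \<open>F\<close> be the quotient of \<open>P ^ l - 1\<close> by
  \<open>P - 1\<close>; it is odd. If 3 or 5 divides \<open>F\<close>, it divides
  \<open>P - 1\<close>, since orders of units modulo 3 and 5 divide 4 and \<open>l\<close> is odd;
  then \<open>F\<close> is congruent to \<open>l\<close>, so this prime is \<open>l\<close>. Hence
  \<open>l\<close> is the only prime divisor of \<open>F\<close>, but \<open>F\<close> is
  \<open>l\<close> modulo \<open>l * l\<close> and too large to be \<open>l\<close>.\<close>

lemma not_odd_prime_exponent:
  fixes P l :: nat
  assumes "P > 4" "odd P" "prime l" "odd l"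
    and smooth: "\<And>r. prime r \<Longrightarrow> r dvd P ^ l - 1 \<Longrightarrow> r \<in> {2, 3, 5}"
  shows False
proof -
  define F where "F = (\<Sum>i<l. P ^ i)"
  have geo: "P ^ l = 1 + (P - 1) * F"
    using Suc_power_geometric[of "P - 1" l] assms(1) by (simp add: F_def)
  have Fmod: "F mod r = l mod r" if "P mod r = 1 mod r" for r
  proof -
    have "(\<Sum>i<l. P ^ i) mod r = (\<Sum>i<l. P ^ i mod r) mod r" by (simp add: mod_sum_eq)
    also have "\<dots> = (\<Sum>i<l. 1 mod r) mod r"
      using that by (metis (no_types, lifting) power_mod power_one)
    also have "\<dots> = l mod r" by (simp add: mod_sum_eq mod_mult_right_eq)
    finally show ?thesis by (simp add: F_def)
  qed
  have one: "P mod r = 1" if r: "r = 3 \<or> r = 5" "P ^ l mod r = 1" for r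
  proof -
    \<comment> \<open>Units modulo 3 and 5 have fourth power 1, so only \<open>l mod 4\<close>
      matters.\<close>
    have "l mod 4 = 1 \<or> l mod 4 = 3" using assms(4) by presburger
    then obtain k c where l: "l = 4 * k + c" "c = 1 \<or> c = 3"
      by (metis mult_div_mod_eq)
    have "P ^ l mod r = (P mod r) ^ l mod r" by (simp only: power_mod)
    also have "\<dots> = (((P mod r) ^ 4) ^ k mod r * (P mod r) ^ c) mod r"
      unfolding l(1) power_add power_mult by (simp only: mod_mult_left_eq)
    also have "((P mod r) ^ 4) ^ k mod r = ((P mod r) ^ 4 mod r) ^ k mod r"
      by (rule power_mod[symmetric])
    finally have 1: "P ^ l mod r = (((P mod r) ^ 4 mod r) ^ k mod r * (P mod r) ^ c) mod r" .
    have "P mod r \<noteq> 0"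
    proof
      assume "P mod r = 0"
      then have "r dvd P ^ l" using prime_gt_0_nat[OF assms(3)]
        by (meson dvd_eq_mod_eq_0 dvd_power dvd_trans)
      then show False using r(2) by simp
    qed
    moreover have "P mod r \<in> {0, 1, 2} \<or> r = 5" "P mod r \<in> {0, 1, 2, 3, 4}"
      using r(1) by auto
    ultimately have cs: "r = 3 \<and> P mod r \<in> {1, 2} \<or> r = 5 \<and> P mod r \<in> {1, 2, 3, 4}"
      using r(1) by auto
    then have "(P mod r) ^ 4 mod r = 1" by auto
    then have 2: "(P mod r) ^ c mod r = 1" using 1 r by auto
    show ?thesis
      using l(2)
    proof
      assume "c = 1"
      then show ?thesis using 2 by simp
    next
      assume "c = 3"
      then show ?thesis using 2 cs by auto
    qed
  qed
  have aux: "(1 + x) mod r = 1" if "r dvd x" "r > 1" for r x :: nat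
  proof -
    have "(1 + x) mod r = (1 + x mod r) mod r" by (rule mod_add_right_eq[symmetric])
    then show ?thesis using that by (simp add: dvd_eq_mod_eq_0)
  qed
  have prF: "r = l \<and> (l = 3 \<or> l = 5)" if r: "prime r" "r dvd F" for r
  proof -
    have "r dvd P ^ l - 1" using geo r(2) by simp
    then have "r \<in> {2, 3, 5}" using smooth r(1) by blast
    moreover have "r \<noteq> 2"
      using Fmod[of 2] r(2) assms(2,4) by (auto simp: odd_iff_mod_2_eq_one)
    ultimately have r35: "r = 3 \<or> r = 5" by blast
    have "P ^ l mod r = 1"
      unfolding geo by (rule aux) (use r(2) r35 in auto)
    then have "P mod r = 1" by (rule one[OF r35])
    then have "P mod r = 1 mod r" using r35 by auto
    then have "r dvd l" using Fmod r(2) by (metis dvd_eq_mod_eq_0)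
    then show ?thesis using r(1) assms(3) r35 primes_dvd_imp_eq by blast
  qed
  have l3: "l \<ge> 3" using assms(3,4) prime_ge_2_nat[of l] by (cases "l = 2") auto
  have "(\<Sum>i\<in>{0,1,2::nat}. P ^ i) \<le> F"
    unfolding F_def by (rule sum_mono2) (use l3 in auto)
  then have Fbig: "F > 5" using assms(1) by simp
  then obtain r where r: "prime r" "r dvd F" using prime_factor_nat[of F] by auto
  then have l: "l dvd F" "l = 3 \<or> l = 5" using prF by auto
  then obtain c where c: "F = l * c" by blast
  have "c \<noteq> 1" using Fbig c l by auto
  \<comment> \<open>Prime divisors of the cofactor also divide \<open>F\<close>, so they are
    \<open>l\<close> again.\<close>
  then obtain r' where "prime r'" "r' dvd c" by (metis prime_factor_nat)
  then have "l * l dvd F" using prF[of r'] c by auto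
  moreover have "P mod l = 1"
  proof -
    have "P ^ l mod l = 1"
      unfolding geo by (rule aux) (use l in auto)
    then show ?thesis using one[of l] l by auto
  qed
  then obtain t where t: "P = l * t + 1" by (metis mult_div_mod_eq)
  \<comment> \<open>With \<open>P = l * t + 1\<close>, every term of \<open>F\<close> beyond the
    constant \<open>l\<close> is a multiple of \<open>l * l\<close>, because 0 + 1 + ... + (l - 1)
    is a multiple of \<open>l\<close> for odd \<open>l\<close>.\<close>
  ultimately show False
  proof -
    assume d: "l * l dvd F"
    show False using l(2)
    proof
      assume l: "l = 3"
      have "F = 1 + P + P * P"
        unfolding F_def l by (simp add: eval_nat_numeral)
      then have "F = 3 + 9 * (t + t * t)"
        unfolding t l by (simp add: algebra_simps)
      moreover have "\<not> 9 dvd 3 + 9 * z" for z :: nat by presburger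
      moreover have "9 dvd F" using d l by simp
      ultimately show False by metis
    next
      assume l: "l = 5"
      have "F = 1 + P + P * P + P * P * P + P * P * P * P"
        unfolding F_def l by (simp add: eval_nat_numeral)
      then have "F = 5 + 25 * (2 * t + 10 * (t * t) + 25 * (t * t * t) + 25 * (t * t * t * t))"
        unfolding t l by (simp add: algebra_simps)
      moreover have "\<not> 25 dvd 5 + 25 * z" for z :: nat by presburger
      moreover have "25 dvd F" using d l by simp
      ultimately show False by metis
    qed
  qed
qed

text \<open>Fourth powers of numbers prime to 30 are 1 modulo 4, 3 and 5. So
  \<open>Q ^ 4 + 1\<close> is 2 modulo each of these: twice an odd number without admissible prime
  divisors, hence 2.\<close>

lemma not_eighth_power:
  fixes Q :: nat
  assumes "Q > 1" "Q mod 2 \<noteq> 0" "Q mod 3 \<noteq> 0" "Q mod 5 \<noteq> 0"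
    and smooth: "\<And>r. prime r \<Longrightarrow> r dvd Q ^ 8 - 1 \<Longrightarrow> r \<in> {2, 3, 5}"
  shows False
proof -
  have m: "Q ^ 4 mod r = (Q mod r) ^ 4 mod r" for r by (simp add: power_mod)
  have "Q mod 4 = 1 \<or> Q mod 4 = 3" "Q mod 3 = 1 \<or> Q mod 3 = 2"
    "Q mod 5 = 1 \<or> Q mod 5 = 2 \<or> Q mod 5 = 3 \<or> Q mod 5 = 4"
    using assms(2-4) by presburger+
  then have mods: "Q ^ 4 mod 4 = 1" "Q ^ 4 mod 3 = 1" "Q ^ 4 mod 5 = 1"
    unfolding m by (elim disjE; simp)+
  have "Q ^ 8 - 1 = (Q ^ 4 + 1) * (Q ^ 4 - 1)"
    using assms(1) by (simp add: algebra_simps diff_mult_distrib2 flip: power_add)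
  then have pr: "r \<in> {2, 3, 5}" if "prime r" "r dvd Q ^ 4 + 1" for r
    using smooth that by (metis dvd_mult2)
  have "\<exists>c. z + 1 = 2 * c \<and> odd c" if "z mod 4 = 1" for z :: nat
    using that by presburger
  then obtain c where c: "Q ^ 4 + 1 = 2 * c" "odd c"
    using mods(1) by blast
  have "c = 1"
  proof (rule ccontr)
    assume "c \<noteq> 1"
    then obtain r where r: "prime r" "r dvd c" by (metis prime_factor_nat)
    then have "r \<noteq> 2" "r dvd Q ^ 4 + 1" using c by auto
    then have "r = 3 \<or> r = 5" using pr r by blast
    then show False using \<open>r dvd Q ^ 4 + 1\<close> mods(2,3) by (auto simp: dvd_eq_mod_eq_0 mod_Suc)
  qed
  then have "Q ^ 4 = 1" using c by simp
  then show False using assms(1) by simp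
qed

text \<open>Powers of 3 are 1 or 3 modulo 8, so the power of 2 is not divisible by 8.\<close>

lemma three_power_plus_one:
  assumes "(3::nat) ^ j + 1 = 2 ^ n"
  shows "(3::nat) ^ j \<le> 3"
proof -
  have "(3::nat) ^ j mod 8 = 1 \<or> (3::nat) ^ j mod 8 = 3"
  proof (induction j)
    case (Suc j)
    have "(3::nat) ^ Suc j mod 8 = 3 * (3 ^ j mod 8) mod 8"
      by (simp only: power_Suc mod_mult_right_eq)
    then show ?case using Suc by auto
  qed simp
  have "n < 3"
  proof (rule ccontr)
    assume "\<not> n < 3"
    then have "(8::nat) dvd 2 ^ n" using le_imp_power_dvd[of 3 n "2::nat"] by simp
    then have "(3 ^ j + 1) mod (8::nat) = 0" using assms by simp
    then show False using \<open>_ \<or> _\<close> by presburger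
  qed
  then have "n = 0 \<or> n = 1 \<or> n = 2" by auto
  then show ?thesis using assms by auto
qed

text \<open>For \<open>n\<close> at least 2, reduction modulo 4 makes \<open>j\<close> even; then
  \<open>2 ^ n\<close> factors as a difference of squares and \<open>three_power_plus_one\<close>
  applies to the larger factor.\<close>

lemma three_power_minus_one:
  assumes "(3::nat) ^ j = 2 ^ n + 1"
  shows "(3::nat) ^ j = 3 \<or> (3::nat) ^ j = 9"
proof (cases "n < 2")
  case True
  then have "n = 0 \<or> n = 1" by auto
  moreover have "odd ((3::nat) ^ j)" by simp
  ultimately show ?thesis using assms by auto
next
  case False
  then have "(4::nat) dvd 2 ^ n" using le_imp_power_dvd[of 2 n "2::nat"] by simp
  then have "(3::nat) ^ j mod 4 = 1" using assms by auto
  have "even j"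
  proof (rule ccontr)
    assume "odd j"
    then obtain i where "j = 2 * i + 1" by (elim oddE)
    then have "(3::nat) ^ j mod 4 = 9 ^ i * 3 mod 4" by (simp add: power_mult mult.commute[of _ 3])
    also have "\<dots> = (9 ^ i mod 4) * 3 mod 4" by (simp only: mod_mult_left_eq)
    also have "(9::nat) ^ i mod 4 = (9 mod 4) ^ i mod 4" by (rule power_mod[symmetric])
    finally show False using \<open>3 ^ j mod 4 = 1\<close> by simp
  qed
  then obtain i where i: "j = 2 * i" by blast
  have "(3 ^ i + 1) * (3 ^ i - 1) = (2::nat) ^ n"
  proof -
    have "(3 ^ i + 1) * (3 ^ i - 1) = (3 ^ i * 3 ^ i - (1::nat))"
      by (simp add: algebra_simps diff_mult_distrib2)
    also have "3 ^ i * 3 ^ i = (3::nat) ^ j" by (simp add: i mult_2 power_add)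
    finally show ?thesis using assms by simp
  qed
  then have "(3 ^ i + 1) dvd (2::nat) ^ n" by (metis dvd_triv_left)
  then obtain k where "3 ^ i + 1 = (2::nat) ^ k" by (metis divides_primepow_nat two_is_prime_nat)
  then have "(3::nat) ^ i \<le> 3" by (rule three_power_plus_one)
  then have "i \<le> 1" using power_increasing_iff[of "3::nat" i 1] by simp
  then have "i = 0 \<or> i = 1" by auto
  then show ?thesis using assms i by auto
qed

text \<open>As \<open>p\<close> is prime to 30, the two preceding exponent lemmas exclude odd primes
  and 8 as divisors of \<open>m\<close>. For \<open>m = 4\<close>, \<open>p ^ 2 + 1\<close> is twice
  an odd number not divisible by 3, so 5 divides it and divides neither \<open>p - 1\<close> nor
  \<open>p + 1\<close>. These two are then a power of 2 and twice a power of 3, which leaves 7 and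
  17.\<close>

lemma prime_power_minus_one_smooth:
  fixes p m :: nat
  assumes p: "prime p" and m: "m > 0"
    and smooth: "\<And>r. prime r \<Longrightarrow> r dvd p ^ m - 1 \<Longrightarrow> r \<in> {2, 3, 5}"
    and d30: "30 dvd p ^ m - 1"
  shows "m = 1 \<or> m = 2 \<or> m = 4 \<and> p = 7"
proof -
  have nd: "p mod q \<noteq> 0" if "q = 2 \<or> q = 3 \<or> q = 5" for q
  proof
    assume "p mod q = 0"
    then have "q dvd p ^ m" using m by (meson dvd_eq_mod_eq_0 dvd_power dvd_trans)
    moreover have "q dvd p ^ m - 1" using d30 that by (auto intro: dvd_trans[of _ 30])
    moreover have "p ^ m > 0" using p prime_gt_0_nat by simp
    ultimately have "q dvd p ^ m - (p ^ m - 1)" "p ^ m - (p ^ m - 1) = 1"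
      by (auto intro: dvd_diff_nat)
    then have "q dvd 1" by simp
    then show False using that by auto
  qed
  have p7: "p \<ge> 7"
  proof (rule ccontr)
    assume "\<not> p \<ge> 7"
    then have "p \<in> {0,1,2,3,4,5,6}" by auto
    then show False using nd[of 2] nd[of 3] nd[of 5] p by auto
  qed
  have ndpow: "p ^ k mod q \<noteq> 0" if "q = 2 \<or> q = 3 \<or> q = 5" for q k
  proof -
    have "prime q" using that by auto
    then show ?thesis using nd[OF that] by (metis dvd_eq_mod_eq_0 prime_dvd_power)
  qed
  have odd_pr: False if l: "prime l" "odd l" "l dvd m" for l
  proof -
    obtain k where k: "m = k * l" using l(3) by (metis dvd_def mult.commute)
    then have "k > 0" using m by auto
    then have "p ^ k \<ge> p" using p7 by (simp add: self_le_power)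
    then show False
      using not_odd_prime_exponent[of "p ^ k" l] l p7 ndpow[of 2 k] smooth k
      by (auto simp: power_mult even_iff_mod_2_eq_zero)
  qed
  have "\<exists>k. m = 2 ^ k"
  proof (rule only_prime_divisor_imp_power)
    fix r assume r: "prime r" "r dvd m"
    then have "even r" using odd_pr by blast
    then show "r = 2" using r(1) primes_dvd_imp_eq[of 2 r] by simp
  qed (use m in auto)
  then obtain k where k: "m = 2 ^ k" by blast
  have "\<not> 8 dvd m"
  proof
    assume "8 dvd m"
    then obtain j where j: "m = j * 8" by (metis dvd_def mult.commute)
    then have "j > 0" using m by auto
    then have "p ^ j \<ge> p" using p7 by (simp add: self_le_power)
    then show False
      using not_eighth_power[of "p ^ j"] ndpow[of 2 j] ndpow[of 3 j] ndpow[of 5 j] p7 smooth j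
      by (auto simp: power_mult)
  qed
  then have "k < 3" using le_imp_power_dvd[of 3 k "2::nat"] k by (cases "k < 3") auto
  then have m124: "m = 1 \<or> m = 2 \<or> m = 4" using k by (auto simp: less_Suc_eq numeral_3_eq_3)
  moreover have "p = 7" if m4: "m = 4"
  proof -
    have fac: "p ^ 4 - 1 = (p\<^sup>2 + 1) * ((p - 1) * (p + 1))"
      using p7 by (simp add: power2_eq_square eval_nat_numeral algebra_simps diff_mult_distrib2)
    have pr: "r \<in> {2, 3, 5}" if "prime r" "r dvd p\<^sup>2 + 1 \<or> r dvd p - 1 \<or> r dvd p + 1" for r
      using smooth[of r] that m4 fac by (metis dvd_mult dvd_mult2)
    have "p mod 4 = 1 \<or> p mod 4 = 3" "p mod 3 = 1 \<or> p mod 3 = 2"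
      using nd[of 2] nd[of 3] by presburger+
    then have mods: "p\<^sup>2 mod 4 = 1" "p\<^sup>2 mod 3 = 1"
      unfolding power_mod[of p 4 2, symmetric] power_mod[of p 3 2, symmetric] by auto
    have two: "\<exists>c. z + 1 = 2 * c \<and> odd c" if "z mod 4 = 1" for z :: nat
      using that by presburger
    have p5: "p mod 5 = 2 \<or> p mod 5 = 3"
    proof -
      obtain c where c: "p\<^sup>2 + 1 = 2 * c" "odd c" using two mods(1) by blast
      have "p\<^sup>2 > 1" using p7 one_less_power[of p 2] by linarith
      then obtain r where r: "prime r" "r dvd c" using c prime_factor_nat[of c] by fastforce
      have "r \<noteq> 2" using r c by auto
      moreover have rd: "r dvd p\<^sup>2 + 1" using r c by simp
      moreover have "r \<noteq> 3" using rd mods(2) by (auto simp: dvd_eq_mod_eq_0 mod_Suc)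
      ultimately have "5 dvd p\<^sup>2 + 1" using pr r by blast
      then have "((p mod 5)\<^sup>2 + 1) mod 5 = 0"
        by (metis dvd_eq_mod_eq_0 mod_add_left_eq power_mod)
      moreover have "p mod 5 \<in> {0, 1, 2, 3, 4}" by auto
      ultimately show ?thesis by (auto simp del: One_nat_def)
    qed
    have three: "r = 2 \<or> r = 3" if "prime r" "r dvd p - 1 \<or> r dvd p + 1" for r
    proof -
      have "\<not> 5 dvd p - 1" "\<not> 5 dvd p + 1" using p5 by presburger+
      then show ?thesis using pr[of r] that by auto
    qed
    have pow2: "\<exists>n. z = 2 ^ n" if "z > 0" "\<not> 3 dvd z" "\<And>r. prime r \<Longrightarrow> r dvd z \<Longrightarrow> r = 2 \<or> r = 3" for z :: nat
      using that by (intro only_prime_divisor_imp_power) auto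
    have pow3: "\<exists>n. z = 3 ^ n" if "odd z" "\<And>r. prime r \<Longrightarrow> r dvd z \<Longrightarrow> r = 2 \<or> r = 3" for z :: nat
      using that by (intro only_prime_divisor_imp_power) (auto intro: odd_pos)
    from \<open>p mod 4 = 1 \<or> p mod 4 = 3\<close> show ?thesis
    proof
      assume "p mod 4 = 1"
      then obtain u where u: "p + 1 = 2 * u" "odd u" using two by blast
      have "r = 2 \<or> r = 3" if "prime r" "r dvd u" for r
        using three[of r] that u(1) by simp
      then obtain j where j: "u = 3 ^ j" using pow3 u(2) by blast
      have "j > 0" using j u(1) p7 by (intro gr0I) simp
      then have "3 dvd u" using j by simp
      then have "\<not> 3 dvd p - 1" using u(1) p7 by presburger
      then obtain n where n: "p - 1 = 2 ^ n" using pow2[of "p - 1"] three p7 by auto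
      then have "n > 0" using p7 by (intro gr0I) simp
      then obtain i where "n = Suc i" using gr0_conv_Suc by blast
      then have "(3::nat) ^ j = 2 ^ i + 1" using n j u(1) p7 by simp
      then have "u = 3 \<or> u = 9" using three_power_minus_one j by blast
      then have "p = 17" using u(1) p7 by auto
      \<comment> \<open>The value 17 is excluded by 17^2 + 1 = 290 = 2 * 5 * 29.\<close>
      moreover have "prime (29::nat)" by simp
      moreover have "(29::nat) dvd 17\<^sup>2 + 1" by simp
      ultimately have "(29::nat) \<in> {2, 3, 5}" using pr by blast
      then show ?thesis by simp
    next
      assume "p mod 4 = 3"
      then have "\<exists>u. p - 1 = 2 * u \<and> odd u" by presburger
      then obtain u where u: "p - 1 = 2 * u" "odd u" by blast
      have "r = 2 \<or> r = 3" if "prime r" "r dvd u" for r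
        using three[of r] that u(1) by simp
      then obtain j where j: "u = 3 ^ j" using pow3 u(2) by blast
      have "j > 0" using j u(1) p7 by (intro gr0I) simp
      then have "3 dvd u" using j by simp
      then have "\<not> 3 dvd p + 1" using u(1) p7 by presburger
      then obtain n where n: "p + 1 = 2 ^ n" using pow2[of "p + 1"] three p7 by auto
      then have "n > 0" using p7 by (intro gr0I) simp
      then obtain i where "n = Suc i" using gr0_conv_Suc by blast
      then have "(3::nat) ^ j + 1 = 2 ^ i" using n j u(1) p7 by simp
      then have "u \<le> 3" using three_power_plus_one j by blast
      then show ?thesis using u(1) p7 by auto
    qed
  qed
  ultimately show ?thesis by blast
qed

section \<open>Fixed-point-free actions on elementary abelian groups\<close>

lemma (in group) pow_mod_exponent:
  assumes "x \<in> carrier G" "x [^] (q::nat) = \<one>"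
  shows "x [^] k = x [^] (k mod q)"
proof -
  have "x [^] (q * (k div q) + k mod q) = x [^] (q * (k div q)) \<otimes> x [^] (k mod q)"
    using assms(1) by (simp only: nat_pow_mult)
  also have "x [^] (q * (k div q)) = (x [^] q) [^] (k div q)"
    using assms(1) by (simp only: nat_pow_pow)
  finally show ?thesis using assms by simp
qed

text \<open>\<open>V\<close> is a vector space over the field of \<open>p\<close> elements, written
  as a group of exponent \<open>p\<close>: the product is vector addition, integer powers are
  multiples, and endomorphisms are the linear maps. In the application \<open>V\<close> lies in the
  kernel and \<open>H\<close> acts by conjugation.\<close>

locale free_action = H: group H + V: comm_group V
  for H :: "('h, 'x) monoid_scheme" (structure) and V :: "('v, 'y) monoid_scheme" +
  fixes act :: "'h \<Rightarrow> 'v \<Rightarrow> 'v" and p :: nat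
  assumes finH: "finite (carrier H)" and finV: "finite (carrier V)"
    and prime_p: "prime p"
    and exponent: "v \<in> carrier V \<Longrightarrow> v [^]\<^bsub>V\<^esub> p = \<one>\<^bsub>V\<^esub>"
    and nontrivial: "carrier V \<noteq> {\<one>\<^bsub>V\<^esub>}"
    and act_closed [simp, intro]: "h \<in> carrier H \<Longrightarrow> v \<in> carrier V \<Longrightarrow> act h v \<in> carrier V"
    and act_hom [simp]: "h \<in> carrier H \<Longrightarrow> v \<in> carrier V \<Longrightarrow> w \<in> carrier V \<Longrightarrow>
      act h (v \<otimes>\<^bsub>V\<^esub> w) = act h v \<otimes>\<^bsub>V\<^esub> act h w"
    and act_mult: "h \<in> carrier H \<Longrightarrow> k \<in> carrier H \<Longrightarrow> v \<in> carrier V \<Longrightarrow>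
      act (h \<otimes> k) v = act h (act k v)"
    and act_one [simp]: "v \<in> carrier V \<Longrightarrow> act \<one> v = v"
    and free: "h \<in> carrier H \<Longrightarrow> v \<in> carrier V \<Longrightarrow> act h v = v \<Longrightarrow> h = \<one> \<or> v = \<one>\<^bsub>V\<^esub>"
begin

lemma nonzero_exists: obtains v where "v \<in> carrier V" "v \<noteq> \<one>\<^bsub>V\<^esub>"
  using nontrivial V.one_closed by blast

lemma act_group_hom: "h \<in> carrier H \<Longrightarrow> group_hom V V (act h)"
  by unfold_locales (auto simp: hom_def)

lemma act_one_V [simp]: "h \<in> carrier H \<Longrightarrow> act h \<one>\<^bsub>V\<^esub> = \<one>\<^bsub>V\<^esub>"
  using group_hom.hom_one[OF act_group_hom] .

lemma act_inv_V [simp]: "h \<in> carrier H \<Longrightarrow> v \<in> carrier V \<Longrightarrow> act h (inv\<^bsub>V\<^esub> v) = inv\<^bsub>V\<^esub> (act h v)"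
  using group_hom.hom_inv[OF act_group_hom] .

lemma act_int_pow [simp]:
  "h \<in> carrier H \<Longrightarrow> v \<in> carrier V \<Longrightarrow> act h (v [^]\<^bsub>V\<^esub> (k::int)) = act h v [^]\<^bsub>V\<^esub> k"
  using group_hom.hom_int_pow[OF act_group_hom] .

lemma act_inv_cancel [simp]:
  assumes "h \<in> carrier H" "v \<in> carrier V"
  shows "act (inv h) (act h v) = v" "act h (act (inv h) v) = v"
  using act_mult[of "inv h" h v] act_mult[of h "inv h" v] assms by auto

lemma act_cancel:
  "h \<in> carrier H \<Longrightarrow> v \<in> carrier V \<Longrightarrow> w \<in> carrier V \<Longrightarrow> act h v = act h w \<longleftrightarrow> v = w"
  by (metis act_inv_cancel(1))

text \<open>Freeness lets an equation in \<open>H\<close> be checked at a single nonzero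
  vector.\<close>

lemma act_eqD:
  assumes "h \<in> carrier H" "k \<in> carrier H" "v \<in> carrier V" "v \<noteq> \<one>\<^bsub>V\<^esub>" "act h v = act k v"
  shows "h = k"
proof -
  have "act (inv k \<otimes> h) v = v"
    using act_mult[of "inv k" h v] assms by simp
  moreover have "inv k \<otimes> h \<in> carrier H" using assms(1,2) by simp
  ultimately have "inv k \<otimes> h = \<one>" using free assms(3,4) by blast
  then show ?thesis using assms(1,2) H.inv_solve_left'[of "\<one>" k h] by simp
qed

lemma act_pow_closed:
  assumes "x \<in> carrier H" "\<And>s. s \<in> S \<Longrightarrow> act x s \<in> S" "S \<subseteq> carrier V" "s \<in> S"
  shows "act (x [^] (n::nat)) s \<in> S"
  using assms(4)
proof (induction n arbitrary: s)
  case 0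
  then show ?case using assms(3) by auto
next
  case (Suc n)
  then show ?case using assms act_mult[of "x [^] n" x s] by auto
qed

lemma subgroup_stable_dvd:
  assumes K: "subgroup K H" and S: "subgroup S V" and stable: "\<And>h s. h \<in> K \<Longrightarrow> s \<in> S \<Longrightarrow> act h s \<in> S"
  shows "card K dvd card S - 1"
proof -
  have SV: "S \<subseteq> carrier V" using S subgroup.subset by blast
  have KH: "K \<subseteq> carrier H" using K subgroup.subset by blast
  have finS: "finite S" using SV finV finite_subset by blast
  have "order (H\<lparr>carrier := K\<rparr>) dvd card (S - {\<one>\<^bsub>V\<^esub>})"
  proof (rule free_action_order_dvd[where act = act])
    show "group (H\<lparr>carrier := K\<rparr>)" using K H.subgroup_imp_group by blast
    show "finite (S - {\<one>\<^bsub>V\<^esub>})" using finS by simp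
    fix g x assume g: "g \<in> carrier (H\<lparr>carrier := K\<rparr>)" and x: "x \<in> S - {\<one>\<^bsub>V\<^esub>}"
    have gx: "g \<in> carrier H" "x \<in> carrier V" "g \<in> K" "x \<noteq> \<one>\<^bsub>V\<^esub>" using g x KH SV by auto
    show "act g x \<in> S - {\<one>\<^bsub>V\<^esub>}"
      using stable gx x act_cancel[of g x "\<one>\<^bsub>V\<^esub>"] by auto
    show "act g x = x \<Longrightarrow> g = \<one>\<^bsub>H\<lparr>carrier := K\<rparr>\<^esub>" using free gx by auto
    fix h assume "h \<in> carrier (H\<lparr>carrier := K\<rparr>)"
    then show "act (g \<otimes>\<^bsub>H\<lparr>carrier := K\<rparr>\<^esub> h) x = act g (act h x)" using act_mult gx KH by auto
  qed (use SV in auto)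
  then show ?thesis using finS subgroup.one_closed[OF S] by (simp add: order_def)
qed

text \<open>The means of excluding invariant subspaces: in dimension \<open>k\<close> the order of
  \<open>x\<close> has to divide \<open>p ^ k - 1\<close>.\<close>

lemma stable_ord_dvd:
  assumes x: "x \<in> carrier H" and S: "subgroup S V" and stable: "\<And>s. s \<in> S \<Longrightarrow> act x s \<in> S"
  shows "H.ord x dvd card S - 1"
proof -
  have SV: "S \<subseteq> carrier V" using S subgroup.subset by blast
  have "card (generate H {x}) dvd card S - 1"
  proof (rule subgroup_stable_dvd[OF _ S])
    show "subgroup (generate H {x}) H" using x H.generate_is_subgroup by simp
    show "\<And>h s. h \<in> generate H {x} \<Longrightarrow> s \<in> S \<Longrightarrow> act h s \<in> S"
      unfolding H.generate_pow_on_finite_carrier[OF finH x]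
      using act_pow_closed[OF x stable SV] by auto
  qed
  then show ?thesis using H.generate_pow_card[OF x] by simp
qed

lemma order_H_dvd: "order H dvd order V - 1"
  using subgroup_stable_dvd[OF H.subgroup_self V.subgroup_self] by (simp add: order_def)

lemma ord_V: "v \<in> carrier V \<Longrightarrow> v \<noteq> \<one>\<^bsub>V\<^esub> \<Longrightarrow> V.ord v = p"
  using V.ord_prime_iff prime_p exponent by blast

lemma subgroup_card_power:
  assumes S: "subgroup S V"
  shows "\<exists>k. card S = p ^ k"
proof (rule only_prime_divisor_imp_power[OF _ prime_p])
  have finS: "finite S" using S finV subgroup.subset finite_subset by metis
  then show "card S > 0" using S subgroup.one_closed by (metis card_gt_0_iff empty_iff)
  fix r assume r: "prime r" "r dvd card S"
  have "\<exists>x\<in>carrier (V\<lparr>carrier := S\<rparr>). group.ord (V\<lparr>carrier := S\<rparr>) x = r"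
    by (rule group.cauchy) (use V.subgroup_imp_group[OF S] finS r in \<open>auto simp: order_def\<close>)
  then obtain x where x: "x \<in> S" "V.ord x = r" using V.ord_subgroup[OF S] by auto
  then have "x \<noteq> \<one>\<^bsub>V\<^esub>" using r(1) by auto
  then show "r = p" using ord_V x S subgroup.mem_carrier by metis
qed

lemma order_V: "\<exists>m. order V = p ^ m"
  using subgroup_card_power[OF V.subgroup_self] by (simp add: order_def)

lemma p_not_dvd: "\<not> p dvd order H"
proof
  assume "p dvd order H"
  then have d: "p dvd order V - 1" using order_H_dvd dvd_trans by blast
  obtain v where "v \<in> carrier V" "v \<noteq> \<one>\<^bsub>V\<^esub>" using nonzero_exists .
  then have "p dvd order V" using V.ord_dvd_group_order ord_V by metis
  moreover have "order V > 0" using finV V.order_gt_0_iff_finite by blast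
  ultimately have "p dvd 1" using d by (metis dvd_diffD1 Suc_leI One_nat_def)
  then show False using prime_p by auto
qed

lemma pow_int_V_one_iff:
  assumes "v \<in> carrier V" "v \<noteq> \<one>\<^bsub>V\<^esub>"
  shows "v [^]\<^bsub>V\<^esub> (k::int) = \<one>\<^bsub>V\<^esub> \<longleftrightarrow> int p dvd k"
  using V.int_pow_eq_id[of v k] ord_V assms by simp

lemma square_eq_mult: "x \<in> carrier H \<Longrightarrow> x [^] (2::nat) = x \<otimes> x"
  by (simp add: numeral_2_eq_2)

text \<open>The sum of \<open>v\<close> and \<open>act t v\<close> is fixed by \<open>t\<close>,
  hence zero. So an involution is -1 on \<open>V\<close>, which makes it unique and central.\<close>

lemma involution_act:
  assumes t: "t \<in> carrier H" "H.ord t = 2" and v: "v \<in> carrier V"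
  shows "act t v = inv\<^bsub>V\<^esub> v"
proof -
  have "t \<otimes> t = \<one>" "t \<noteq> \<one>"
    using t H.ord_prime_iff[of t 2] by (auto simp: square_eq_mult)
  then have "act t (v \<otimes>\<^bsub>V\<^esub> act t v) = v \<otimes>\<^bsub>V\<^esub> act t v"
    using act_mult[of t t v] t v V.m_comm by simp
  then have "v \<otimes>\<^bsub>V\<^esub> act t v = \<one>\<^bsub>V\<^esub>"
    using free[of t "v \<otimes>\<^bsub>V\<^esub> act t v"] t v \<open>t \<noteq> \<one>\<close> by auto
  then show ?thesis using t v by (metis V.inv_equality V.m_comm act_closed)
qed

lemma involution_unique:
  assumes "t \<in> carrier H" "H.ord t = 2" "s \<in> carrier H" "H.ord s = 2"
  shows "s = t"
proof -
  obtain v where "v \<in> carrier V" "v \<noteq> \<one>\<^bsub>V\<^esub>" using nonzero_exists .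
  then show ?thesis using act_eqD[of s t v] involution_act assms by simp
qed

lemma act_extI:
  assumes "h \<in> carrier H" "k \<in> carrier H" "\<And>v. v \<in> carrier V \<Longrightarrow> act h v = act k v"
  shows "h = k"
  using nonzero_exists act_eqD assms by metis

lemma square_eq_one:
  assumes "t \<in> carrier H" "H.ord t = 2" "x \<in> carrier H" "x \<otimes> x = \<one>"
  shows "x = \<one> \<or> x = t"
  using involution_unique[OF assms(1,2,3)] H.ord_prime_iff[of x 2] assms(3,4)
  by (auto simp: square_eq_mult)

lemma involution_central:
  assumes "t \<in> carrier H" "H.ord t = 2" "x \<in> carrier H"
  shows "t \<otimes> x = x \<otimes> t"
  using assms by (intro act_extI) (auto simp: act_mult involution_act)

section \<open>Norms, and commuting elements of prime order\<close>

lemma finprod_shift: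
  assumes "\<And>k. f k \<in> carrier V"
  shows "finprod V (\<lambda>k. f (Suc k)) {..<n::nat} \<otimes>\<^bsub>V\<^esub> f 0 = finprod V f {..<n} \<otimes>\<^bsub>V\<^esub> f n"
proof (induction n)
  case (Suc n)
  let ?A = "finprod V (\<lambda>k. f (Suc k)) {..<n}" and ?B = "finprod V f {..<n}"
  have c: "?A \<in> carrier V" "?B \<in> carrier V" using assms by auto
  have "finprod V (\<lambda>k. f (Suc k)) {..<Suc n} \<otimes>\<^bsub>V\<^esub> f 0 = f (Suc n) \<otimes>\<^bsub>V\<^esub> (?A \<otimes>\<^bsub>V\<^esub> f 0)"
    using assms c by (simp add: lessThan_Suc V.m_assoc)
  also have "\<dots> = f (Suc n) \<otimes>\<^bsub>V\<^esub> (?B \<otimes>\<^bsub>V\<^esub> f n)" using Suc by simp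
  also have "\<dots> = finprod V f {..<Suc n} \<otimes>\<^bsub>V\<^esub> f (Suc n)"
    using assms c by (simp add: lessThan_Suc V.m_ac)
  finally show ?case .
qed (use assms in simp)

lemma finprod_swap:
  assumes "\<And>i k. f i k \<in> carrier V"
  shows "finprod V (\<lambda>i. finprod V (\<lambda>k. f i k) {..<m}) {..<n::nat} =
         finprod V (\<lambda>k. finprod V (\<lambda>i. f i k) {..<n}) {..<m::nat}"
proof (induction n)
  case (Suc n)
  have "finprod V (\<lambda>k. finprod V (\<lambda>i. f i k) {..<Suc n}) {..<m} =
        finprod V (\<lambda>k. f n k \<otimes>\<^bsub>V\<^esub> finprod V (\<lambda>i. f i k) {..<n}) {..<m}"
    using assms by (simp add: lessThan_Suc)
  also have "\<dots> = finprod V (\<lambda>k. f n k) {..<m} \<otimes>\<^bsub>V\<^esub> finprod V (\<lambda>k. finprod V (\<lambda>i. f i k) {..<n}) {..<m}"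
    using assms by (intro V.finprod_multf) auto
  finally show ?case using Suc assms by (simp add: lessThan_Suc)
qed (simp add: V.finprod_one_eqI)

lemma act_finprod:
  assumes "h \<in> carrier H" "\<And>k. f k \<in> carrier V"
  shows "act h (finprod V f {..<n::nat}) = finprod V (\<lambda>k. act h (f k)) {..<n}"
  using assms by (induction n) (auto simp: lessThan_Suc)

text \<open>Applying \<open>h\<close> shifts the factors of the norm cyclically, so the norm is a
  fixed point of \<open>h\<close>.\<close>

lemma norm_trivial:
  assumes h: "h \<in> carrier H" "h [^] n = \<one>" "h \<noteq> \<one>" and v: "v \<in> carrier V"
  shows "finprod V (\<lambda>k. act (h [^] k) v) {..<n::nat} = \<one>\<^bsub>V\<^esub>" (is "?N = _")
proof -
  have N: "?N \<in> carrier V" using h v by auto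
  have "act h ?N = finprod V (\<lambda>k. act (h [^] Suc k) v) {..<n}"
    using h v by (simp add: act_finprod act_mult[symmetric] H.nat_pow_Suc2[symmetric] del: H.nat_pow_Suc nat_pow_Suc)
  moreover have "finprod V (\<lambda>k. act (h [^] Suc k) v) {..<n} \<otimes>\<^bsub>V\<^esub> v = ?N \<otimes>\<^bsub>V\<^esub> v"
    using finprod_shift[of "\<lambda>k. act (h [^] k) v" n] h v by simp
  ultimately have "act h ?N = ?N" using N h v V.right_cancel[of v "act h ?N" ?N] by simp
  then show ?thesis using free h N by blast
qed

text \<open>Otherwise summing \<open>(y x\<^sup>i)\<^sup>k v\<close> over all \<open>i, k < q\<close> in both orders gives \<open>q v = 0\<close>.\<close>

lemma commuting_prime_order:
  assumes x: "x \<in> carrier H" "H.ord x = q" and y: "y \<in> carrier H" "y [^] q = \<one>"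
    and comm: "x \<otimes> y = y \<otimes> x" and q: "prime q"
  shows "\<exists>k<q. y = x [^] (k::nat)"
proof (rule ccontr)
  assume not: "\<not> ?thesis"
  have q1: "q > 1" using q prime_gt_1_nat by blast
  have xq: "x [^] q = \<one>" using x H.pow_ord_eq_1 by auto
  have notpow: "y \<noteq> x [^] k" for k :: nat
  proof
    assume "y = x [^] k"
    moreover have "x [^] k = x [^] (k mod q)"
      using H.pow_mod_exponent[OF x(1) xq] .
    ultimately show False using not q1 by (metis mod_less_divisor less_trans zero_less_one)
  qed
  obtain v where v: "v \<in> carrier V" "v \<noteq> \<one>\<^bsub>V\<^esub>" using nonzero_exists .
  define f where "f i k = act ((y \<otimes> x [^] i) [^] k) v" for i k :: nat
  have fc: "f i k \<in> carrier V" for i k using x y v by (auto simp: f_def)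
  have commp: "y \<otimes> x [^] i = x [^] i \<otimes> y" for i :: nat
    using H.group_commutes_pow[OF comm x(1) y(1), of i] by simp
  have pw: "(y \<otimes> x [^] i) [^] k = y [^] k \<otimes> (x [^] k) [^] i" for i k :: nat
    using H.pow_mult_distrib[OF commp] x y by (simp add: H.nat_pow_pow mult.commute)
  \<comment> \<open>Since \<open>y\<close> is not a power of \<open>x\<close>, each product of
    \<open>y\<close> with a power of \<open>x\<close> is a nonidentity element whose
    \<open>q\<close>-th power is one, and its norm vanishes.\<close>
  have one: "finprod V (\<lambda>k. f i k) {..<q} = \<one>\<^bsub>V\<^esub>" for i
    unfolding f_def
  proof (rule norm_trivial)
    show "(y \<otimes> x [^] i) [^] q = \<one>" using pw[of i q] y xq by simp
    show "y \<otimes> x [^] i \<noteq> \<one>"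
    proof
      assume "y \<otimes> x [^] i = \<one>"
      then have "y = inv (x [^] i)" using x y by (metis H.inv_equality H.nat_pow_closed)
      moreover have "x [^] ((q - 1) * i) \<otimes> x [^] i = \<one>"
      proof -
        have "(q - 1) * i + i = q * i" using q1 by (cases q) auto
        then have "x [^] ((q - 1) * i) \<otimes> x [^] i = x [^] (q * i)"
          using H.nat_pow_mult[OF x(1), of "(q - 1) * i" i] by (simp only:)
        also have "\<dots> = (x [^] q) [^] i"
          by (rule H.nat_pow_pow[OF x(1), symmetric])
        finally show ?thesis using xq by simp
      qed
      ultimately have "y = x [^] ((q - 1) * i)" using x by (metis H.inv_equality H.nat_pow_closed)
      then show False using notpow by blast
    qed
  qed (use x y v in auto)
  \<comment> \<open>For \<open>k\<close> between 0 and \<open>q\<close>, the sum over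
    \<open>i\<close> is \<open>y [^] k\<close> applied to the norm of \<open>v\<close> under
    \<open>x [^] k\<close>. So only \<open>k = 0\<close> survives, contributing \<open>v\<close>
    once for each of the \<open>q\<close> values of \<open>i\<close>.\<close>
  have zero: "finprod V (\<lambda>i. f i k) {..<q} = \<one>\<^bsub>V\<^esub>" if k: "0 < k" "k < q" for k
  proof -
    have "x [^] k \<noteq> \<one>" using H.pow_eq_id[OF x(1), of k] x(2) k nat_dvd_not_less by blast
    then have "finprod V (\<lambda>i. act ((x [^] k) [^] i) v) {..<q} = \<one>\<^bsub>V\<^esub>"
    proof (intro norm_trivial)
      have "(x [^] k) [^] q = (x [^] q) [^] k"
        using x(1) by (simp only: H.nat_pow_pow mult.commute)
      then show "(x [^] k) [^] q = \<one>" using xq by simp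
    qed (use x v in auto)
    then have "act (y [^] k) (finprod V (\<lambda>i. act ((x [^] k) [^] i) v) {..<q}) = \<one>\<^bsub>V\<^esub>"
      using y by simp
    moreover have "f i k = act (y [^] k) (act ((x [^] k) [^] i) v)" for i
      unfolding f_def pw using x y v by (simp add: act_mult)
    ultimately show ?thesis using x y v by (simp add: act_finprod)
  qed
  have "\<one>\<^bsub>V\<^esub> = finprod V (\<lambda>i. finprod V (\<lambda>k. f i k) {..<q}) {..<q}"
    using one by (simp add: V.finprod_one_eqI)
  also have "\<dots> = finprod V (\<lambda>k. finprod V (\<lambda>i. f i k) {..<q}) {..<q}"
    by (rule finprod_swap) (rule fc)
  also have "{..<q} = insert 0 {0<..<q}" using q1 by auto
  also have "finprod V (\<lambda>k. finprod V (\<lambda>i. f i k) (insert 0 {0<..<q})) (insert 0 {0<..<q})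
      = finprod V (\<lambda>i. f i 0) {..<q} \<otimes>\<^bsub>V\<^esub> finprod V (\<lambda>k. finprod V (\<lambda>i. f i k) {..<q}) {0<..<q}"
  proof -
    have "insert 0 {0<..<q} = {..<q}" using q1 by auto
    then show ?thesis using fc by (subst V.finprod_insert) auto
  qed
  also have "finprod V (\<lambda>k. finprod V (\<lambda>i. f i k) {..<q}) {0<..<q} = \<one>\<^bsub>V\<^esub>"
    by (rule V.finprod_one_eqI) (use zero in auto)
  also have "finprod V (\<lambda>i. f i 0) {..<q} = v [^]\<^bsub>V\<^esub> q"
    using V.finprod_const[of v "{..<q}"] x y v by (simp add: f_def)
  finally have "v [^]\<^bsub>V\<^esub> q = \<one>\<^bsub>V\<^esub>" using v by simp
  then have "p dvd q" using V.pow_eq_id[of v q] v ord_V by simp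
  then have "p = q" using q prime_p primes_dvd_imp_eq by blast
  moreover have "q dvd order H" using x H.ord_dvd_group_order by blast
  ultimately show False using p_not_dvd by simp
qed

text \<open>By \<open>commuting_prime_order\<close> a commutative subgroup has at most
  \<open>q\<close> roots of prime exponent \<open>q\<close>, so it is cyclic by
  \<open>card_generators\<close>.\<close>

lemma card_generators_commuting:
  assumes Z: "subgroup Z H" and comm: "\<And>x y. x \<in> Z \<Longrightarrow> y \<in> Z \<Longrightarrow> x \<otimes> y = y \<otimes> x"
  shows "card {z \<in> Z. H.ord z = card Z} = totient (card Z)"
proof -
  have ZH: "Z \<subseteq> carrier H" using Z subgroup.subset by blast
  have finZ: "finite Z" using ZH finH finite_subset by blast
  interpret Z: comm_group "H\<lparr>carrier := Z\<rparr>"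
    by (rule group.group_comm_groupI[OF H.subgroup_imp_group[OF Z]]) (simp, rule comm)
  have "card {x \<in> carrier (H\<lparr>carrier := Z\<rparr>). Z.ord x = order (H\<lparr>carrier := Z\<rparr>)} = totient (order (H\<lparr>carrier := Z\<rparr>))"
  proof (rule Z.card_generators)
    show "finite (carrier (H\<lparr>carrier := Z\<rparr>))" using finZ by simp
    fix q :: nat assume q: "prime q"
    let ?R = "{x \<in> Z. x [^] q = \<one>}"
    have "card ?R \<le> q"
    proof (cases "?R \<subseteq> {\<one>}")
      case True
      then have "card ?R \<le> 1" using card_mono[of "{\<one>}" ?R] by simp
      then show ?thesis using prime_gt_1_nat[OF q] by simp
    next
      case False
      then obtain x where x: "x \<in> Z" "x [^] q = \<one>" "x \<noteq> \<one>" by blast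
      then have "H.ord x = q" using H.ord_prime_iff q ZH by blast
      then have "?R \<subseteq> (\<lambda>k. x [^] k) ` {..<q}"
        using commuting_prime_order[of x q] x(1) ZH comm[OF x(1)] q by blast
      then have "card ?R \<le> card ((\<lambda>k. x [^] k) ` {..<q})" by (intro card_mono) auto
      also have "\<dots> \<le> q" using card_image_le[of "{..<q}"] by simp
      finally show ?thesis .
    qed
    moreover have "x [^]\<^bsub>H\<lparr>carrier := Z\<rparr>\<^esub> q = x [^] q" for x
      by (rule H.nat_pow_consistent[symmetric])
    ultimately show "card {x \<in> carrier (H\<lparr>carrier := Z\<rparr>). x [^]\<^bsub>H\<lparr>carrier := Z\<rparr>\<^esub> q = \<one>\<^bsub>H\<lparr>carrier := Z\<rparr>\<^esub>} \<le> q"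
      by simp
  qed
  then show ?thesis using H.ord_subgroup[OF Z] by (simp add: order_def)
qed


section \<open>Scalars, invariant lines and planes\<close>

text \<open>The integer \<open>k\<close> represents a residue modulo \<open>p\<close>. One
  \<open>k\<close> has to serve all vectors; by \<open>nonscalarE\<close>, multipliers depending on
  the vector would give the same notion.\<close>

definition scalar :: "'h \<Rightarrow> bool" where
  "scalar h \<longleftrightarrow> h \<in> carrier H \<and> (\<exists>k::int. \<forall>w\<in>carrier V. act h w = w [^]\<^bsub>V\<^esub> k)"

lemma scalar_carrier: "scalar h \<Longrightarrow> h \<in> carrier H"
  by (simp add: scalar_def)

lemma scalar_commute:
  assumes "scalar h" "k \<in> carrier H"
  shows "h \<otimes> k = k \<otimes> h"
proof -
  obtain e :: int where "\<And>w. w \<in> carrier V \<Longrightarrow> act h w = w [^]\<^bsub>V\<^esub> e" "h \<in> carrier H"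
    using assms(1) by (auto simp: scalar_def)
  then show ?thesis using assms(2) by (intro act_extI) (auto simp: act_mult)
qed

lemma int_pow_invertible:
  assumes w: "w \<in> carrier V" and i: "\<not> int p dvd i"
  shows "\<exists>b::int. w = (w [^]\<^bsub>V\<^esub> i) [^]\<^bsub>V\<^esub> b"
proof (cases "w = \<one>\<^bsub>V\<^esub>")
  case False
  have "coprime (int p) i" using prime_p i by (simp add: prime_imp_coprime)
  then obtain a b where "a * int p + b * i = 1" using bezout_int[of "int p" i] by auto
  then have ab: "b * i - 1 = int p * (- a)" by (simp add: algebra_simps)
  have "w [^]\<^bsub>V\<^esub> (b * i) = w [^]\<^bsub>V\<^esub> (1::int)"
    using V.int_pow_eq[of w "1" "b * i"] ord_V[OF w False] w ab by simp
  then show ?thesis using w by (intro exI[of _ b]) (simp add: V.int_pow_pow mult.commute)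
qed (auto intro!: exI[of _ 0])

lemma span_subgroup:
  assumes v: "v \<in> carrier V" and u: "u \<in> carrier V"
  shows "subgroup {v [^]\<^bsub>V\<^esub> i \<otimes>\<^bsub>V\<^esub> u [^]\<^bsub>V\<^esub> j | (i::int) (j::int). True} V" (is "subgroup ?S V")
    and "v \<in> {v [^]\<^bsub>V\<^esub> i \<otimes>\<^bsub>V\<^esub> u [^]\<^bsub>V\<^esub> j | (i::int) (j::int). True}"
    and "u \<in> {v [^]\<^bsub>V\<^esub> i \<otimes>\<^bsub>V\<^esub> u [^]\<^bsub>V\<^esub> j | (i::int) (j::int). True}"
proof -
  have SI: "v [^]\<^bsub>V\<^esub> i \<otimes>\<^bsub>V\<^esub> u [^]\<^bsub>V\<^esub> j \<in> ?S" for i j :: int by auto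
  show "v \<in> ?S" "u \<in> ?S" using SI[of 1 0] SI[of 0 1] v u by simp_all
  show "subgroup ?S V"
  proof (rule V.subgroupI)
    show "?S \<subseteq> carrier V" using v u by auto
    show "?S \<noteq> {}" using SI by blast
    fix x assume "x \<in> ?S"
    then obtain i j :: int where x: "x = v [^]\<^bsub>V\<^esub> i \<otimes>\<^bsub>V\<^esub> u [^]\<^bsub>V\<^esub> j" by auto
    have "inv\<^bsub>V\<^esub> x = v [^]\<^bsub>V\<^esub> (- i) \<otimes>\<^bsub>V\<^esub> u [^]\<^bsub>V\<^esub> (- j)"
      unfolding x using v u by (simp add: V.inv_mult V.int_pow_neg)
    then show "inv\<^bsub>V\<^esub> x \<in> ?S" using SI by simp
    fix y assume "y \<in> ?S"
    then obtain i' j' :: int where y: "y = v [^]\<^bsub>V\<^esub> i' \<otimes>\<^bsub>V\<^esub> u [^]\<^bsub>V\<^esub> j'" by auto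
    have "x \<otimes>\<^bsub>V\<^esub> y = v [^]\<^bsub>V\<^esub> (i + i') \<otimes>\<^bsub>V\<^esub> u [^]\<^bsub>V\<^esub> (j + j')"
      unfolding x y using v u by (simp add: V.int_pow_mult V.m_ac)
    then show "x \<otimes>\<^bsub>V\<^esub> y \<in> ?S" using SI by simp
  qed
qed

lemma inv_cross_mult:
  assumes "A \<in> carrier V" "B \<in> carrier V" "C \<in> carrier V" "D \<in> carrier V"
    and "A \<otimes>\<^bsub>V\<^esub> B = C \<otimes>\<^bsub>V\<^esub> D"
  shows "B \<otimes>\<^bsub>V\<^esub> inv\<^bsub>V\<^esub> D = inv\<^bsub>V\<^esub> A \<otimes>\<^bsub>V\<^esub> C"
proof -
  have "B = inv\<^bsub>V\<^esub> A \<otimes>\<^bsub>V\<^esub> (C \<otimes>\<^bsub>V\<^esub> D)" using assms V.inv_solve_left by auto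
  then show ?thesis using assms V.inv_solve_right'[of "inv\<^bsub>V\<^esub> A \<otimes>\<^bsub>V\<^esub> C" B D] by (simp add: V.m_assoc)
qed

text \<open>A linear map with every vector an eigenvector is scalar: for independent
  \<open>v\<close> and \<open>w\<close>, the eigenvalues of \<open>v\<close>, \<open>w\<close> and
  their sum agree. The \<open>v\<close> obtained is independent of its image.\<close>

lemma nonscalarE:
  assumes h: "h \<in> carrier H" "\<not> scalar h"
  obtains v where "v \<in> carrier V" "\<And>k::int. act h v \<noteq> v [^]\<^bsub>V\<^esub> k"
proof -
  have "\<exists>v\<in>carrier V. \<forall>k::int. act h v \<noteq> v [^]\<^bsub>V\<^esub> k"
  proof (rule ccontr)
    assume "\<not> ?thesis"
    then have ev: "\<exists>k::int. act h v = v [^]\<^bsub>V\<^esub> k" if "v \<in> carrier V" for v using that by blast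
    obtain v where v: "v \<in> carrier V" "v \<noteq> \<one>\<^bsub>V\<^esub>" using nonzero_exists .
    obtain k :: int where k: "act h v = v [^]\<^bsub>V\<^esub> k" using ev v by blast
    have "act h w = w [^]\<^bsub>V\<^esub> k" if w: "w \<in> carrier V" for w
    proof (cases "\<exists>i::int. w = v [^]\<^bsub>V\<^esub> i")
      case True
      then show ?thesis using h v k by (auto simp: V.int_pow_pow mult.commute)
    next
      case False
      obtain j :: int where j: "act h w = w [^]\<^bsub>V\<^esub> j" using ev w by blast
      obtain l :: int where l: "act h (v \<otimes>\<^bsub>V\<^esub> w) = (v \<otimes>\<^bsub>V\<^esub> w) [^]\<^bsub>V\<^esub> l" using ev v w by blast
      have "v [^]\<^bsub>V\<^esub> k \<otimes>\<^bsub>V\<^esub> w [^]\<^bsub>V\<^esub> j = v [^]\<^bsub>V\<^esub> l \<otimes>\<^bsub>V\<^esub> w [^]\<^bsub>V\<^esub> l"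
        using l h v w k j by (simp add: V.int_pow_distrib)
      then have "w [^]\<^bsub>V\<^esub> j \<otimes>\<^bsub>V\<^esub> inv\<^bsub>V\<^esub> (w [^]\<^bsub>V\<^esub> l) = inv\<^bsub>V\<^esub> (v [^]\<^bsub>V\<^esub> k) \<otimes>\<^bsub>V\<^esub> v [^]\<^bsub>V\<^esub> l"
        using v w by (intro inv_cross_mult) auto
      \<comment> \<open>A multiple of \<open>w\<close> equals a multiple of \<open>v\<close>; by
        independence both coefficients vanish modulo \<open>p\<close>.\<close>
      then have eq: "w [^]\<^bsub>V\<^esub> (j - l) = v [^]\<^bsub>V\<^esub> (l - k)"
        using v w by (simp add: V.int_pow_diff V.m_comm)
      have "w \<noteq> \<one>\<^bsub>V\<^esub>" using False by (metis int_pow_0)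
      have "int p dvd j - l"
      proof (rule ccontr)
        assume "\<not> int p dvd j - l"
        then obtain b :: int where "w = (w [^]\<^bsub>V\<^esub> (j - l)) [^]\<^bsub>V\<^esub> b"
          using int_pow_invertible[OF w] by blast
        then have "w = v [^]\<^bsub>V\<^esub> ((l - k) * b)" unfolding eq using v by (simp add: V.int_pow_pow)
        then show False using False by blast
      qed
      then have "w [^]\<^bsub>V\<^esub> (j - l) = \<one>\<^bsub>V\<^esub>"
        using pow_int_V_one_iff w \<open>w \<noteq> _\<close> by blast
      then have "int p dvd l - k" using eq pow_int_V_one_iff[OF v, of "l - k"] by simp
      then have "int p dvd j - k" using \<open>int p dvd j - l\<close> by (metis diff_add_cancel dvd_add add_diff_eq)
      then show ?thesis using j V.int_pow_eq[OF w, of k j] ord_V[OF w \<open>w \<noteq> _\<close>] by simp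
    qed
    then show False using h by (auto simp: scalar_def)
  qed
  then show ?thesis using that by blast
qed

text \<open>A scalar maps each line to itself, and a line has \<open>p - 1\<close> nonzero
  vectors.\<close>

lemma scalar_ord_dvd:
  assumes "scalar h"
  shows "H.ord h dvd p - 1"
proof -
  obtain e :: int where e: "\<And>w. w \<in> carrier V \<Longrightarrow> act h w = w [^]\<^bsub>V\<^esub> e" and h: "h \<in> carrier H"
    using assms(1) by (auto simp: scalar_def)
  obtain v where v: "v \<in> carrier V" "v \<noteq> \<one>\<^bsub>V\<^esub>" using nonzero_exists .
  have S: "subgroup (generate V {v}) V" using v V.generate_is_subgroup by simp
  have "H.ord h dvd card (generate V {v}) - 1"
  proof (rule stable_ord_dvd[OF h S])
    fix s assume s: "s \<in> generate V {v}"
    then have "act h s = s [^]\<^bsub>V\<^esub> e" using e S subgroup.mem_carrier by metis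
    then show "act h s \<in> generate V {v}" using s V.subgroup_int_pow_closed[OF S] by simp
  qed
  then show ?thesis using V.generate_pow_card v ord_V by metis
qed

lemma card_scalars_le: "card {h. scalar h} \<le> p - 1"
proof -
  obtain v where v: "v \<in> carrier V" "v \<noteq> \<one>\<^bsub>V\<^esub>" using nonzero_exists .
  have S: "subgroup (generate V {v}) V" using v V.generate_is_subgroup by simp
  have fin: "finite (generate V {v})" using S finV subgroup.subset finite_subset by metis
  have "card {h. scalar h} \<le> card (generate V {v} - {\<one>\<^bsub>V\<^esub>})"
  proof (rule card_inj_on_le[where f = "\<lambda>h. act h v"])
    show "inj_on (\<lambda>h. act h v) {h. scalar h}"
      using act_eqD v by (auto intro!: inj_onI simp: scalar_def)
    show "(\<lambda>h. act h v) ` {h. scalar h} \<subseteq> generate V {v} - {\<one>\<^bsub>V\<^esub>}"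
    proof
      fix w assume "w \<in> (\<lambda>h. act h v) ` {h. scalar h}"
      then obtain h where h: "scalar h" "w = act h v" by blast
      then obtain e :: int where "w = v [^]\<^bsub>V\<^esub> e" using v by (auto simp: scalar_def)
      moreover have "w \<noteq> \<one>\<^bsub>V\<^esub>"
        using h scalar_carrier act_cancel[of h v "\<one>\<^bsub>V\<^esub>"] v by auto
      ultimately show "w \<in> generate V {v} - {\<one>\<^bsub>V\<^esub>}"
        using V.generate_pow[OF v(1)] by auto
    qed
  qed (use fin in auto)
  also have "\<dots> = p - 1"
    using fin S subgroup.one_closed[OF S] V.generate_pow_card[OF v(1)] ord_V v by simp
  finally show ?thesis .
qed

text \<open>With \<open>V\<close> cyclic over the subring generated by \<open>a\<close>, elements commuting with \<open>a\<close> act as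
  endomorphisms from the bicommutant of \<open>a\<close>, which is commutative.\<close>

lemma centralizer_commutative:
  assumes a: "a \<in> carrier H" and v: "v \<in> carrier V" "v \<noteq> \<one>\<^bsub>V\<^esub>"
    and gen: "\<And>S. subgroup S V \<Longrightarrow> v \<in> S \<Longrightarrow> (\<And>s. s \<in> S \<Longrightarrow> act a s \<in> S) \<Longrightarrow> S = carrier V"
    and h: "h \<in> carrier H" "h \<otimes> a = a \<otimes> h"
    and k: "k \<in> carrier H" "k \<otimes> a = a \<otimes> k"
  shows "h \<otimes> k = k \<otimes> h"
proof -
  \<comment> \<open>\<open>cent\<close> is the centralizer of \<open>a\<close> among the
    endomorphisms and \<open>bic\<close> the centralizer of \<open>cent\<close>. The images of
    \<open>v\<close> under \<open>bic\<close> form a subgroup containing \<open>v\<close> and stable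
    under \<open>a\<close>, hence all of \<open>V\<close>.\<close>
  define cent where "cent f \<longleftrightarrow> f \<in> hom V V \<and> (\<forall>w\<in>carrier V. f (act a w) = act a (f w))" for f
  define bic where "bic f \<longleftrightarrow> f \<in> hom V V \<and> (\<forall>g. cent g \<longrightarrow> (\<forall>w\<in>carrier V. f (g w) = g (f w)))" for f
  define S where "S = {f v | f. bic f}"
  have homD: "f w \<in> carrier V" "f (w \<otimes>\<^bsub>V\<^esub> u) = f w \<otimes>\<^bsub>V\<^esub> f u" if "f \<in> hom V V" "w \<in> carrier V" "u \<in> carrier V" for f w u
    using that by (auto simp: hom_def)
  have gh: "group_hom V V f" if "f \<in> hom V V" for f
    using that by unfold_locales
  have hinv: "f (inv\<^bsub>V\<^esub> w) = inv\<^bsub>V\<^esub> (f w)" "f \<one>\<^bsub>V\<^esub> = \<one>\<^bsub>V\<^esub>" if "f \<in> hom V V" "w \<in> carrier V" for f w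
    using group_hom.hom_inv[OF gh] group_hom.hom_one[OF gh] that by auto
  have acthom: "act g \<in> hom V V" if "g \<in> carrier H" for g
    using that by (auto simp: hom_def)
  have cent_act: "cent (act g)" if "g \<in> carrier H" "g \<otimes> a = a \<otimes> g" for g
    using that a acthom unfolding cent_def by (auto simp: act_mult[symmetric])
  have cent_a: "cent (act a)" using cent_act a by simp
  have sub: "subgroup S V"
  proof (rule V.subgroupI)
    show "S \<subseteq> carrier V" using homD v unfolding S_def bic_def by auto
    have "bic (\<lambda>w. w)" by (auto simp: bic_def hom_def)
    then show "S \<noteq> {}" by (auto simp: S_def)
    fix x assume "x \<in> S"
    then obtain f where f: "bic f" "x = f v" by (auto simp: S_def)
    have fh: "f \<in> hom V V" and fc: "\<And>g w. cent g \<Longrightarrow> w \<in> carrier V \<Longrightarrow> f (g w) = g (f w)"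
      using f(1) by (auto simp: bic_def)
    have "bic (\<lambda>w. inv\<^bsub>V\<^esub> (f w))"
      unfolding bic_def
    proof (intro conjI allI impI ballI)
      show "(\<lambda>w. inv\<^bsub>V\<^esub> (f w)) \<in> hom V V"
        using homD[OF fh] by (auto simp: hom_def V.inv_mult)
      fix g w assume g: "cent g" and w: "w \<in> carrier V"
      have "g \<in> hom V V" using g by (simp add: cent_def)
      then have "g (inv\<^bsub>V\<^esub> (f w)) = inv\<^bsub>V\<^esub> (g (f w))" using hinv(1) homD(1)[OF fh w w] by blast
      then show "inv\<^bsub>V\<^esub> (f (g w)) = g (inv\<^bsub>V\<^esub> (f w))" using fc[OF g w] by simp
    qed
    then show "inv\<^bsub>V\<^esub> x \<in> S" using f by (auto simp: S_def)
    fix y assume "y \<in> S"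
    then obtain g where g: "bic g" "y = g v" by (auto simp: S_def)
    have gh': "g \<in> hom V V" and gc: "\<And>c w. cent c \<Longrightarrow> w \<in> carrier V \<Longrightarrow> g (c w) = c (g w)"
      using g(1) by (auto simp: bic_def)
    have "bic (\<lambda>w. f w \<otimes>\<^bsub>V\<^esub> g w)"
      unfolding bic_def
    proof (intro conjI allI impI ballI)
      show "(\<lambda>w. f w \<otimes>\<^bsub>V\<^esub> g w) \<in> hom V V"
        using homD[OF fh] homD[OF gh'] by (auto simp: hom_def V.m_ac)
      fix c w assume c: "cent c" and w: "w \<in> carrier V"
      have "c \<in> hom V V" using c by (simp add: cent_def)
      then have "c (f w \<otimes>\<^bsub>V\<^esub> g w) = c (f w) \<otimes>\<^bsub>V\<^esub> c (g w)"
        using homD(2) homD(1)[OF fh w w] homD(1)[OF gh' w w] by blast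
      then show "f (c w) \<otimes>\<^bsub>V\<^esub> g (c w) = c (f w \<otimes>\<^bsub>V\<^esub> g w)" using fc[OF c w] gc[OF c w] by simp
    qed
    then show "x \<otimes>\<^bsub>V\<^esub> y \<in> S" using f g by (auto simp: S_def)
  qed
  have "v \<in> S"
  proof -
    have "bic (\<lambda>w. w)" by (auto simp: bic_def hom_def)
    then show ?thesis by (auto simp: S_def)
  qed
  moreover have "act a s \<in> S" if s: "s \<in> S" for s
  proof -
    obtain f where f: "bic f" "s = f v" using s by (auto simp: S_def)
    have fh: "f \<in> hom V V" and fc: "\<And>g w. cent g \<Longrightarrow> w \<in> carrier V \<Longrightarrow> f (g w) = g (f w)"
      using f(1) by (auto simp: bic_def)
    have "bic (\<lambda>w. act a (f w))"
      unfolding bic_def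
    proof (intro conjI allI impI ballI)
      show "(\<lambda>w. act a (f w)) \<in> hom V V"
        using homD[OF fh] a by (auto simp: hom_def)
      fix c w assume c: "cent c" and w: "w \<in> carrier V"
      then show "act a (f (c w)) = c (act a (f w))"
        using fc[OF c w] homD(1)[OF fh w w] by (simp add: cent_def)
    qed
    then show ?thesis using f by (auto simp: S_def)
  qed
  ultimately have SV: "S = carrier V" using gen[OF sub] by blast
  have "act h v \<in> S" using SV v h by simp
  then obtain f where f: "bic f" "act h v = f v" unfolding S_def by blast
  have "act k v \<in> S" using SV v k by simp
  then obtain g where g: "bic g" "act k v = g v" unfolding S_def by blast
  have fb: "f (c w) = c (f w)" if "cent c" "w \<in> carrier V" for c w
    by (rule f(1)[unfolded bic_def, THEN conjunct2, rule_format, OF that])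
  have gb: "g (c w) = c (g w)" if "cent c" "w \<in> carrier V" for c w
    by (rule g(1)[unfolded bic_def, THEN conjunct2, rule_format, OF that])
  have cg: "cent g" using g(1)[unfolded bic_def, THEN conjunct1] gb[OF cent_a] unfolding cent_def by blast
  \<comment> \<open>\<open>f\<close> and \<open>g\<close> are only known to agree with
    \<open>h\<close> and \<open>k\<close> at \<open>v\<close>. That is enough: both lie in
    \<open>bic\<close>, \<open>g\<close> lies in \<open>cent\<close> as well, and freeness carries
    the equality at \<open>v\<close> over to \<open>H\<close>.\<close>
  have "act k (act h v) = f (g v)"
  proof -
    have "f (act k v) = act k (f v)" by (rule fb[OF cent_act[OF k] v(1)])
    then show ?thesis using f(2) g(2) by simp
  qed
  also have "\<dots> = g (f v)" by (rule fb[OF cg v(1)])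
  also have "\<dots> = act h (act k v)"
  proof -
    have "g (act h v) = act h (g v)" by (rule gb[OF cent_act[OF h] v(1)])
    then show ?thesis using f(2) g(2) by simp
  qed
  finally show ?thesis using act_eqD[of "h \<otimes> k" "k \<otimes> h" v] h k v by (simp add: act_mult)
qed

text \<open>In additive notation, \<open>(a - d)(a + d - M) = 0\<close>, and \<open>a - d\<close> is injective.\<close>

lemma quadratic_roots_sum:
  assumes a: "a \<in> carrier H" and d: "d \<in> carrier H" and comm: "a \<otimes> d = d \<otimes> a" and ne: "a \<noteq> d"
    and L: "\<And>w. w \<in> carrier V \<Longrightarrow> L w \<in> carrier V" and M: "\<And>w. w \<in> carrier V \<Longrightarrow> M w \<in> carrier V"
    and Ma: "\<And>w. w \<in> carrier V \<Longrightarrow> M (act a w) = act a (M w)"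
    and Md: "\<And>w. w \<in> carrier V \<Longrightarrow> M (act d w) = act d (M w)"
    and qa: "\<And>w. w \<in> carrier V \<Longrightarrow> act a (act a w) = L w \<otimes>\<^bsub>V\<^esub> M (act a w)"
    and qd: "\<And>w. w \<in> carrier V \<Longrightarrow> act d (act d w) = L w \<otimes>\<^bsub>V\<^esub> M (act d w)"
    and w: "w \<in> carrier V"
  shows "act a w \<otimes>\<^bsub>V\<^esub> act d w = M w"
proof -
  \<comment> \<open>\<open>u\<close> is the second factor (a + d - M) applied to \<open>w\<close>.
    Both quadratics reduce its images under \<open>a\<close> and \<open>d\<close> to the sum of
    \<open>L w\<close> and \<open>act a (act d w)\<close>.\<close>
  define u where "u = act a w \<otimes>\<^bsub>V\<^esub> act d w \<otimes>\<^bsub>V\<^esub> inv\<^bsub>V\<^esub> (M w)"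
  have u: "u \<in> carrier V" using a d w M by (simp add: u_def)
  have ad: "act a (act d w) = act d (act a w)"
    unfolding act_mult[OF a d w, symmetric] act_mult[OF d a w, symmetric] comm ..
  have canc: "x \<otimes>\<^bsub>V\<^esub> y \<otimes>\<^bsub>V\<^esub> z \<otimes>\<^bsub>V\<^esub> inv\<^bsub>V\<^esub> y = x \<otimes>\<^bsub>V\<^esub> z"
    if "x \<in> carrier V" "y \<in> carrier V" "z \<in> carrier V" for x y z
  proof -
    have "x \<otimes>\<^bsub>V\<^esub> y \<otimes>\<^bsub>V\<^esub> z = x \<otimes>\<^bsub>V\<^esub> z \<otimes>\<^bsub>V\<^esub> y"
      using that by (simp add: V.m_assoc V.m_comm[of y z])
    then show ?thesis using that V.inv_solve_right'[of "x \<otimes>\<^bsub>V\<^esub> z" "x \<otimes>\<^bsub>V\<^esub> y \<otimes>\<^bsub>V\<^esub> z" y] by simp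
  qed
  have "act a u = act a (act a w) \<otimes>\<^bsub>V\<^esub> act a (act d w) \<otimes>\<^bsub>V\<^esub> inv\<^bsub>V\<^esub> (M (act a w))"
    unfolding u_def Ma[OF w] using a d w M by simp
  also have "\<dots> = L w \<otimes>\<^bsub>V\<^esub> act a (act d w)"
    unfolding qa[OF w] by (rule canc) (use a d w L M in auto)
  also have "\<dots> = L w \<otimes>\<^bsub>V\<^esub> M (act d w) \<otimes>\<^bsub>V\<^esub> act d (act a w) \<otimes>\<^bsub>V\<^esub> inv\<^bsub>V\<^esub> (M (act d w))"
    unfolding ad by (rule canc[symmetric]) (use a d w L M in auto)
  also have "\<dots> = act d (act d w) \<otimes>\<^bsub>V\<^esub> act d (act a w) \<otimes>\<^bsub>V\<^esub> inv\<^bsub>V\<^esub> (act d (M w))"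
    unfolding qd[OF w] Md[OF w] ..
  also have "\<dots> = act d u"
    unfolding u_def using a d w M V.m_comm[of "act d (act d w)"] by simp
  finally have "u = \<one>\<^bsub>V\<^esub>" using act_eqD[OF a d u] ne by blast
  then show ?thesis unfolding u_def using a d w M by (simp add: V.inv_solve_right')
qed


lemma line_card:
  assumes "v \<in> carrier V" "v \<noteq> \<one>\<^bsub>V\<^esub>"
  shows "subgroup (generate V {v}) V" "card (generate V {v}) = p"
    "generate V {v} = {v [^]\<^bsub>V\<^esub> (k::int) | k. k \<in> UNIV}"
  using V.generate_is_subgroup[of "{v}"] V.generate_pow_card[of v] ord_V[of v] V.generate_pow[of v] assms
  by auto

text \<open>Subgroup orders are powers of \<open>p\<close>, so a subgroup strictly larger than a
  line has order at least \<open>p ^ 2\<close>.\<close>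

lemma subgroup_eq_plane:
  assumes V2: "order V = p ^ 2" and v: "v \<in> carrier V" and u: "\<And>k::int. u \<noteq> v [^]\<^bsub>V\<^esub> k"
    and S: "subgroup S V" "v \<in> S" "u \<in> S" and v1: "v \<noteq> \<one>\<^bsub>V\<^esub>"
  shows "S = carrier V"
proof -
  have SV: "S \<subseteq> carrier V" using S(1) subgroup.subset by blast
  have finS: "finite S" using SV finV finite_subset by blast
  obtain k where k: "card S = p ^ k" using subgroup_card_power[OF S(1)] by blast
  have "generate V {v} \<subset> S"
    using u S(2,3) V.generate_subgroup_incl[of "{v}" S] S(1) line_card(3)[OF v v1] by auto
  then have "p < card S" using psubset_card_mono[OF finS] line_card(2)[OF v v1] by metis
  then have "p ^ 1 < p ^ k" using k by simp
  then have "1 < k" using prime_gt_1_nat[OF prime_p] power_less_imp_less_exp by blast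
  then have "p ^ 2 \<le> p ^ k" using prime_gt_1_nat[OF prime_p] by (intro power_increasing) auto
  then have "card (carrier V) \<le> card S" using V2 k by (simp add: order_def)
  then show ?thesis using card_seteq[OF finV SV] by blast
qed

text \<open>A vector that is not an eigenvector of \<open>a\<close> spans the plane together with
  its image, so it generates the plane under \<open>a\<close>.\<close>

lemma nonscalar_centralizer_commutative:
  assumes V2: "order V = p ^ 2" and a: "a \<in> carrier H" "\<not> scalar a"
    and h: "h \<in> carrier H" "h \<otimes> a = a \<otimes> h"
    and k: "k \<in> carrier H" "k \<otimes> a = a \<otimes> k"
  shows "h \<otimes> k = k \<otimes> h"
proof -
  obtain v where v: "v \<in> carrier V" and av: "\<And>k::int. act a v \<noteq> v [^]\<^bsub>V\<^esub> k"
    using nonscalarE[OF a] by blast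
  have v1: "v \<noteq> \<one>\<^bsub>V\<^esub>" using av[of 0] a(1) by auto
  show ?thesis
  proof (rule centralizer_commutative[OF a(1) v v1 _ h k])
    fix S assume "subgroup S V" "v \<in> S" "\<And>s. s \<in> S \<Longrightarrow> act a s \<in> S"
    then show "S = carrier V" using subgroup_eq_plane[OF V2 v av _ _ _ v1] by blast
  qed
qed

text \<open>Cayley-Hamilton in dimension two without matrices: the relation is read off at a vector
  \<open>v\<close> that is not an eigenvector, and the vectors satisfying it form a subgroup
  containing \<open>v\<close> and \<open>act a v\<close>.\<close>

lemma nonscalar_quadratic:
  assumes V2: "order V = p ^ 2" and a: "a \<in> carrier H" "\<not> scalar a"
  shows "\<exists>(l::int) (m::int). \<forall>w\<in>carrier V. act a (act a w) = w [^]\<^bsub>V\<^esub> l \<otimes>\<^bsub>V\<^esub> act a w [^]\<^bsub>V\<^esub> m"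
proof -
  obtain v where v: "v \<in> carrier V" and av: "\<And>k::int. act a v \<noteq> v [^]\<^bsub>V\<^esub> k"
    using nonscalarE[OF a] by blast
  have v1: "v \<noteq> \<one>\<^bsub>V\<^esub>" using av[of 0] a(1) by auto
  have avc: "act a v \<in> carrier V" using a v by simp
  define S where "S = {v [^]\<^bsub>V\<^esub> i \<otimes>\<^bsub>V\<^esub> act a v [^]\<^bsub>V\<^esub> j | (i::int) (j::int). True}"
  have "subgroup S V" "v \<in> S" "act a v \<in> S" unfolding S_def by (rule span_subgroup[OF v avc])+
  then have "S = carrier V" using subgroup_eq_plane[OF V2 v av _ _ _ v1] by blast
  then have "act a (act a v) \<in> S" using a v by simp
  then obtain l m :: int where lm: "act a (act a v) = v [^]\<^bsub>V\<^esub> l \<otimes>\<^bsub>V\<^esub> act a v [^]\<^bsub>V\<^esub> m"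
    by (auto simp: S_def)
  define T where "T = {w \<in> carrier V. act a (act a w) = w [^]\<^bsub>V\<^esub> l \<otimes>\<^bsub>V\<^esub> act a w [^]\<^bsub>V\<^esub> m}"
  have "subgroup T V"
  proof (rule V.subgroupI)
    show "T \<subseteq> carrier V" by (auto simp: T_def)
    show "T \<noteq> {}" using v lm by (auto simp: T_def)
    fix x assume x: "x \<in> T"
    then show "inv\<^bsub>V\<^esub> x \<in> T" using a by (auto simp: T_def V.inv_mult V.int_pow_inv)
    fix y assume "y \<in> T"
    then show "x \<otimes>\<^bsub>V\<^esub> y \<in> T" using x a by (auto simp: T_def V.int_pow_distrib V.m_ac)
  qed
  moreover have "v \<in> T" using v lm by (simp add: T_def)
  moreover have "act a v \<in> T"
    using v avc a arg_cong[OF lm, of "act a"] by (simp add: T_def)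
  ultimately have "T = carrier V" using subgroup_eq_plane[OF V2 v av _ _ _ v1] by blast
  then show ?thesis unfolding T_def by blast
qed

section \<open>Conjugates as roots of a common quadratic\<close>

lemma conjugate_act:
  assumes "a \<in> carrier H" "g \<in> carrier H" "w \<in> carrier V"
  shows "act (g \<otimes> a \<otimes> inv g) w = act g (act a (act (inv g) w))"
  using assms by (simp add: act_mult)

text \<open>Coefficients that commute with the conjugating element are carried to themselves. They
  are operators \<open>L\<close> and \<open>M\<close> rather than integers, in order to cover
  coefficients from the field of 49 elements.\<close>

lemma conjugate_quadratic:
  assumes a: "a \<in> carrier H" and g: "g \<in> carrier H"
    and L: "\<And>w. w \<in> carrier V \<Longrightarrow> L w \<in> carrier V" and M: "\<And>w. w \<in> carrier V \<Longrightarrow> M w \<in> carrier V"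
    and Lg: "\<And>w. w \<in> carrier V \<Longrightarrow> L (act g w) = act g (L w)"
    and Mg: "\<And>w. w \<in> carrier V \<Longrightarrow> M (act g w) = act g (M w)"
    and qa: "\<And>w. w \<in> carrier V \<Longrightarrow> act a (act a w) = L w \<otimes>\<^bsub>V\<^esub> M (act a w)"
    and d: "d = g \<otimes> a \<otimes> inv g" and w: "w \<in> carrier V"
  shows "act d (act d w) = L w \<otimes>\<^bsub>V\<^esub> M (act d w)"
proof -
  define u where "u = act (inv g) w"
  have u: "u \<in> carrier V" "act g u = w" using g w by (auto simp: u_def)
  have dw: "act d w = act g (act a u)" unfolding d u_def using conjugate_act[OF a g w] .
  have "act d (act d w) = act g (act a (act a u))"
    unfolding dw unfolding d using conjugate_act[OF a g, of "act g (act a u)"] a g u by simp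
  also have "\<dots> = act g (L u) \<otimes>\<^bsub>V\<^esub> act g (M (act a u))" using qa[OF u(1)] L M g a u by simp
  also have "\<dots> = L w \<otimes>\<^bsub>V\<^esub> M (act d w)" using Lg[OF u(1)] Mg[of "act a u"] a u dw by simp
  finally show ?thesis .
qed

text \<open>Hence \<open>a\<close>, \<open>d\<close>, \<open>e\<close> are roots of the same quadratic and \<open>d = M - a = e\<close>.\<close>

lemma quadratic_conjugates_eq:
  assumes a: "a \<in> carrier H" and g: "g \<in> carrier H" and h: "h \<in> carrier H"
    and L: "\<And>w. w \<in> carrier V \<Longrightarrow> L w \<in> carrier V" and M: "\<And>w. w \<in> carrier V \<Longrightarrow> M w \<in> carrier V"
    and comm: "\<And>k w. k \<in> {a, g, h} \<Longrightarrow> w \<in> carrier V \<Longrightarrow> L (act k w) = act k (L w) \<and> M (act k w) = act k (M w)"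
    and qa: "\<And>w. w \<in> carrier V \<Longrightarrow> act a (act a w) = L w \<otimes>\<^bsub>V\<^esub> M (act a w)"
    and d: "d = g \<otimes> a \<otimes> inv g" and e: "e = h \<otimes> a \<otimes> inv h"
    and ad: "a \<otimes> d = d \<otimes> a" "a \<noteq> d" and ae: "a \<otimes> e = e \<otimes> a" "a \<noteq> e"
  shows "d = e"
proof -
  have dc: "d \<in> carrier H" and ec: "e \<in> carrier H" using a g h d e by auto
  have invc: "M (act (inv k) w) = act (inv k) (M w)" if "k \<in> {g, h}" "w \<in> carrier V" for k w
  proof -
    have k: "k \<in> carrier H" using that g h by auto
    have "M w = act k (M (act (inv k) w))"
      using comm[of k "act (inv k) w"] that k by auto
    then have "act (inv k) (M w) = act (inv k) (act k (M (act (inv k) w)))" by simp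
    also have "\<dots> = M (act (inv k) w)" using k that M by simp
    finally show ?thesis by simp
  qed
  have Md: "M (act d w) = act d (M w)" if "w \<in> carrier V" for w
    unfolding d using that a g M comm[of g "act a (act (inv g) w)"] comm[of a "act (inv g) w"] invc[of g w]
    by (simp add: conjugate_act)
  have Me: "M (act e w) = act e (M w)" if "w \<in> carrier V" for w
    unfolding e using that a h M comm[of h "act a (act (inv h) w)"] comm[of a "act (inv h) w"] invc[of h w]
    by (simp add: conjugate_act)
  have qd: "act d (act d w) = L w \<otimes>\<^bsub>V\<^esub> M (act d w)" if "w \<in> carrier V" for w
    by (rule conjugate_quadratic[where L = L and M = M, OF a g L M _ _ qa d that]) (use comm in auto)
  have qe: "act e (act e w) = L w \<otimes>\<^bsub>V\<^esub> M (act e w)" if "w \<in> carrier V" for w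
    by (rule conjugate_quadratic[where L = L and M = M, OF a h L M _ _ qa e that]) (use comm in auto)
  have Ma: "M (act a w) = act a (M w)" if "w \<in> carrier V" for w using comm that by blast
  have "act d w = act e w" if w: "w \<in> carrier V" for w
  proof -
    have "act a w \<otimes>\<^bsub>V\<^esub> act d w = M w"
      by (rule quadratic_roots_sum[where L = L and M = M, OF a dc ad L M Ma Md qa qd w])
    moreover have "act a w \<otimes>\<^bsub>V\<^esub> act e w = M w"
      by (rule quadratic_roots_sum[where L = L and M = M, OF a ec ae L M Ma Me qa qe w])
    ultimately show ?thesis using a dc ec w V.right_cancel[of "act a w" "act d w" "act e w"] V.m_comm[of "act a w"] by simp
  qed
  then show ?thesis using act_extI[OF dc ec] by blast
qed

text \<open>Integer multiples commute with all of \<open>H\<close>, so in a plane the conjugating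
  elements are arbitrary.\<close>

lemma plane_conjugates_eq:
  assumes V2: "order V = p ^ 2" and a: "a \<in> carrier H" "\<not> scalar a" and g: "g \<in> carrier H" and h: "h \<in> carrier H"
    and d: "d = g \<otimes> a \<otimes> inv g" and e: "e = h \<otimes> a \<otimes> inv h"
    and ad: "a \<otimes> d = d \<otimes> a" "a \<noteq> d" and ae: "a \<otimes> e = e \<otimes> a" "a \<noteq> e"
  shows "d = e"
proof -
  obtain l m :: int where q: "\<And>w. w \<in> carrier V \<Longrightarrow>
      act a (act a w) = w [^]\<^bsub>V\<^esub> l \<otimes>\<^bsub>V\<^esub> act a w [^]\<^bsub>V\<^esub> m"
    using nonscalar_quadratic[OF V2 a] by blast
  show ?thesis
    by (rule quadratic_conjugates_eq[where L = "\<lambda>w. w [^]\<^bsub>V\<^esub> l" and M = "\<lambda>w. w [^]\<^bsub>V\<^esub> m",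
          OF a(1) g h _ _ _ q d e ad ae]) (use a g h in auto)
qed

end

section \<open>Conjugation and elements of prime order\<close>

text \<open>The Chinese remainder theorem gives exponents \<open>e\<close> and \<open>f\<close> that
  extract the two parts of an element of order \<open>r * s\<close>. Commutation is assumed just
  between elements of the two orders; in the plane case this holds because those of order 5 are
  scalar.\<close>

lemma (in group) card_ord_mult:
  fixes r s :: nat
  assumes cop: "coprime r s"
    and comm: "\<And>x y. x \<in> carrier G \<Longrightarrow> y \<in> carrier G \<Longrightarrow> ord x = r \<Longrightarrow> ord y = s \<Longrightarrow> x \<otimes> y = y \<otimes> x"
  shows "card {z \<in> carrier G. ord z = r * s} = card {x \<in> carrier G. ord x = r} * card {y \<in> carrier G. ord y = s}"
proof -
  obtain e where e: "[e = 1] (mod r)" "[e = 0] (mod s)"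
    using binary_chinese_remainder_nat[OF cop] by blast
  obtain f where f: "[f = 0] (mod r)" "[f = 1] (mod s)"
    using binary_chinese_remainder_nat[OF cop] by blast
  have pe: "x [^] e = x" "x [^] f = \<one>" if "x \<in> carrier G" "ord x = r" for x
  proof -
    have "int (ord x) dvd int 1 - int e"
      using e(1) that by (metis cong_int_iff cong_iff_dvd_diff cong_sym)
    then have "x [^] int e = x [^] int 1" using int_pow_eq[OF that(1)] by blast
    then show "x [^] e = x" using that(1) by (simp add: int_pow_int)
    show "x [^] f = \<one>" using f(1) that pow_eq_id[OF that(1), of f] by (simp add: cong_0_iff)
  qed
  have pf: "y [^] f = y" "y [^] e = \<one>" if "y \<in> carrier G" "ord y = s" for y
  proof -
    have "int (ord y) dvd int 1 - int f"
      using f(2) that by (metis cong_int_iff cong_iff_dvd_diff cong_sym)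
    then have "y [^] int f = y [^] int 1" using int_pow_eq[OF that(1)] by blast
    then show "y [^] f = y" using that(1) by (simp add: int_pow_int)
    show "y [^] e = \<one>" using e(2) that pow_eq_id[OF that(1), of e] by (simp add: cong_0_iff)
  qed
  have prod: "(x \<otimes> y) [^] e = x" "(x \<otimes> y) [^] f = y"
    if "x \<in> carrier G" "ord x = r" "y \<in> carrier G" "ord y = s" for x y
    using that pe[of x] pf[of y] comm[of x y] by (simp_all add: pow_mult_distrib)
  have cope: "coprime e r" "coprime f s"
    using e(1) f(2) by (metis cong_imp_coprime cong_sym coprime_1_left)+
  let ?A = "{x \<in> carrier G. ord x = r}" and ?B = "{y \<in> carrier G. ord y = s}" and ?C = "{z \<in> carrier G. ord z = r * s}"
  have "bij_betw (\<lambda>(x, y). x \<otimes> y) (?A \<times> ?B) ?C"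
  proof (rule bij_betwI[where g = "\<lambda>z. (z [^] e, z [^] f)"])
    show "(\<lambda>(x, y). x \<otimes> y) \<in> ?A \<times> ?B \<rightarrow> ?C"
    proof safe
      fix x y assume x: "x \<in> carrier G" "r = ord x" and y: "y \<in> carrier G" "s = ord y"
      show "x \<otimes> y \<in> carrier G" using x y by simp
      have "(x \<otimes> y) [^] n = \<one> \<longleftrightarrow> r * s dvd n" for n :: nat
      proof
        assume *: "(x \<otimes> y) [^] n = \<one>"
        have "x [^] n = ((x \<otimes> y) [^] e) [^] n" using prod(1)[of x y] x y by simp
        also have "\<dots> = ((x \<otimes> y) [^] n) [^] e" using x y by (simp add: nat_pow_pow mult.commute)
        finally have "r dvd n" using * x pow_eq_id[OF x(1), of n] by simp
        have "y [^] n = ((x \<otimes> y) [^] f) [^] n" using prod(2)[of x y] x y by simp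
        also have "\<dots> = ((x \<otimes> y) [^] n) [^] f" using x y by (simp add: nat_pow_pow mult.commute)
        finally have "s dvd n" using * y pow_eq_id[OF y(1), of n] by simp
        then show "r * s dvd n" using \<open>r dvd n\<close> cop by (simp add: divides_mult)
      next
        assume d: "r * s dvd n"
        have "x [^] n = \<one>" using pow_eq_id[OF x(1), of n] x(2) d by (metis dvd_mult_left)
        moreover have "y [^] n = \<one>" using pow_eq_id[OF y(1), of n] y(2) d by (metis dvd_mult_right)
        ultimately show "(x \<otimes> y) [^] n = \<one>" using x y comm[of x y] by (simp add: pow_mult_distrib)
      qed
      then show "ord (x \<otimes> y) = ord x * ord y" using ord_unique[of "x \<otimes> y"] x y by auto
    qed
    have zz: "ord (z [^] e) = r" "ord (z [^] f) = s" "z [^] e \<otimes> z [^] f = z" if z: "z \<in> carrier G" "ord z = r * s" for z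
    proof -
      have "(z [^] e) [^] n = \<one> \<longleftrightarrow> r dvd n" for n :: nat
      proof -
        have "(z [^] e) [^] n = \<one> \<longleftrightarrow> r * s dvd e * n" using z by (simp add: nat_pow_pow pow_eq_id)
        also have "\<dots> \<longleftrightarrow> r dvd e * n \<and> s dvd e * n"
          using cop by (meson divides_mult dvd_mult_left dvd_mult_right)
        also have "\<dots> \<longleftrightarrow> r dvd n"
          using e(2) cope(1) by (auto simp: cong_0_iff coprime_dvd_mult_right_iff coprime_commute)
        finally show ?thesis .
      qed
      then show "ord (z [^] e) = r" using ord_unique[of "z [^] e"] z by simp
      have "(z [^] f) [^] n = \<one> \<longleftrightarrow> s dvd n" for n :: nat
      proof -
        have "(z [^] f) [^] n = \<one> \<longleftrightarrow> r * s dvd f * n" using z by (simp add: nat_pow_pow pow_eq_id)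
        also have "\<dots> \<longleftrightarrow> r dvd f * n \<and> s dvd f * n"
          using cop by (meson divides_mult dvd_mult_left dvd_mult_right)
        also have "\<dots> \<longleftrightarrow> s dvd n"
          using f(1) cope(2) by (auto simp: cong_0_iff coprime_dvd_mult_right_iff coprime_commute)
        finally show ?thesis .
      qed
      then show "ord (z [^] f) = s" using ord_unique[of "z [^] f"] z by simp
      have "[e + f = 1] (mod r)" "[e + f = 1] (mod s)"
        using cong_add[OF e(1) f(1)] cong_add[OF e(2) f(2)] by simp_all
      then have "[e + f = 1] (mod r * s)" using cop by (simp add: coprime_cong_mult_nat)
      then have "int (ord z) dvd int 1 - int (e + f)"
        using z(2) by (metis cong_int_iff cong_iff_dvd_diff cong_sym)
      then have "z [^] int (e + f) = z [^] int 1" using int_pow_eq[OF z(1)] by blast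
      then have "z [^] (e + f) = z" using z(1) unfolding int_pow_int by simp
      then show "z [^] e \<otimes> z [^] f = z" using z by (simp add: nat_pow_mult)
    qed
    show "(\<lambda>z. (z [^] e, z [^] f)) \<in> ?C \<rightarrow> ?A \<times> ?B" using zz by auto
    fix z assume "z \<in> ?C"
    then show "(case (z [^] e, z [^] f) of (x, y) \<Rightarrow> x \<otimes> y) = z" using zz by simp
  next
    fix a assume "a \<in> ?A \<times> ?B"
    then show "((case a of (x, y) \<Rightarrow> x \<otimes> y) [^] e, (case a of (x, y) \<Rightarrow> x \<otimes> y) [^] f) = a"
      using prod by auto
  qed
  then have "card (?A \<times> ?B) = card ?C" by (rule bij_betw_same_card)
  then show ?thesis by (simp only: card_cartesian_product)
qed

lemma (in group) centralizer_subgroup: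
  assumes "a \<in> carrier G"
  shows "subgroup {h \<in> carrier G. h \<otimes> a = a \<otimes> h} G"
proof (rule subgroupI)
  show "{h \<in> carrier G. h \<otimes> a = a \<otimes> h} \<noteq> {}" using assms by auto
  fix h assume h: "h \<in> {h \<in> carrier G. h \<otimes> a = a \<otimes> h}"
  then have hc: "h \<in> carrier G" "h \<otimes> a = a \<otimes> h" by auto
  have "inv h \<otimes> a = a \<otimes> inv h"
    using hc assms inv_solve_left'[of "a \<otimes> inv h" h a] by (simp add: m_assoc[symmetric]) (simp add: m_assoc)
  then show "inv h \<in> {h \<in> carrier G. h \<otimes> a = a \<otimes> h}" using hc by simp
  fix k assume k: "k \<in> {h \<in> carrier G. h \<otimes> a = a \<otimes> h}"
  then have kc: "k \<in> carrier G" "k \<otimes> a = a \<otimes> k" by auto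
  have "h \<otimes> k \<otimes> a = h \<otimes> (a \<otimes> k)" using hc kc assms by (simp add: m_assoc)
  also have "\<dots> = a \<otimes> h \<otimes> k" using hc kc assms by (simp add: m_assoc[symmetric])
  finally show "h \<otimes> k \<in> {h \<in> carrier G. h \<otimes> a = a \<otimes> h}" using hc kc assms by (simp add: m_assoc)
qed auto

lemma (in group) conj_commute_iff:
  assumes "h \<in> carrier G" "a \<in> carrier G"
  shows "h \<otimes> a \<otimes> inv h = b \<longleftrightarrow> b \<in> carrier G \<and> h \<otimes> a = b \<otimes> h"
  using assms inv_solve_right'[of b "h \<otimes> a" h] by auto

lemma (in group) conj_hom:
  assumes "h \<in> carrier G" "a \<in> carrier G" "b \<in> carrier G"
  shows "h \<otimes> (a \<otimes> b) \<otimes> inv h = (h \<otimes> a \<otimes> inv h) \<otimes> (h \<otimes> b \<otimes> inv h)"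
proof -
  have "inv h \<otimes> (h \<otimes> (b \<otimes> inv h)) = b \<otimes> inv h" using assms by (simp add: m_assoc[symmetric])
  then show ?thesis using assms by (simp add: m_assoc)
qed

lemma (in group) conj_conj:
  assumes "g \<in> carrier G" "h \<in> carrier G" "a \<in> carrier G"
  shows "g \<otimes> (h \<otimes> a \<otimes> inv h) \<otimes> inv g = (g \<otimes> h) \<otimes> a \<otimes> inv (g \<otimes> h)"
  using assms by (simp add: inv_mult_group m_assoc)

lemma (in group) conj_inj:
  assumes "h \<in> carrier G" "a \<in> carrier G" "b \<in> carrier G"
  shows "h \<otimes> a \<otimes> inv h = h \<otimes> b \<otimes> inv h \<longleftrightarrow> a = b"
  using assms by (metis inv_closed l_inv m_assoc m_closed l_one right_cancel)

lemma (in group) conj_pow: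
  assumes "h \<in> carrier G" "a \<in> carrier G"
  shows "h \<otimes> a [^] (n::nat) \<otimes> inv h = (h \<otimes> a \<otimes> inv h) [^] n"
proof (induction n)
  case (Suc n)
  then show ?case using conj_hom[of h "a [^] n" a] assms by simp
qed (use assms in simp)

lemma (in group) ord_conj:
  assumes "h \<in> carrier G" "a \<in> carrier G"
  shows "ord (h \<otimes> a \<otimes> inv h) = ord a"
proof -
  have "(h \<otimes> a \<otimes> inv h) [^] n = \<one> \<longleftrightarrow> a [^] n = \<one>" for n :: nat
    using conj_inj[of h "a [^] n" \<one>] assms conj_pow[of h a n] by simp
  then show ?thesis using ord_unique[of "h \<otimes> a \<otimes> inv h" "ord a"] pow_eq_id assms by simp
qed

lemma (in group) conj_funpow:
  assumes "c \<in> carrier G" "x \<in> carrier G"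
  shows "((\<lambda>x. c \<otimes> x \<otimes> inv c) ^^ n) x = c [^] n \<otimes> x \<otimes> inv (c [^] n)"
proof (induction n)
  case (Suc n)
  then show ?case using conj_conj[of c "c [^] n" x] assms nat_pow_Suc2[of c n] by simp
qed (use assms in simp)

context free_action
begin

lemma prime_order_powers:
  assumes c: "c \<in> carrier H" "H.ord c = q" and q: "prime q"
  shows "{d \<in> carrier H. H.ord d = q \<and> c \<otimes> d = d \<otimes> c} = (\<lambda>k. c [^] k) ` {0<..<q}"
    and "card ((\<lambda>k. c [^] k) ` {0<..<q}) = q - 1"
proof -
  show "{d \<in> carrier H. H.ord d = q \<and> c \<otimes> d = d \<otimes> c} = (\<lambda>k. c [^] k) ` {0<..<q}" (is "?L = ?R")
  proof
    show "?L \<subseteq> ?R"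
    proof
      fix d assume d: "d \<in> ?L"
      then have "d [^] q = \<one>" by auto
      then obtain k where k: "k < q" "d = c [^] k" using commuting_prime_order[OF c] d q by auto
      have "d \<noteq> \<one>" using d q H.ord_prime_iff[of d q] by auto
      then have "k \<noteq> 0" using k(2) by (intro notI) simp
      then show "d \<in> ?R" using k by auto
    qed
    show "?R \<subseteq> ?L"
    proof
      fix d assume "d \<in> ?R"
      then obtain k where k: "0 < k" "k < q" "d = c [^] k" by auto
      then have "coprime k q" using q by (metis coprime_commute prime_imp_coprime nat_dvd_not_less)
      then have "H.ord d = q" using H.pow_ord_eq_ord_iff[OF finH c(1), of k] k c by simp
      moreover have "c \<otimes> d = d \<otimes> c" using k c H.group_commutes_pow[of c c k] by simp
      ultimately show "d \<in> ?L" using k c by simp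
    qed
  qed
  have "inj_on (\<lambda>k. c [^] k) {0<..<q}"
    by (rule inj_on_subset[OF H.ord_inj[OF c(1)]]) (use c in auto)
  then show "card ((\<lambda>k. c [^] k) ` {0<..<q}) = q - 1" by (simp add: card_image)
qed

text \<open>Conjugation by \<open>c\<close> permutes the elements of order \<open>q\<close> with
  period \<open>q\<close>, and the fixed ones are the \<open>q - 1\<close> nontrivial powers of
  \<open>c\<close>.\<close>

lemma card_prime_order_mod:
  assumes c: "c \<in> carrier H" "H.ord c = q" and q: "prime q"
  shows "card {d \<in> carrier H. H.ord d = q} mod q = q - 1"
proof -
  let ?X = "{d \<in> carrier H. H.ord d = q}"
  define f where "f d = c \<otimes> d \<otimes> inv c" for d
  have "card ?X mod q = card {d \<in> ?X. f d = d} mod q"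
  proof (rule card_fixed_cong[OF q])
    fix d assume d: "d \<in> ?X"
    then show "f d \<in> ?X" using c H.ord_conj by (auto simp: f_def)
    show "(f ^^ q) d = d" unfolding f_def using H.conj_funpow[OF c(1), of d q] d c by auto
  qed (use finH in simp)
  also have "{d \<in> ?X. f d = d} = {d \<in> carrier H. H.ord d = q \<and> c \<otimes> d = d \<otimes> c}"
    using H.conj_commute_iff[OF c(1)] by (auto simp: f_def)
  also have "card \<dots> = q - 1" using prime_order_powers[OF c q] by simp
  finally show ?thesis using prime_gt_1_nat[OF q] by simp
qed

end

section \<open>Regular actions of groups with perfect order classes\<close>

text \<open>By \<open>order_H\<close> the free action is regular on the nonzero vectors;
  \<open>smooth\<close> and \<open>dvd30\<close> make 2, 3 and 5 exactly the prime divisors of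
  \<open>order H\<close>.\<close>

locale poc_action = free_action H V act p
  for H :: "('h, 'x) monoid_scheme" (structure) and V :: "('v, 'y) monoid_scheme"
    and act :: "'h \<Rightarrow> 'v \<Rightarrow> 'v" and p :: nat +
  assumes order_H: "order H = order V - 1"
    and smooth: "prime r \<Longrightarrow> r dvd order H \<Longrightarrow> r \<in> {2, 3, 5}"
    and dvd30: "30 dvd order H"
    and poc: "perfect_order_classes H"
begin

lemma card_ord_dvd:
  assumes "x \<in> carrier H" "H.ord x = n"
  shows "card {y \<in> carrier H. H.ord y = n} dvd order H"
proof -
  have "n > 0" using assms H.ord_ge_1[OF finH assms(1)] by simp
  moreover have "card {y \<in> carrier H. H.ord y = n} \<noteq> 0" using assms finH by auto
  ultimately show ?thesis using poc[unfolded perfect_order_classes_def, rule_format, of n] by simp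
qed

lemma order_H_pos: "order H > 0"
  using finH H.order_gt_0_iff_finite by blast

text \<open>Here \<open>|Z|\<close> has exactly \<open>4|Z|/15\<close> generators, and this has to divide \<open>j|Z|\<close>.\<close>

lemma commutative_index:
  assumes Z: "subgroup Z H" and comm: "\<And>x y. x \<in> Z \<Longrightarrow> y \<in> Z \<Longrightarrow> x \<otimes> y = y \<otimes> x"
    and d: "30 dvd card Z" and j: "order H = j * card Z"
    and in_Z: "\<And>g. g \<in> carrier H \<Longrightarrow> H.ord g = card Z \<Longrightarrow> g \<in> Z"
  shows "4 dvd j" and "\<exists>g\<in>Z. H.ord g = card Z"
proof -
  have ZH: "Z \<subseteq> carrier H" using Z subgroup.subset by blast
  have pos: "card Z > 0" using j order_H_pos by (auto intro: gr0I)
  have t: "15 * totient (card Z) = 4 * card Z"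
  proof (rule totient_235[OF _ d pos])
    fix r :: nat assume "prime r" "r dvd card Z"
    then show "r \<in> {2, 3, 5}" using smooth j by simp
  qed
  \<comment> \<open>\<open>in_Z\<close> turns the generator count of \<open>Z\<close> into the size
    of an order class of \<open>H\<close>, to which perfect order classes apply.\<close>
  have "{g \<in> carrier H. H.ord g = card Z} = {g \<in> Z. H.ord g = card Z}" using in_Z ZH by blast
  then have N: "card {g \<in> carrier H. H.ord g = card Z} = totient (card Z)"
    using card_generators_commuting[OF Z comm] by simp
  then have "card {g \<in> carrier H. H.ord g = card Z} \<noteq> 0" using pos by simp
  then obtain g where g: "g \<in> carrier H" "H.ord g = card Z" by (metis (mono_tags, lifting) card.empty empty_Collect_eq)
  then show "\<exists>g\<in>Z. H.ord g = card Z" using in_Z by blast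
  have "totient (card Z) dvd order H" using card_ord_dvd[OF g] N by simp
  then obtain c where "j * card Z = totient (card Z) * c" using j by auto
  then have "15 * j * card Z = 4 * c * card Z" using t by (metis (no_types, lifting) mult.assoc mult.commute)
  then have "15 * j = 4 * c" using pos by simp
  then show "4 dvd j" by presburger
qed

lemma not_commutative: "\<exists>x\<in>carrier H. \<exists>y\<in>carrier H. x \<otimes> y \<noteq> y \<otimes> x"
proof (rule ccontr)
  assume "\<not> ?thesis"
  then have "4 dvd (1::nat)"
    using commutative_index(1)[OF H.subgroup_self, of 1] dvd30 by (simp add: order_def)
  then show False by simp
qed

lemma exists_nonscalar: "\<exists>x\<in>carrier H. \<not> scalar x"
  using not_commutative scalar_commute by blast

lemma not_line: "order V \<noteq> p"
proof
  assume V: "order V = p"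
  obtain x where x: "x \<in> carrier H" "\<not> scalar x" using exists_nonscalar by blast
  obtain v where v: "v \<in> carrier V" and xv: "\<And>k::int. act x v \<noteq> v [^]\<^bsub>V\<^esub> k"
    using nonscalarE[OF x] by blast
  have v1: "v \<noteq> \<one>\<^bsub>V\<^esub>" using xv[of 0] x(1) by auto
  have "generate V {v} = carrier V"
    using card_seteq[OF finV, of "generate V {v}"] line_card(1,2)[OF v v1] V subgroup.subset
    by (metis order_def order_refl)
  then show False using line_card(3)[OF v v1] xv x(1) v by blast
qed

lemma involution_exists: obtains t where "t \<in> carrier H" "H.ord t = 2"
proof -
  have "2 dvd order H" using dvd30 by (auto intro: dvd_trans[of _ 30])
  then show ?thesis using H.cauchy[OF finH] that two_is_prime_nat by blast
qed

lemma p_gt_5: "p > 5"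
proof (rule ccontr)
  assume "\<not> p > 5"
  then have "p \<in> {0, 1, 2, 3, 4, 5}" by auto
  then have "p = 2 \<or> p = 3 \<or> p = 5" using prime_p by auto
  then have "p dvd 30" by auto
  then show False using dvd30 p_not_dvd dvd_trans by blast
qed

text \<open>Otherwise \<open>plane_conjugates_eq\<close> leaves at most two conjugates of
  \<open>a\<close>, so its commutative centralizer has index 1 or 2, against
  \<open>commutative_index\<close>. The work lies in placing every element of order
  \<open>card Z\<close> in \<open>Z\<close>.\<close>

lemma plane_conjugate_not_commuting:
  assumes V2: "order V = p ^ 2" and a: "a \<in> carrier H" "\<not> scalar a"
  obtains h where "h \<in> carrier H"
    "a \<otimes> (h \<otimes> a \<otimes> inv h) \<noteq> (h \<otimes> a \<otimes> inv h) \<otimes> a"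
proof (rule ccontr)
  note thesisI = that
  assume not: "\<not> thesis"
  let ?cj = "\<lambda>h. h \<otimes> a \<otimes> inv h"
  have comm: "a \<otimes> ?cj h = ?cj h \<otimes> a" if "h \<in> carrier H" for h
  proof (rule ccontr)
    assume "a \<otimes> ?cj h \<noteq> ?cj h \<otimes> a"
    then have thesis by (rule thesisI[OF that])
    then show False using not by simp
  qed
  define C where "C = ?cj ` carrier H"
  define Z where "Z = {h \<in> carrier H. h \<otimes> a = a \<otimes> h}"
  have Z: "subgroup Z H" unfolding Z_def by (rule H.centralizer_subgroup[OF a(1)])
  have aC: "a \<in> C" unfolding C_def by (rule image_eqI[of _ _ "\<one>"]) (use a in auto)
  have finC: "finite C" using finH by (simp add: C_def)
  have two: "d = e" if "d \<in> C" "e \<in> C" "d \<noteq> a" "e \<noteq> a" for d e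
  proof -
    obtain g h where g: "g \<in> carrier H" "d = ?cj g" and h: "h \<in> carrier H" "e = ?cj h"
      using \<open>d \<in> C\<close> \<open>e \<in> C\<close> unfolding C_def by blast
    show ?thesis
      by (rule plane_conjugates_eq[OF V2 a g(1) h(1) g(2) h(2)]) (use comm g h that in auto)
  qed
  have cardC: "card C = 1 \<or> card C = 2"
  proof (cases "C = {a}")
    case False
    then obtain d where "d \<in> C" "d \<noteq> a" using aC by blast
    then have "C = {a, d}" using two aC by blast
    then show ?thesis using \<open>d \<noteq> a\<close> by simp
  qed simp
  have HZ: "order H = card C * card Z"
    using H.card_conjugates[OF finH a(1) H.subgroup_self] by (simp add: order_def C_def Z_def)
  have Zcomm: "x \<otimes> y = y \<otimes> x" if "x \<in> Z" "y \<in> Z" for x y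
    using nonscalar_centralizer_commutative[OF V2 a] that by (simp add: Z_def)
  have oH: "order H = (p - 1) * (p + 1)"
    using order_H V2 by (simp add: power2_eq_square algebra_simps diff_mult_distrib2)
  have "odd p" using prime_p p_gt_5 by (simp add: prime_odd_nat)
  then obtain k where k: "p = 2 * k + 1" by (elim oddE)
  \<comment> \<open>The factor 4 keeps 30 a divisor of \<open>card Z\<close> even for index
    2.\<close>
  then have "order H = 4 * (k * (k + 1))" unfolding oH by simp
  then have "4 dvd order H" by simp
  then have "60 dvd order H" using dvd30 by presburger
  then have Z30: "30 dvd card Z" using HZ cardC dvd30 by auto
  have "g \<in> Z" if g: "g \<in> carrier H" "H.ord g = card Z" for g
  proof (rule ccontr)
    assume gZ: "g \<notin> Z"
    then have ga: "g \<otimes> a \<noteq> a \<otimes> g" using g by (simp add: Z_def)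
    define s where "s = g [^] (2::nat)"
    have s: "s \<in> carrier H" "s = g \<otimes> g" using g square_eq_mult by (simp_all add: s_def)
    have d: "?cj g \<noteq> a" using H.conj_commute_iff[OF g(1) a(1), of a] ga by simp
    have gC: "?cj g \<in> C" "?cj s \<in> C" using g s by (auto simp: C_def)
    have "?cj s = g \<otimes> ?cj g \<otimes> inv g" unfolding s(2) using H.conj_conj[OF g(1) g(1) a(1)] by simp
    also have "\<dots> \<noteq> ?cj g" using H.conj_inj[OF g(1), of "?cj g" a] g a d by simp
    finally have "?cj s \<noteq> ?cj g" .
    then have "?cj s = a" using two[of "?cj s" "?cj g"] gC d by blast
    then have sa: "s \<otimes> a = a \<otimes> s" using H.conj_commute_iff[OF s(1) a(1), of a] by simp
    have gs: "g \<otimes> s = s \<otimes> g" using g by (simp add: s(2) H.m_assoc)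
    \<comment> \<open>The square of \<open>g\<close> commutes with the noncommuting pair
      \<open>g\<close> and \<open>a\<close>. Being scalar, it has order at most
      \<open>p - 1\<close>, but this order is half of \<open>card Z\<close>, which is too
      large.\<close>
    have "scalar s"
      using nonscalar_centralizer_commutative[OF V2 s(1) _ g(1) gs a(1) sa[symmetric]] ga by blast
    then have "H.ord s dvd p - 1" by (rule scalar_ord_dvd)
    then have le: "H.ord s \<le> p - 1" using p_gt_5 by (intro dvd_imp_le) auto
    have "2 dvd H.ord g" using g(2) Z30 by (auto intro: dvd_trans[of _ 30])
    then have "H.ord s = card Z div 2" unfolding s_def using H.ord_pow[OF g(1), of 2] g(2) by simp
    then have "card Z \<le> 2 * (p - 1)" using le \<open>2 dvd H.ord g\<close> g(2) by auto
    then have "(p - 1) * (p + 1) \<le> 2 * (2 * (p - 1))" using HZ oH cardC by auto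
    then have "(p - 1) * (p + 1) \<le> (p - 1) * 4" by simp
    then have "p + 1 \<le> 4" using p_gt_5 by (simp del: mult_Suc_right)
    then show False using p_gt_5 by simp
  qed
  then have "4 dvd card C" using commutative_index(1)[OF Z Zcomm Z30 HZ] by blast
  then show False using cardC by auto
qed

end

section \<open>Solvable groups acting regularly on a plane\<close>

context free_action
begin

lemma scalar_one: "scalar \<one>"
  unfolding scalar_def by (auto intro!: exI[of _ 1])

text \<open>A nonscalar \<open>d\<close> would have a commutative centralizer containing the
  noncommuting pair.\<close>

lemma scalar_if_commutes_with_pair:
  assumes V2: "order V = p ^ 2" and x: "x \<in> carrier H" and y: "y \<in> carrier H"
    and xy: "x \<otimes> y \<noteq> y \<otimes> x" and d: "d \<in> carrier H"
    and dx: "d \<otimes> x = x \<otimes> d" and dy: "d \<otimes> y = y \<otimes> d"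
  shows "scalar d"
  using nonscalar_centralizer_commutative[OF V2 d _ x dx[symmetric] y dy[symmetric]] xy by blast

text \<open>The conjugate \<open>\<zeta>d\<close> of \<open>d\<close> is the other root of the quadratic of \<open>d\<close>, so \<open>(1 + \<zeta>) d\<close> is scalar;
  as \<open>d\<close> is not, \<open>\<zeta> = -1\<close>, and the linear term of the quadratic vanishes.\<close>

lemma scalar_commutator:
  assumes V2: "order V = p ^ 2" and c: "c \<in> carrier H" and d: "d \<in> carrier H"
    and ne: "c \<otimes> d \<noteq> d \<otimes> c"
    and sc: "scalar (c \<otimes> d \<otimes> inv c \<otimes> inv d)"
    and t: "t \<in> carrier H" "H.ord t = 2"
  shows "c \<otimes> d = t \<otimes> (d \<otimes> c)" and "scalar (d \<otimes> d)"
proof -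
  define z where "z = c \<otimes> d \<otimes> inv c \<otimes> inv d"
  define d' where "d' = c \<otimes> d \<otimes> inv c"
  have zc: "z \<in> carrier H" and d'c: "d' \<in> carrier H" using c d by (simp_all add: z_def d'_def)
  have d'z: "d' = z \<otimes> d" using c d by (simp add: z_def d'_def H.m_assoc)
  have zs: "scalar z" using sc by (simp add: z_def)
  have nsd: "\<not> scalar d" using scalar_commute[of d c] c ne by metis
  obtain l m :: int where q: "\<And>w. w \<in> carrier V \<Longrightarrow>
      act d (act d w) = w [^]\<^bsub>V\<^esub> l \<otimes>\<^bsub>V\<^esub> act d w [^]\<^bsub>V\<^esub> m"
    using nonscalar_quadratic[OF V2 d nsd] by blast
  obtain e :: int where e: "\<And>w. w \<in> carrier V \<Longrightarrow> act z w = w [^]\<^bsub>V\<^esub> e"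
    using zs by (auto simp: scalar_def)
  have comm: "d \<otimes> d' = d' \<otimes> d"
    unfolding d'z using scalar_commute[OF zs d, symmetric] zc d by (simp add: H.m_assoc[symmetric])
  have "d \<noteq> d'" using H.conj_commute_iff[OF c d, of d] ne by (auto simp: d'_def)
  have q': "act d' (act d' w) = w [^]\<^bsub>V\<^esub> l \<otimes>\<^bsub>V\<^esub> act d' w [^]\<^bsub>V\<^esub> m" if "w \<in> carrier V" for w
    by (rule conjugate_quadratic[where L = "\<lambda>w. w [^]\<^bsub>V\<^esub> l" and M = "\<lambda>w. w [^]\<^bsub>V\<^esub> m", OF d c _ _ _ _ q d'_def that])
      (use c in auto)
  have sum: "act d w [^]\<^bsub>V\<^esub> (1 + e) = w [^]\<^bsub>V\<^esub> m" if w: "w \<in> carrier V" for w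
  proof -
    have "act d w \<otimes>\<^bsub>V\<^esub> act d' w = w [^]\<^bsub>V\<^esub> m"
      by (rule quadratic_roots_sum[where L = "\<lambda>w. w [^]\<^bsub>V\<^esub> l" and M = "\<lambda>w. w [^]\<^bsub>V\<^esub> m",
            OF d d'c comm \<open>d \<noteq> d'\<close> _ _ _ _ q q' w]) (use d d'c in auto)
    moreover have "act d' w = act d w [^]\<^bsub>V\<^esub> e" unfolding d'z using act_mult zc d w e by simp
    ultimately show ?thesis using d w by (simp add: V.int_pow_mult)
  qed
  obtain v where v: "v \<in> carrier V" and dv: "\<And>k::int. act d v \<noteq> v [^]\<^bsub>V\<^esub> k"
    using nonscalarE[OF d nsd] by blast
  \<comment> \<open>Were \<open>1 + e\<close> invertible modulo \<open>p\<close>, \<open>sum\<close>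
    would express \<open>act d v\<close> as a multiple of \<open>v\<close>.\<close>
  have pe: "int p dvd 1 + e"
  proof (rule ccontr)
    assume "\<not> int p dvd 1 + e"
    then obtain b :: int where "act d v = (act d v [^]\<^bsub>V\<^esub> (1 + e)) [^]\<^bsub>V\<^esub> b"
      using int_pow_invertible[of "act d v" "1 + e"] d v by auto
    then have "act d v = v [^]\<^bsub>V\<^esub> (m * b)" using sum[OF v] v by (simp add: V.int_pow_pow)
    then show False using dv by blast
  qed
  have pow1: "w [^]\<^bsub>V\<^esub> (1 + e) = \<one>\<^bsub>V\<^esub>" if "w \<in> carrier V" for w
    using pow_int_V_one_iff[of w] that pe by (cases "w = \<one>\<^bsub>V\<^esub>") auto
  have zt: "z = t"
  proof (rule act_extI[OF zc t(1)])
    fix w assume w: "w \<in> carrier V"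
    have "w [^]\<^bsub>V\<^esub> e \<otimes>\<^bsub>V\<^esub> w = \<one>\<^bsub>V\<^esub>" using pow1[OF w] w by (simp add: V.int_pow_mult V.m_comm)
    then have "w [^]\<^bsub>V\<^esub> e = inv\<^bsub>V\<^esub> w" using w by (simp add: V.inv_equality)
    then show "act z w = act t w" using e[OF w] involution_act[OF t w] by simp
  qed
  have "c \<otimes> d = d' \<otimes> c" using c d by (simp add: d'_def H.m_assoc)
  also have "\<dots> = t \<otimes> (d \<otimes> c)" using d'z zt t c d by (simp add: H.m_assoc)
  finally show "c \<otimes> d = t \<otimes> (d \<otimes> c)" .
  have "act (d \<otimes> d) w = w [^]\<^bsub>V\<^esub> l" if w: "w \<in> carrier V" for w
  proof -
    \<comment> \<open>\<open>1 + e\<close> annihilates \<open>V\<close>, so \<open>sum\<close> at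
      \<open>act d w\<close> removes the linear term.\<close>
    have "act d w [^]\<^bsub>V\<^esub> m = act d (act d w) [^]\<^bsub>V\<^esub> (1 + e)" using sum[of "act d w"] d w by simp
    also have "\<dots> = \<one>\<^bsub>V\<^esub>" by (rule pow1) (use d w in auto)
    finally show ?thesis using q[OF w] d w by (simp add: act_mult)
  qed
  then show "scalar (d \<otimes> d)" using d by (auto simp: scalar_def)
qed

text \<open>The condition on \<open>d \<otimes> w\<close> fixes the class of \<open>d\<close> modulo
  scalars. Two square roots of \<open>q\<close> in one class differ by a scalar with square one,
  that is by \<open>\<one>\<close> or \<open>t\<close>.\<close>

lemma card_square_roots_le:
  assumes t: "t \<in> carrier H" "H.ord t = 2" and w: "w \<in> carrier H"
  shows "card {d \<in> carrier H. d \<otimes> d = q \<and> scalar (d \<otimes> w)} \<le> 2" (is "card ?X \<le> 2")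
proof (cases "?X = {}")
  case True
  then show ?thesis by (metis card.empty zero_le)
next
  case False
  then obtain c where c: "c \<in> carrier H" "c \<otimes> c = q" "scalar (c \<otimes> w)" by blast
  have "?X \<subseteq> {c, t \<otimes> c}"
  proof
    fix d assume "d \<in> ?X"
    then have d: "d \<in> carrier H" "d \<otimes> d = q" "scalar (d \<otimes> w)" by auto
    define r where "r = c \<otimes> w" define s where "s = d \<otimes> w"
    have rc: "r \<in> carrier H" and scar: "s \<in> carrier H" using c d w by (auto simp: r_def s_def)
    have cr: "c = r \<otimes> inv w" and ds: "d = s \<otimes> inv w"
      using c d w by (auto simp: r_def s_def H.m_assoc)
    have sq: "u \<otimes> inv w \<otimes> (u \<otimes> inv w) = u \<otimes> u \<otimes> (inv w \<otimes> inv w)"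
      if "scalar u" for u
    proof -
      have u: "u \<in> carrier H" using that scalar_carrier by blast
      have "inv w \<otimes> (u \<otimes> inv w) = u \<otimes> (inv w \<otimes> inv w)"
        using scalar_commute[OF that, of "inv w", symmetric] u w by (simp add: H.m_assoc[symmetric])
      then show ?thesis using u w by (simp add: H.m_assoc)
    qed
    have "r \<otimes> r \<otimes> (inv w \<otimes> inv w) = s \<otimes> s \<otimes> (inv w \<otimes> inv w)"
    proof -
      have "c \<otimes> c = r \<otimes> r \<otimes> (inv w \<otimes> inv w)"
        using sq[of r] c(3) unfolding cr[symmetric] r_def[symmetric] by blast
      moreover have "d \<otimes> d = s \<otimes> s \<otimes> (inv w \<otimes> inv w)"
        using sq[of s] d(3) unfolding ds[symmetric] s_def[symmetric] by blast
      ultimately show ?thesis using c(2) d(2) by simp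
    qed
    then have rs: "r \<otimes> r = s \<otimes> s" using rc scar w by simp
    have comm: "r \<otimes> s = s \<otimes> r" using scalar_commute[of r s] c(3) scar by (simp add: r_def)
    define u where "u = s \<otimes> inv r"
    have uc: "u \<in> carrier H" and sur: "s = u \<otimes> r" using rc scar by (auto simp: u_def H.m_assoc)
    have ur: "r \<otimes> u = u \<otimes> r" using scalar_commute[of r u] c(3) uc by (simp add: r_def)
    have "s \<otimes> s = u \<otimes> (r \<otimes> u) \<otimes> r"
      unfolding sur using uc rc by (simp add: H.m_assoc)
    also have "\<dots> = u \<otimes> u \<otimes> (r \<otimes> r)"
      unfolding ur using uc rc by (simp add: H.m_assoc)
    finally have "u \<otimes> u \<otimes> (r \<otimes> r) = r \<otimes> r" using rs by simp
    then have "u \<otimes> u = \<one>"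
      using H.r_cancel_one[of "r \<otimes> r" "u \<otimes> u"] uc rc by simp
    then have "u = \<one> \<or> u = t" using square_eq_one[OF t uc] by blast
    then show "d \<in> {c, t \<otimes> c}"
      using sur cr ds rc t w by (auto simp: H.m_assoc)
  qed
  then have "card ?X \<le> card {c, t \<otimes> c}" by (intro card_mono) auto
  also have "\<dots> \<le> 2" by (simp add: card_insert_if)
  finally show ?thesis .
qed

end

section \<open>Induction along the derived series, and commutation factors\<close>

lemma (in group) exp_derived_normal: "(derived G ^^ n) (carrier G) \<lhd> G"
proof (induction n)
  case 0
  then show ?case by (simp add: normal_self)
next
  case (Suc n)
  then show ?case using derived_is_normal by simp
qed

lemma (in group) commutator_mem_derived:
  assumes "a \<in> S" "b \<in> S"
  shows "a \<otimes> b \<otimes> inv a \<otimes> inv b \<in> derived G S"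
  unfolding derived_def by (rule generate.incl) (use assms in blast)

text \<open>The induction climbs from the trivial end of the series. It locates the first nonscalar
  term, and later spreads the normalizing of a subgroup of order 5 to the whole group.\<close>

lemma (in group) derived_series_induct:
  assumes "solvable G" and "P {\<one>}"
    and step: "\<And>M. M \<lhd> G \<Longrightarrow> P (derived G M) \<Longrightarrow> P M"
  shows "P (carrier G)"
proof -
  obtain n where n: "(derived G ^^ n) (carrier G) = {\<one>}"
    using assms(1) solvable_iff_trivial_derived_seq by blast
  have "P ((derived G ^^ (n - k)) (carrier G))" if "k \<le> n" for k
    using that
  proof (induction k)
    case 0
    then show ?case using n assms(2) by simp
  next
    case (Suc k)
    then have "n - k = Suc (n - Suc k)" by simp
    then show ?case using Suc step[OF exp_derived_normal, of "n - Suc k"] by simp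
  qed
  from this[of n] show ?thesis by simp
qed

text \<open>The factor incurred on moving past \<open>z\<close> is multiplicative. With factors in
  {1, t} this is the commutator pairing on a group that is commutative modulo scalars.\<close>

lemma (in group) skew_commute_mult:
  assumes "c \<in> carrier G" "d \<in> carrier G" "z \<in> carrier G" "r \<in> carrier G" "s \<in> carrier G"
    and "c \<otimes> z = r \<otimes> (z \<otimes> c)" "d \<otimes> z = s \<otimes> (z \<otimes> d)" and "c \<otimes> s = s \<otimes> c"
  shows "(c \<otimes> d) \<otimes> z = (s \<otimes> r) \<otimes> (z \<otimes> (c \<otimes> d))"
proof -
  have "(c \<otimes> d) \<otimes> z = c \<otimes> (d \<otimes> z)" using assms(1-5) by (simp add: m_assoc)
  also have "\<dots> = (c \<otimes> s) \<otimes> (z \<otimes> d)" unfolding assms(7) using assms(1-5) by (simp add: m_assoc)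
  also have "\<dots> = s \<otimes> (c \<otimes> z) \<otimes> d" unfolding assms(8) using assms(1-5) by (simp add: m_assoc)
  also have "\<dots> = (s \<otimes> r) \<otimes> (z \<otimes> (c \<otimes> d))" unfolding assms(6) using assms(1-5) by (simp add: m_assoc)
  finally show ?thesis .
qed

context poc_action
begin

text \<open>\<open>D\<close> is the last term of the derived series that is not scalar.  Modulo scalars it is the Klein
  four group generated by \<open>x\<close> and \<open>y\<close>, on which \<open>H\<close> acts with kernel the scalars.\<close>

lemma plane_impossible:
  assumes V2: "order V = p ^ 2" and solv: "solvable H"
  shows False
proof -
  have "\<exists>D. D \<lhd> H \<and> (\<forall>z\<in>derived H D. scalar z) \<and> \<not> (\<forall>z\<in>D. scalar z)"
  proof (rule ccontr)
    assume "\<not> ?thesis"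
    then have "\<forall>z\<in>carrier H. scalar z"
      by (intro H.derived_series_induct[OF solv, of "\<lambda>D. \<forall>z\<in>D. scalar z"]) (auto simp: scalar_one)
    then show False using exists_nonscalar by blast
  qed
  then obtain D where D: "D \<lhd> H" "\<And>z. z \<in> derived H D \<Longrightarrow> scalar z" "\<not> (\<forall>z\<in>D. scalar z)" by blast
  have DH: "D \<subseteq> carrier H" using D(1) normal_imp_subgroup subgroup.subset by blast
  have conjD: "h \<otimes> z \<otimes> inv h \<in> D" if "h \<in> carrier H" "z \<in> D" for h z
    using normal.inv_op_closed2[OF D(1)] that by blast
  obtain x where x: "x \<in> D" "\<not> scalar x" using D(3) by blast
  have xc: "x \<in> carrier H" using x DH by blast
  \<comment> \<open>\<open>y\<close> is a conjugate of \<open>x\<close> that does not commute with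
    \<open>x\<close>; normality keeps it in \<open>D\<close>.\<close>
  obtain y where y: "y \<in> D" and xy: "x \<otimes> y \<noteq> y \<otimes> x"
    using plane_conjugate_not_commuting[OF V2 xc x(2)] conjD[OF _ x(1)] by metis
  have yc: "y \<in> carrier H" using y DH by blast
  obtain t where t: "t \<in> carrier H" "H.ord t = 2" using involution_exists .
  have tt: "t \<otimes> t = \<one>" using H.pow_ord_eq_1[OF t(1)] t square_eq_mult by simp
  have tcen: "z \<otimes> t = t \<otimes> z" if "z \<in> carrier H" for z
    using involution_central[OF t that] by simp
  have skew: "c \<otimes> d = t \<otimes> (d \<otimes> c)" "scalar (d \<otimes> d)"
    if "c \<in> D" "d \<in> D" "c \<otimes> d \<noteq> d \<otimes> c" for c d
    using scalar_commutator[OF V2 _ _ that(3) D(2)[OF H.commutator_mem_derived[OF that(1,2)]] t] that(1,2) DH by blast+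
  have sx: "scalar (x \<otimes> x)" and sy: "scalar (y \<otimes> y)"
    using skew(2)[OF y x(1)] skew(2)[OF x(1) y] xy by auto
  have both: "scalar d" if "d \<in> carrier H" "d \<otimes> x = x \<otimes> d" "d \<otimes> y = y \<otimes> d" for d
    by (rule scalar_if_commutes_with_pair[OF V2 xc yc xy that])
  \<comment> \<open>\<open>sg c z r\<close> records that moving \<open>c\<close> past
    \<open>z\<close> costs the factor \<open>r\<close>; within \<open>D\<close> this factor is
    \<open>\<one>\<close> or \<open>t\<close>.\<close>
  define sg where "sg c z r \<longleftrightarrow> c \<otimes> z = r \<otimes> (z \<otimes> c)" for c z r
  have sg1: "c \<otimes> z = z \<otimes> c" if "sg c z \<one>" "c \<in> carrier H" "z \<in> carrier H" for c z
    using that by (simp add: sg_def)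
  have sgm: "sg (c \<otimes> d) z (s \<otimes> r)"
    if "sg c z r" "sg d z s" "c \<in> carrier H" "d \<in> carrier H" "z \<in> carrier H" "r \<in> {\<one>, t}" "s \<in> {\<one>, t}" for c d z r s
  proof -
    have "c \<otimes> s = s \<otimes> c" using that tcen[of c] by auto
    then show ?thesis
      using H.skew_commute_mult[of c d z r s] that t(1) unfolding sg_def by blast
  qed
  have sgD: "sg c z \<one> \<or> sg c z t" if "c \<in> D" "z \<in> D" for c z
  proof -
    have "c \<in> carrier H" "z \<in> carrier H" using that DH by auto
    then show ?thesis using skew(1)[OF that] by (cases "c \<otimes> z = z \<otimes> c") (simp_all add: sg_def)
  qed
  have sgs: "sg x x \<one>" "sg y y \<one>" "sg x y t" "sg y x t"
    using skew(1)[OF x(1) y] skew(1)[OF y x(1)] xy xc yc by (auto simp: sg_def)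
  have sxy: "sg (x \<otimes> y) x t" "sg (x \<otimes> y) y t"
    using sgm[OF sgs(1,4) xc yc xc] sgm[OF sgs(3,2) xc yc yc] t(1) by simp_all
  \<comment> \<open>The factors of \<open>d\<close> against \<open>x\<close> and \<open>y\<close>
    leave four cases. Multiplying by \<open>\<one>\<close>, \<open>x\<close>, \<open>y\<close> or
    their product cancels both factors, and what commutes with \<open>x\<close> and \<open>y\<close>
    is scalar.\<close>
  have classes: "scalar d \<or> scalar (d \<otimes> x) \<or> scalar (d \<otimes> y) \<or> scalar (d \<otimes> (x \<otimes> y))"
    if d: "d \<in> D" for d
  proof -
    have dc: "d \<in> carrier H" using d DH by blast
    have xyc: "x \<otimes> y \<in> carrier H" using xc yc by simp
    consider "sg d x \<one>" "sg d y \<one>" | "sg d x \<one>" "sg d y t" | "sg d x t" "sg d y \<one>" | "sg d x t" "sg d y t"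
      using sgD[OF d x(1)] sgD[OF d y] by blast
    then show ?thesis
    proof cases
      case 1
      then show ?thesis using both[OF dc] sg1 dc xc yc by blast
    next
      case 2
      have "sg (d \<otimes> x) x \<one>" using sgm[OF 2(1) sgs(1) dc xc xc] by simp
      moreover have "sg (d \<otimes> x) y \<one>" using sgm[OF 2(2) sgs(3) dc xc yc] tt by simp
      ultimately show ?thesis using both[of "d \<otimes> x"] sg1 dc xc yc H.m_closed by blast
    next
      case 3
      have "sg (d \<otimes> y) x \<one>" using sgm[OF 3(1) sgs(4) dc yc xc] tt by simp
      moreover have "sg (d \<otimes> y) y \<one>" using sgm[OF 3(2) sgs(2) dc yc yc] by simp
      ultimately show ?thesis using both[of "d \<otimes> y"] sg1 dc xc yc H.m_closed by blast
    next
      case 4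
      have "sg (d \<otimes> (x \<otimes> y)) x \<one>" using sgm[OF 4(1) sxy(1) dc xyc xc] tt by simp
      moreover have "sg (d \<otimes> (x \<otimes> y)) y \<one>" using sgm[OF 4(2) sxy(2) dc xyc yc] tt by simp
      ultimately show ?thesis using both[of "d \<otimes> (x \<otimes> y)"] sg1 dc xyc xc yc H.m_closed by blast
    qed
  qed
  define R where "R q w = {d \<in> carrier H. d \<otimes> d = q \<and> scalar (d \<otimes> w)}" for q w
  have finR: "finite (R q w)" for q w using finH by (simp add: R_def)
  have cardR: "card (R q w) \<le> 2" if "w \<in> carrier H" for q w
    unfolding R_def by (rule card_square_roots_le[OF t that])
  define X where "X q = {d \<in> D. d \<otimes> d = q \<and> \<not> scalar d}" for q
  have finX: "finite (X q)" for q
    by (rule finite_subset[OF _ finH]) (use DH in \<open>auto simp: X_def\<close>)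
  \<comment> \<open>There are three nonscalar classes, with at most two square roots of
    \<open>q\<close> in each.\<close>
  have cardX: "card (X q) \<le> 6" for q
  proof -
    have "X q \<subseteq> R q x \<union> R q y \<union> R q (x \<otimes> y)"
      using classes DH unfolding X_def R_def by blast
    then have "card (X q) \<le> card (R q x \<union> R q y \<union> R q (x \<otimes> y))"
      using finR by (intro card_mono) auto
    also have "\<dots> \<le> card (R q x) + card (R q y) + card (R q (x \<otimes> y))"
      using card_Un_le[of "R q x \<union> R q y"] card_Un_le[of "R q x" "R q y"] by (meson add_le_mono le_refl le_trans)
    also have "\<dots> \<le> 6" using cardR[OF xc, of q] cardR[OF yc, of q] cardR[of "x \<otimes> y" q] xc yc by simp
    finally show ?thesis .
  qed
  have conj_sq: "(h \<otimes> z \<otimes> inv h) \<otimes> (h \<otimes> z \<otimes> inv h) = z \<otimes> z"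
    if "h \<in> carrier H" "z \<in> carrier H" "scalar (z \<otimes> z)" for h z
    using H.conj_hom[of h z z] H.conj_commute_iff[of h "z \<otimes> z" "z \<otimes> z"] scalar_commute[OF that(3) that(1)] that by simp
  have conj_ns: "\<not> scalar (h \<otimes> z \<otimes> inv h)" if "h \<in> carrier H" "z \<in> carrier H" "\<not> scalar z" for h z
  proof
    assume s: "scalar (h \<otimes> z \<otimes> inv h)"
    have "h \<otimes> z = (h \<otimes> z \<otimes> inv h) \<otimes> h" using that by (simp add: H.m_assoc)
    also have "\<dots> = h \<otimes> (h \<otimes> z \<otimes> inv h)" by (rule scalar_commute[OF s that(1)])
    finally have "z = h \<otimes> z \<otimes> inv h" using that by (simp add: H.m_assoc)
    then show False using s that(3) by simp
  qed
  have conjX: "h \<otimes> z \<otimes> inv h \<in> X q" if "h \<in> carrier H" "z \<in> X q" "scalar q" for h z q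
    using that conjD conj_sq conj_ns DH unfolding X_def by auto
  define C where "C = {h \<in> carrier H. h \<otimes> x = x \<otimes> h}"
  have C: "subgroup C H" unfolding C_def by (rule H.centralizer_subgroup[OF xc])
  \<comment> \<open>The square of \<open>x\<close> is scalar, so all conjugates of \<open>x\<close>
    have the same square.\<close>
  have "(\<lambda>h. h \<otimes> x \<otimes> inv h) ` carrier H \<subseteq> X (x \<otimes> x)"
    using conjX[of _ x "x \<otimes> x"] x sx unfolding X_def by auto
  then have c1: "card ((\<lambda>h. h \<otimes> x \<otimes> inv h) ` carrier H) \<le> 6"
    using card_mono[OF finX] cardX le_trans by blast
  \<comment> \<open>Elements of \<open>C\<close> keep the failure of \<open>y\<close> to commute
    with \<open>x\<close>, so the image lies in the class of \<open>y\<close> or of the product of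
    \<open>x\<close> and \<open>y\<close>: two classes with two roots each.\<close>
  have "(\<lambda>h. h \<otimes> y \<otimes> inv h) ` C \<subseteq> R (y \<otimes> y) y \<union> R (y \<otimes> y) (x \<otimes> y)"
  proof
    fix d assume "d \<in> (\<lambda>h. h \<otimes> y \<otimes> inv h) ` C"
    then obtain h where h: "h \<in> carrier H" "h \<otimes> x = x \<otimes> h" "d = h \<otimes> y \<otimes> inv h" by (auto simp: C_def)
    have dD: "d \<in> D" using h conjD y by simp
    then have dc: "d \<in> carrier H" using DH by blast
    have hx: "h \<otimes> x \<otimes> inv h = x" using H.conj_commute_iff[OF h(1) xc, of x] h xc by simp
    have dx: "d \<otimes> x \<noteq> x \<otimes> d"
    proof
      assume "d \<otimes> x = x \<otimes> d"
      then have "h \<otimes> (y \<otimes> x) \<otimes> inv h = h \<otimes> (x \<otimes> y) \<otimes> inv h"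
        using H.conj_hom[OF h(1) yc xc] H.conj_hom[OF h(1) xc yc] hx h(3) by simp
      then show False using H.conj_inj[OF h(1), of "y \<otimes> x" "x \<otimes> y"] xy xc yc by simp
    qed
    have "\<not> scalar d" using dx scalar_commute xc by blast
    moreover have "\<not> scalar (d \<otimes> x)"
    proof
      assume "scalar (d \<otimes> x)"
      then have "d \<otimes> x \<otimes> x = x \<otimes> (d \<otimes> x)" using scalar_commute xc by blast
      then have "d \<otimes> x \<otimes> x = x \<otimes> d \<otimes> x" using dc xc by (simp add: H.m_assoc)
      then show False using dx dc xc by simp
    qed
    ultimately show "d \<in> R (y \<otimes> y) y \<union> R (y \<otimes> y) (x \<otimes> y)"
      using classes[OF dD] dc conj_sq[OF h(1) yc sy] h(3) unfolding R_def by blast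
  qed
  then have "card ((\<lambda>h. h \<otimes> y \<otimes> inv h) ` C) \<le> card (R (y \<otimes> y) y \<union> R (y \<otimes> y) (x \<otimes> y))"
    using finR by (intro card_mono) auto
  also have "\<dots> \<le> card (R (y \<otimes> y) y) + card (R (y \<otimes> y) (x \<otimes> y))" by (rule card_Un_le)
  also have "\<dots> \<le> 4" using cardR[OF yc, of "y \<otimes> y"] cardR[of "x \<otimes> y" "y \<otimes> y"] xc yc by simp
  finally have c2: "card ((\<lambda>h. h \<otimes> y \<otimes> inv h) ` C) \<le> 4" .
  have finS: "finite {h. scalar h}" by (rule finite_subset[OF _ finH]) (auto simp: scalar_def)
  have "{h \<in> C. h \<otimes> y = y \<otimes> h} \<subseteq> {h. scalar h}" using both by (auto simp: C_def)
  then have c3: "card {h \<in> C. h \<otimes> y = y \<otimes> h} \<le> p - 1"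
    using card_mono[OF finS] card_scalars_le le_trans by blast
  have c4: "card C \<le> 4 * (p - 1)"
    using H.card_conjugates[OF finH yc C] mult_le_mono[OF c2 c3] by simp
  \<comment> \<open>Orbit-stabilizer for \<open>x\<close> and then, inside \<open>C\<close>, for
    \<open>y\<close> bounds (p - 1)(p + 1) by 6 times 4 times \<open>p - 1\<close>.\<close>
  have "order H = card ((\<lambda>h. h \<otimes> x \<otimes> inv h) ` carrier H) * card C"
    using H.card_conjugates[OF finH xc H.subgroup_self] by (simp add: order_def C_def)
  also have "\<dots> \<le> 6 * (4 * (p - 1))" by (rule mult_le_mono[OF c1 c4])
  finally have "order H \<le> 6 * (4 * (p - 1))" .
  moreover have oH: "order H = (p - 1) * (p + 1)"
    using order_H V2 by (simp add: power2_eq_square algebra_simps diff_mult_distrib2)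
  ultimately have "(p - 1) * (p + 1) \<le> (p - 1) * 24" by simp
  then have p23: "p \<le> 23" using p_gt_5 mult_le_cancel1[of "p - 1" "p + 1" 24] by simp
  \<comment> \<open>Conjugation by \<open>c\<close> could still move 5 of the at most 6 elements of
    \<open>X q\<close>. Multiplication by \<open>t\<close> pairs up the moved ones, so their number
    is a multiple of 10 and hence 0. Thus \<open>c\<close> commutes with \<open>x\<close> and
    \<open>y\<close>.\<close>
  have sc5: "scalar c" if c: "c \<in> carrier H" "H.ord c = 5" for c
  proof -
    have commX: "c \<otimes> z = z \<otimes> c" if z: "z \<in> X q" "scalar q" for z q
    proof -
      define f where "f d = c \<otimes> d \<otimes> inv c" for d
      define N where "N = {d \<in> X q. f d \<noteq> d}"
      have XH: "X q \<subseteq> carrier H" using DH by (auto simp: X_def)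
      have "5 dvd card N"
        unfolding N_def
      proof (rule card_nonfixed_dvd)
        fix d assume d: "d \<in> X q"
        show "f d \<in> X q" using conjX[OF c(1) d z(2)] by (simp add: f_def)
        show "(f ^^ 5) d = d" unfolding f_def using H.conj_funpow[OF c(1), of d 5] H.pow_ord_eq_1[OF c(1)] c d XH by auto
      qed (use finX in auto)
      moreover have "2 dvd card {d \<in> N. t \<otimes> d \<noteq> d}"
      proof (rule card_nonfixed_dvd)
        show "finite N" using finX by (simp add: N_def)
        fix d assume d: "d \<in> N"
        then have dX: "d \<in> X q" "d \<in> D" "d \<in> carrier H" "f d \<noteq> d" using XH by (auto simp: N_def X_def)
        have td: "t \<otimes> d \<otimes> (t \<otimes> d) = d \<otimes> d"
        proof -
          have "t \<otimes> d \<otimes> (t \<otimes> d) = t \<otimes> (d \<otimes> t) \<otimes> d" using t dX by (simp add: H.m_assoc)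
          also have "\<dots> = (t \<otimes> t) \<otimes> (d \<otimes> d)" unfolding tcen[OF dX(3)] using t dX by (simp add: H.m_assoc)
          finally show ?thesis using tt dX by simp
        qed
        have tD: "t \<in> D"
        proof -
          have "x \<otimes> y \<otimes> inv (y \<otimes> x) = t"
            using skew(1)[OF x(1) y xy] xc yc t(1) H.inv_solve_right'[of t "x \<otimes> y" "y \<otimes> x"] by simp
          then show ?thesis using normal_imp_subgroup[OF D(1)] x(1) y by (metis subgroup.m_closed subgroup.m_inv_closed)
        qed
        have ns: "\<not> scalar (t \<otimes> d)"
        proof
          assume s: "scalar (t \<otimes> d)"
          have "d \<otimes> z = z \<otimes> d" if "z \<in> carrier H" for z
          proof -
            have "t \<otimes> (d \<otimes> z) = (z \<otimes> t) \<otimes> d"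
              using scalar_commute[OF s that] t dX that by (simp add: H.m_assoc)
            also have "\<dots> = t \<otimes> (z \<otimes> d)" unfolding tcen[OF that] using t dX that by (simp add: H.m_assoc)
            finally show ?thesis using t dX that by simp
          qed
          then have "scalar d" using both dX xc yc by blast
          then show False using dX by (simp add: X_def)
        qed
        have "f (t \<otimes> d) = t \<otimes> f d"
        proof -
          have "f (t \<otimes> d) = (c \<otimes> t) \<otimes> (d \<otimes> inv c)" using c t dX by (simp add: f_def H.m_assoc)
          also have "\<dots> = t \<otimes> f d" unfolding tcen[OF c(1)] using c t dX by (simp add: f_def H.m_assoc)
          finally show ?thesis .
        qed
        then have "f (t \<otimes> d) \<noteq> t \<otimes> d" using dX t c by (simp add: f_def)
        moreover have "t \<otimes> d \<in> D" using tD dX normal_imp_subgroup[OF D(1)] by (simp add: subgroup.m_closed)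
        ultimately show "t \<otimes> d \<in> N" using ns td dX by (simp add: N_def X_def)
        show "(((\<otimes>) t) ^^ 2) d = d"
          using t dX tt by (simp add: numeral_2_eq_2 H.m_assoc[symmetric])
      qed auto
      moreover have "{d \<in> N. t \<otimes> d \<noteq> d} = N"
      proof -
        have "t \<noteq> \<one>" using t by auto
        then show ?thesis using XH t by (auto simp: N_def)
      qed
      ultimately have "5 dvd card N" "2 dvd card N" by simp_all
      then have "10 dvd card N" by presburger
      moreover have "card N \<le> 6" using cardX[of q] card_mono[OF finX, of N q] by (simp add: N_def)
      ultimately have "card N = 0" by (auto elim!: dvdE)
      then have "N = {}" using finX by (simp add: N_def)
      then have "f z = z" using z by (auto simp: N_def)
      then show ?thesis using H.conj_commute_iff[OF c(1), of z z] z XH by (auto simp: f_def)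
    qed
    have "\<not> scalar y" using scalar_commute xy xc by metis
    then show ?thesis
      using both[OF c(1)] commX[of x "x \<otimes> x"] commX[of y "y \<otimes> y"] x y sx sy by (simp add: X_def)
  qed
  have "5 dvd order H" "3 dvd order H" using dvd30 by (auto intro: dvd_trans[of _ 30])
  then obtain c b where c: "c \<in> carrier H" "H.ord c = 5" and b: "b \<in> carrier H" "H.ord b = 3"
    using H.cauchy[OF finH, of 5] H.cauchy[OF finH, of 3] by auto
  have "5 dvd p - 1" using scalar_ord_dvd[OF sc5[OF c]] c by simp
  moreover have "odd p" using prime_p p_gt_5 by (simp add: prime_odd_nat)
  \<comment> \<open>\<open>p\<close> is 1 modulo 10 and lies between 6 and 23.\<close>
  ultimately have "p \<in> {11, 21}" using p23 p_gt_5 by (auto elim!: dvdE) presburger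
  moreover have "\<not> prime (21::nat)" using primes_dvd_imp_eq[of 3 "21::nat"] by auto
  ultimately have p11: "p = 11" using prime_p by auto
  have oH: "order H = 120" using oH p11 by simp
  have bns: "\<not> scalar b" using scalar_ord_dvd[of b] b p11 by auto
  define N where "N n = card {z \<in> carrier H. H.ord z = n}" for n
  have N5: "N 5 = 4"
  proof -
    have "{z \<in> carrier H. H.ord z = 5} = {d \<in> carrier H. H.ord d = 5 \<and> c \<otimes> d = d \<otimes> c}"
      using scalar_commute[OF sc5[OF c]] by blast
    then show ?thesis using prime_order_powers[OF c] by (simp add: N_def)
  qed
  have N15: "N (3 * 5) = N 3 * N 5"
    unfolding N_def
  proof (rule H.card_ord_mult)
    show "coprime 3 (5::nat)" by (rule primes_coprime) simp_all
    show "\<And>x y. x \<in> carrier H \<Longrightarrow> y \<in> carrier H \<Longrightarrow> H.ord x = 3 \<Longrightarrow> H.ord y = 5 \<Longrightarrow> x \<otimes> y = y \<otimes> x"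
      using scalar_commute sc5 by metis
  qed
  have N3mod: "N 3 mod 3 = 2" using card_prime_order_mod[OF b] by (simp add: N_def)
  then have "N 3 \<noteq> 0" by (intro notI) simp
  then have "N 15 \<noteq> 0" using N15 N5 by simp
  then obtain z where "z \<in> carrier H" "H.ord z = 15" unfolding N_def by (metis (mono_tags, lifting) card.empty empty_Collect_eq)
  then have "N 15 dvd 120" using card_ord_dvd oH unfolding N_def by metis
  \<comment> \<open>Since \<open>N 5\<close> is 4, the order class of 15 makes \<open>N 3\<close> a
    divisor of 30. It is also 2 modulo 3, and even because inversion pairs up elements of order 3,
    which leaves 2.\<close>
  then have "N 3 * 4 dvd 30 * 4" using N15 N5 by simp
  then have N30: "N 3 dvd 30" by (simp only: dvd_times_right_cancel_iff)
  have "2 dvd card {z \<in> {z \<in> carrier H. H.ord z = 3}. inv z \<noteq> z}"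
    by (rule card_nonfixed_dvd[OF two_is_prime_nat]) (use finH in \<open>auto simp: numeral_2_eq_2\<close>)
  moreover have "{z \<in> {z \<in> carrier H. H.ord z = 3}. inv z \<noteq> z} = {z \<in> carrier H. H.ord z = 3}"
  proof -
    have "inv z \<noteq> z" if "z \<in> carrier H" "H.ord z = 3" for z
    proof
      assume "inv z = z"
      then have "z [^] (2::nat) = \<one>" using that H.r_inv[of z] square_eq_mult[of z] by simp
      then have "3 dvd (2::nat)" using H.pow_eq_id[of z 2] that by simp
      then show False by simp
    qed
    then show ?thesis by blast
  qed
  ultimately have "even (N 3)" by (simp add: N_def)
  then have "N 3 = 2"
  proof -
    have "N 3 \<le> 30" using N30 by (intro dvd_imp_le) auto
    then have "N 3 = 2 \<or> N 3 = 8 \<or> N 3 = 14 \<or> N 3 = 20 \<or> N 3 = 26"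
      using N3mod \<open>even (N 3)\<close> by presburger
    then show ?thesis using N30 by auto
  qed
  moreover have sub: "(\<lambda>k. b [^] k) ` {0<..<3::nat} \<subseteq> {z \<in> carrier H. H.ord z = 3}"
    using prime_order_powers(1)[OF b] by auto
  ultimately have eq: "(\<lambda>k. b [^] k) ` {0<..<3::nat} = {z \<in> carrier H. H.ord z = 3}"
    using card_seteq[OF _ sub] prime_order_powers(2)[OF b] finH by (simp add: N_def)
  \<comment> \<open>All elements of order 3 are powers of \<open>b\<close>, so every conjugate of
    \<open>b\<close> commutes with it, which is impossible for a nonscalar \<open>b\<close>.\<close>
  obtain h where h: "h \<in> carrier H"
    "b \<otimes> (h \<otimes> b \<otimes> inv h) \<noteq> (h \<otimes> b \<otimes> inv h) \<otimes> b"
    using plane_conjugate_not_commuting[OF V2 b(1) bns] .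
  have "h \<otimes> b \<otimes> inv h \<in> {z \<in> carrier H. H.ord z = 3}"
    using h b H.ord_conj by simp
  then show False using h eq prime_order_powers(1)[OF b] by auto
qed

end

section \<open>Solvable groups acting regularly in dimension four\<close>

text \<open>Under \<open>f\<close> the elements of each order other than 1 fall into cycles of
  length 5, so each prime divisor of the order accounts for at least 5 elements. This forces order
  6, where 2 and 3 would need 10 nonidentity elements. Of \<open>f\<close> only preservation of
  orders is asked.\<close>

lemma (in group) trivial_if_free_automorphism_5:
  assumes fin: "finite (carrier G)" and le: "order G \<le> 6"
    and f: "\<And>x. x \<in> carrier G \<Longrightarrow> f x \<in> carrier G" "\<And>x. x \<in> carrier G \<Longrightarrow> ord (f x) = ord x"
      "\<And>x. x \<in> carrier G \<Longrightarrow> (f ^^ 5) x = x" "\<And>x. x \<in> carrier G \<Longrightarrow> f x = x \<Longrightarrow> x = \<one>"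
  shows "order G = 1"
proof (rule ccontr)
  assume "order G \<noteq> 1"
  have five: "5 dvd card {x \<in> carrier G. ord x = n}" if "n \<noteq> 1" for n
  proof -
    have "5 dvd card {x \<in> {x \<in> carrier G. ord x = n}. f x \<noteq> x}"
      by (rule card_nonfixed_dvd) (use fin f in auto)
    moreover have "f x \<noteq> x" if "x \<in> carrier G" "ord x = n" for x
    proof
      assume "f x = x"
      then have "x = \<one>" using f(4) that by blast
      then show False using that \<open>n \<noteq> 1\<close> by simp
    qed
    then have "{x \<in> {x \<in> carrier G. ord x = n}. f x \<noteq> x} = {x \<in> carrier G. ord x = n}" by blast
    ultimately show ?thesis by simp
  qed
  have ge: "5 \<le> card {x \<in> carrier G. ord x = q}" if "prime q" "q dvd order G" for q
  proof -
    have "\<exists>x\<in>carrier G. ord x = q" by (rule cauchy[OF fin that])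
    then obtain x where "x \<in> carrier G" "ord x = q" by blast
    then have "card {x \<in> carrier G. ord x = q} > 0" using fin by (auto simp: card_gt_0_iff)
    moreover have "q \<noteq> 1" using that by auto
    ultimately show ?thesis using five by (intro dvd_imp_le) auto
  qed
  have le5: "card A \<le> 5" if "A \<subseteq> carrier G - {\<one>}" for A
    using card_mono[OF _ that] fin le by (simp add: order_def)
  obtain q where q: "prime q" "q dvd order G" using \<open>order G \<noteq> 1\<close> prime_factor_nat by blast
  have "ord \<one> \<noteq> q" using q(1) by auto
  then have "{x \<in> carrier G. ord x = q} \<subseteq> carrier G - {\<one>}" by auto
  then have "card {x \<in> carrier G. ord x = q} \<le> order G - 1"
    using card_mono[of "carrier G - {\<one>}" "{x \<in> carrier G. ord x = q}"] fin by (simp add: order_def)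
  then have "order G = 6" using ge[OF q] le by simp
  then have "5 \<le> card {x \<in> carrier G. ord x = 2}" "5 \<le> card {x \<in> carrier G. ord x = 3}"
    using ge[of 2] ge[of 3] by simp_all
  moreover have "card {x \<in> carrier G. ord x = 2} + card {x \<in> carrier G. ord x = 3}
      = card ({x \<in> carrier G. ord x = 2} \<union> {x \<in> carrier G. ord x = 3})"
    by (rule card_Un_disjoint[symmetric]) (use fin in auto)
  moreover have "card ({x \<in> carrier G. ord x = 2} \<union> {x \<in> carrier G. ord x = 3}) \<le> 5"
    by (rule le5) auto
  ultimately show False by simp
qed

lemma (in group) conj_power_iterate:
  assumes "h \<in> carrier G" "c \<in> carrier G" "h \<otimes> c \<otimes> inv h = c [^] (k::nat)"
  shows "h [^] n \<otimes> c \<otimes> inv (h [^] n) = c [^] (k ^ n)"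
proof (induction n)
  case (Suc n)
  have "h [^] Suc n \<otimes> c \<otimes> inv (h [^] Suc n) = h [^] n \<otimes> (h \<otimes> c \<otimes> inv h) \<otimes> inv (h [^] n)"
    using conj_conj[of "h [^] n" h c] assms by simp
  also have "\<dots> = (c [^] (k ^ n)) [^] k" using conj_pow[of "h [^] n" c k] assms Suc by simp
  finally show ?case using assms by (simp add: nat_pow_pow mult.commute)
qed (use assms in simp)

context free_action
begin

definition normalizes :: "'h \<Rightarrow> 'h \<Rightarrow> bool" where
  "normalizes h c \<longleftrightarrow> h \<in> carrier H \<and> (\<exists>k::nat. h \<otimes> c \<otimes> inv h = c [^] k)"

lemma prime_order_power_generates:
  assumes c: "c \<in> carrier H" "H.ord c = q" and q: "prime q" and k: "c [^] (k::nat) \<noteq> \<one>"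
  shows "\<exists>j::nat. c = (c [^] k) [^] j"
proof -
  have "(c [^] k) [^] q = (c [^] q) [^] k" using c by (simp add: H.nat_pow_pow mult.commute)
  then have "H.ord (c [^] k) = q" using H.ord_prime_iff[of "c [^] k" q] c q k by auto
  moreover have "c [^] k \<otimes> c = c \<otimes> c [^] k" using c H.group_commutes_pow[of c c k] by simp
  ultimately show ?thesis
    using commuting_prime_order[of "c [^] k" q c] c q H.pow_ord_eq_1[of c] by auto
qed

text \<open>Closure under inverses uses the prime order: the conjugate of \<open>c\<close> is a
  nontrivial power, so it generates \<open>c\<close> back.\<close>

lemma normalizer_subgroup:
  assumes c: "c \<in> carrier H" "H.ord c = q" and q: "prime q"
  shows "subgroup {h. normalizes h c} H"
proof (rule H.subgroupI)
  show "{h. normalizes h c} \<subseteq> carrier H" by (auto simp: normalizes_def)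
  have "normalizes \<one> c" using c by (auto simp: normalizes_def intro!: exI[of _ 1])
  then show "{h. normalizes h c} \<noteq> {}" by blast
  fix g assume "g \<in> {h. normalizes h c}"
  then obtain k :: nat where g: "g \<in> carrier H" "g \<otimes> c \<otimes> inv g = c [^] k" by (auto simp: normalizes_def)
  have "c \<noteq> \<one>" using c q by auto
  then have "g \<otimes> c \<otimes> inv g \<noteq> g \<otimes> \<one> \<otimes> inv g" using H.conj_inj[OF g(1) c(1) H.one_closed] by simp
  then have "c [^] k \<noteq> \<one>" using g by simp
  then obtain j :: nat where j: "c = (c [^] k) [^] j" using prime_order_power_generates[OF c q] by blast
  have "g \<otimes> c [^] j \<otimes> inv g = c" using H.conj_pow[OF g(1) c(1), of j] g(2) j by simp
  then have "inv g \<otimes> c \<otimes> inv (inv g) = inv g \<otimes> (g \<otimes> c [^] j \<otimes> inv g) \<otimes> inv (inv g)" by simp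
  also have "\<dots> = c [^] j" using H.conj_conj[of "inv g" g "c [^] j"] g c by simp
  finally show "inv g \<in> {h. normalizes h c}" using g by (auto simp: normalizes_def)
  fix h assume "h \<in> {h. normalizes h c}"
  then obtain l :: nat where h: "h \<in> carrier H" "h \<otimes> c \<otimes> inv h = c [^] l" by (auto simp: normalizes_def)
  have "(g \<otimes> h) \<otimes> c \<otimes> inv (g \<otimes> h) = (c [^] k) [^] l"
    using H.conj_conj[OF g(1) h(1) c(1)] H.conj_pow[OF g(1) c(1), of l] g h by simp
  then show "g \<otimes> h \<in> {h. normalizes h c}" using g h c by (auto simp: normalizes_def H.nat_pow_pow)
qed

text \<open>\<open>d\<close> permutes the \<open>q - 1\<close> nontrivial powers of \<open>c\<close>
  with period \<open>q\<close>. Fewer than \<open>q\<close> points leave no room for a moved one, so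
  \<open>d\<close> commutes with \<open>c\<close>.\<close>

lemma normalizes_same_prime_order:
  assumes c: "c \<in> carrier H" "H.ord c = q" and q: "prime q"
    and d: "d \<in> carrier H" "H.ord d = q" "normalizes d c"
  shows "d \<in> (\<lambda>k. c [^] k) ` {0<..<q}" 
proof -
  define P where "P = (\<lambda>k. c [^] k) ` {0<..<q}"
  define f where "f x = d \<otimes> x \<otimes> inv d" for x
  have PE: "P = {x \<in> carrier H. H.ord x = q \<and> c \<otimes> x = x \<otimes> c}" "card P = q - 1"
    using prime_order_powers[OF c q] by (simp_all add: P_def)
  have q1: "q > 1" using prime_gt_1_nat[OF q] .
  obtain k :: nat where k: "f c = c [^] k" using d(3) by (auto simp: normalizes_def f_def)
  have "q dvd card {x \<in> P. f x \<noteq> x}"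
  proof (rule card_nonfixed_dvd[OF q])
    show "finite P" by (simp add: P_def)
    fix x assume x: "x \<in> P"
    then obtain n :: nat where n: "x = c [^] n" by (auto simp: P_def)
    have xH: "x \<in> carrier H" "H.ord x = q" using x PE by auto
    have "f x = c [^] (k * n)" using H.conj_pow[OF d(1) c(1), of n] k c by (simp add: f_def n H.nat_pow_pow)
    then have "c \<otimes> f x = f x \<otimes> c" using H.group_commutes_pow[of c c "k * n"] c by simp
    then show "f x \<in> P" using PE xH d H.ord_conj by (simp add: f_def)
    show "(f ^^ q) x = x" unfolding f_def using H.conj_funpow[OF d(1), of x q] H.pow_ord_eq_1[OF d(1)] d(2) xH by simp
  qed
  moreover have "card {x \<in> P. f x \<noteq> x} < q" using card_mono[of P "{x \<in> P. f x \<noteq> x}"] PE(2) q1 by (simp add: P_def)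
  ultimately have "card {x \<in> P. f x \<noteq> x} = 0" by (metis dvd_imp_le not_gr_zero linorder_not_less)
  then have "{x \<in> P. f x \<noteq> x} = {}" by (simp add: P_def)
  moreover have "c \<in> P" using PE c by simp
  ultimately have "f c = c" by blast
  then have "c \<otimes> d = d \<otimes> c" using H.conj_commute_iff[OF d(1) c(1), of c] by (simp add: f_def)
  then show ?thesis using PE d unfolding P_def by blast
qed

end

context poc_action
begin

text \<open>The quotient of \<open>M\<close> by the normalizer of \<open>\<langle>c\<rangle>\<close> in \<open>M\<close> has order at most 6 and \<open>c\<close> acts on it
  without nontrivial fixed points.\<close>

lemma normalizes_step:
  assumes M: "M \<lhd> H" and c: "c \<in> carrier H" "H.ord c = 5"
    and N5: "card {z \<in> carrier H. H.ord z = 5} \<le> 24"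
    and sub: "\<And>z. z \<in> derived H M \<Longrightarrow> normalizes z c" and m: "m \<in> M"
  shows "normalizes m c"
proof -
  have p5: "prime (5::nat)" by simp
  have MH: "subgroup M H" using M normal_imp_subgroup by blast
  have Mc: "M \<subseteq> carrier H" using MH subgroup.subset by blast
  define K where "K = {h. normalizes h c}"
  have K: "subgroup K H" unfolding K_def by (rule normalizer_subgroup[OF c p5])
  define R where "R = M \<inter> K"
  have RH: "subgroup R H" unfolding R_def by (rule H.subgroups_Inter_pair[OF MH K])
  have Rc: "R \<subseteq> carrier H" using RH subgroup.subset by blast
  define A where "A = H\<lparr>carrier := M\<rparr>"
  interpret A: group A unfolding A_def by (rule H.subgroup_imp_group[OF MH])
  have Asimp [simp]: "carrier A = M" "monoid.mult A = monoid.mult H" "one A = one H" by (simp_all add: A_def)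
  have invA: "inv\<^bsub>A\<^esub> x = inv x" if "x \<in> M" for x
    unfolding A_def using H.m_inv_consistent[OF MH that] .
  have RA: "subgroup R A" unfolding A_def by (rule H.subgroup_incl[OF RH MH]) (simp add: R_def)
  have RnA: "R \<lhd> A"
  proof (rule A.normal_invI[OF RA])
    fix g r assume g: "g \<in> carrier A" and r: "r \<in> R"
    have gr: "g \<in> M" "r \<in> M" "g \<in> carrier H" "r \<in> carrier H" using g r Mc by (auto simp: R_def)
    \<comment> \<open>\<open>R\<close> contains all commutators of \<open>M\<close>, which makes it
      normal in \<open>M\<close> and the quotient \<open>L\<close> a group.\<close>
    have "g \<otimes> r \<otimes> inv g \<otimes> inv r \<in> R"
    proof -
      have "g \<otimes> r \<otimes> inv g \<otimes> inv r \<in> derived H M"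
        by (rule H.commutator_mem_derived[OF gr(1,2)])
      moreover have "derived H M \<subseteq> M" by (rule H.derived_incl[OF _ MH]) simp
      ultimately show ?thesis using sub by (auto simp: R_def K_def)
    qed
    then have "(g \<otimes> r \<otimes> inv g \<otimes> inv r) \<otimes> r \<in> R"
      using r RH by (simp add: subgroup.m_closed)
    then show "g \<otimes>\<^bsub>A\<^esub> r \<otimes>\<^bsub>A\<^esub> inv\<^bsub>A\<^esub> g \<in> R" using gr by (simp add: invA H.m_assoc)
  qed
  interpret R: normal R A by (rule RnA)
  define L where "L = A Mod R"
  interpret L: group L unfolding L_def by (rule R.factorgroup_is_group)
  have Lcar: "carrier L = (\<lambda>x. R #>\<^bsub>A\<^esub> x) ` M" unfolding L_def carrier_FactGroup by simp
  have finL: "finite (carrier L)" unfolding Lcar using finH Mc finite_subset by blast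
  have coset: "R #>\<^bsub>A\<^esub> x = R #> x" for x by (simp add: r_coset_def)
  have oneL: "one L = R" by (simp add: L_def)
  have eqR: "R #>\<^bsub>A\<^esub> x = R \<longleftrightarrow> x \<in> R" if "x \<in> M" for x
    using A.coset_join2[of x R] A.coset_join1[of R x] that RA R.subset by auto
  have eqc: "x \<otimes> inv y \<in> R" if "R #>\<^bsub>A\<^esub> x = R #>\<^bsub>A\<^esub> y" "x \<in> M" "y \<in> M" for x y
  proof -
    have "x \<in> R #>\<^bsub>A\<^esub> y" using A.rcos_self[of x R] RA that by simp
    then have "x \<otimes>\<^bsub>A\<^esub> inv\<^bsub>A\<^esub> y \<in> R" using R.rcos_module_imp[OF A.is_group, of y x] that by simp
    then show ?thesis using that invA by simp
  qed
  have cK: "c \<in> K" using c by (auto simp: K_def normalizes_def H.m_assoc intro!: exI[of _ 1])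
  define \<gamma> where "\<gamma> x = c \<otimes> x \<otimes> inv c" for x
  have \<gamma>M: "\<gamma> x \<in> M" if "x \<in> M" for x
    using normal.inv_op_closed2[OF M c(1) that] by (simp add: \<gamma>_def)
  have \<gamma>K: "\<gamma> x \<in> K \<longleftrightarrow> x \<in> K" if x: "x \<in> M" for x
  proof
    show "x \<in> K \<Longrightarrow> \<gamma> x \<in> K" using K cK by (simp add: \<gamma>_def subgroup.m_closed subgroup.m_inv_closed)
    assume "\<gamma> x \<in> K"
    then have "inv c \<otimes> \<gamma> x \<otimes> c \<in> K" using K cK by (simp add: subgroup.m_closed subgroup.m_inv_closed)
    moreover have "inv c \<otimes> \<gamma> x \<otimes> c = x"
      using H.conj_conj[of "inv c" c x] x Mc c(1) by (auto simp: \<gamma>_def)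
    ultimately show "x \<in> K" by simp
  qed
  have \<gamma>R: "\<gamma> x \<in> R \<longleftrightarrow> x \<in> R" if "x \<in> M" for x using \<gamma>M \<gamma>K that by (simp add: R_def)
  \<comment> \<open>Conjugation by \<open>c\<close> preserves \<open>M\<close> and the normalizer
    \<open>K\<close>, hence permutes the cosets of \<open>R\<close>.\<close>
  define f where "f X = \<gamma> ` X" for X
  have fcos: "f (R #>\<^bsub>A\<^esub> x) = R #>\<^bsub>A\<^esub> \<gamma> x" if x: "x \<in> M" for x
  proof
    have xH: "x \<in> carrier H" using x Mc by blast
    show "f (R #>\<^bsub>A\<^esub> x) \<subseteq> R #>\<^bsub>A\<^esub> \<gamma> x"
    proof
      fix y assume "y \<in> f (R #>\<^bsub>A\<^esub> x)"
      then obtain r where r: "r \<in> R" "y = \<gamma> (r \<otimes> x)" by (auto simp: f_def r_coset_def)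
      have "y = \<gamma> r \<otimes> \<gamma> x" using H.conj_hom[OF c(1), of r x] r Rc xH by (auto simp: \<gamma>_def)
      moreover have "\<gamma> r \<in> R" using \<gamma>R r by (auto simp: R_def)
      ultimately show "y \<in> R #>\<^bsub>A\<^esub> \<gamma> x" by (auto simp: r_coset_def)
    qed
    show "R #>\<^bsub>A\<^esub> \<gamma> x \<subseteq> f (R #>\<^bsub>A\<^esub> x)"
    proof
      fix y assume "y \<in> R #>\<^bsub>A\<^esub> \<gamma> x"
      then obtain r where r: "r \<in> R" "y = r \<otimes> \<gamma> x" by (auto simp: r_coset_def)
      define s where "s = inv c \<otimes> r \<otimes> c"
      have rH: "r \<in> carrier H" "r \<in> M" using r Rc by (auto simp: R_def)
      have \<gamma>s: "\<gamma> s = r" using H.conj_conj[of c "inv c" r] c(1) rH by (simp add: \<gamma>_def s_def)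
      have "s \<in> M" using normal.inv_op_closed1[OF M c(1) rH(2)] by (simp add: s_def)
      then have "s \<in> R" using \<gamma>R[of s] \<gamma>s r(1) by simp
      moreover have "y = \<gamma> (s \<otimes> x)"
        using H.conj_hom[OF c(1), of s x] \<gamma>s r(2) c(1) rH xH by (simp add: \<gamma>_def s_def)
      ultimately show "y \<in> f (R #>\<^bsub>A\<^esub> x)" by (auto simp: f_def r_coset_def)
    qed
  qed
  have "order L = 1"
  proof (rule L.trivial_if_free_automorphism_5[where f = f])
    show "finite (carrier L)" by (rule finL)
    show "f X \<in> carrier L" if "X \<in> carrier L" for X using that fcos \<gamma>M by (auto simp: Lcar)
    show "L.ord (f X) = L.ord X" if X: "X \<in> carrier L" for X
    proof -
      obtain x where x: "x \<in> M" "X = R #>\<^bsub>A\<^esub> x" using X by (auto simp: Lcar)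
      have xc: "x \<in> carrier H" using x Mc by blast
      have "f X [^]\<^bsub>L\<^esub> n = \<one>\<^bsub>L\<^esub> \<longleftrightarrow> X [^]\<^bsub>L\<^esub> n = \<one>\<^bsub>L\<^esub>" for n :: nat
      proof -
        have pw: "y [^]\<^bsub>A\<^esub> n = y [^] n" for y unfolding A_def by (rule H.nat_pow_consistent[symmetric])
        have pM: "x [^] n \<in> M" using A.nat_pow_closed[of x n] x(1) pw by simp
        have "\<gamma> x [^] n = \<gamma> (x [^] n)" using H.conj_pow[OF c(1) xc, of n] by (simp add: \<gamma>_def)
        then show ?thesis
          unfolding x(2) fcos[OF x(1)] L_def R.FactGroup_pow[of x n, simplified, OF x(1)] 
            R.FactGroup_pow[of "\<gamma> x" n, simplified, OF \<gamma>M[OF x(1)]]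
          using eqR[OF pM] eqR[OF \<gamma>M[OF pM]] \<gamma>R[OF pM] pw by simp
      qed
      then show ?thesis using L.ord_unique[of "f X" "L.ord X"] L.pow_eq_id[of X] X fcos[OF x(1)] \<gamma>M[OF x(1)] x
        by (auto simp: Lcar)
    qed
    show "(f ^^ 5) X = X" if X: "X \<in> carrier L" for X
    proof -
      obtain x where x: "x \<in> M" "X = R #>\<^bsub>A\<^esub> x" using X by (auto simp: Lcar)
      have "(\<gamma> ^^ n) x \<in> M \<and> (f ^^ n) X = R #>\<^bsub>A\<^esub> (\<gamma> ^^ n) x" for n
        by (induction n) (use x fcos \<gamma>M in auto)
      moreover have "(\<gamma> ^^ 5) x = x"
        unfolding \<gamma>_def using H.conj_funpow[OF c(1), of x 5] H.pow_ord_eq_1[OF c(1)] c(2) x(1) Mc by auto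
      ultimately show ?thesis using x(2) by metis
    qed
    show "X = \<one>\<^bsub>L\<^esub>" if X: "X \<in> carrier L" "f X = X" for X
    proof -
      obtain x where x: "x \<in> M" "X = R #>\<^bsub>A\<^esub> x" using X(1) by (auto simp: Lcar)
      have xc: "x \<in> carrier H" using x Mc by blast
      \<comment> \<open>For a fixed coset, a conjugate of \<open>inv c\<close> normalizes the
        subgroup generated by \<open>c\<close>. Having order 5, it is a power of \<open>c\<close>,
        so \<open>x\<close> itself normalizes that subgroup.\<close>
      have "\<gamma> x \<otimes> inv x \<in> R" using eqc[of "\<gamma> x" x] X(2) fcos[OF x(1)] x \<gamma>M[OF x(1)] by simp
      then have "inv c \<otimes> (\<gamma> x \<otimes> inv x) \<in> K"
        using K cK by (simp add: R_def subgroup.m_closed subgroup.m_inv_closed)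
      moreover have "inv c \<otimes> (\<gamma> x \<otimes> inv x) = x \<otimes> inv c \<otimes> inv x"
        using c(1) xc by (simp add: \<gamma>_def H.m_assoc[symmetric])
      ultimately have "normalizes (x \<otimes> inv c \<otimes> inv x) c" by (simp add: K_def)
      moreover have "H.ord (x \<otimes> inv c \<otimes> inv x) = 5" using H.ord_conj[OF xc] c by simp
      moreover have "x \<otimes> inv c \<otimes> inv x \<in> carrier H" using xc c(1) by simp
      ultimately have "x \<otimes> inv c \<otimes> inv x \<in> (\<lambda>k. c [^] k) ` {0<..<5::nat}"
        using normalizes_same_prime_order[OF c p5, of "x \<otimes> inv c \<otimes> inv x"] by simp
      then obtain k :: nat where k: "x \<otimes> inv c \<otimes> inv x = c [^] k" by (elim imageE)
      have "x \<otimes> c \<otimes> inv x = inv (x \<otimes> inv c \<otimes> inv x)"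
        using xc c(1) by (simp add: H.inv_mult_group H.m_assoc)
      also have "\<dots> = inv (c [^] k)" by (simp only: k)
      also have "\<dots> = c [^] (4 * k)"
      proof -
        have "c [^] (4 * k) \<otimes> c [^] k = c [^] (5 * k)" using c(1) by (simp add: H.nat_pow_mult)
        also have "\<dots> = \<one>" using H.pow_eq_id[OF c(1), of "5 * k"] c(2) by simp
        finally show ?thesis using c(1) by (simp add: H.inv_equality)
      qed
      finally have "x \<in> R" using x xc by (auto simp: R_def K_def normalizes_def)
      then show ?thesis using eqR x oneL by simp
    qed
    show "order L \<le> 6"
    proof -
      define rep where "rep X = (SOME x. x \<in> M \<and> X = R #>\<^bsub>A\<^esub> x)" for X
      have rep: "rep X \<in> M" "X = R #>\<^bsub>A\<^esub> rep X" if "X \<in> carrier L" for X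
      proof -
        have "\<exists>x. x \<in> M \<and> X = R #>\<^bsub>A\<^esub> x" using that by (auto simp: Lcar)
        then have "rep X \<in> M \<and> X = R #>\<^bsub>A\<^esub> rep X" unfolding rep_def by (rule someI_ex)
        then show "rep X \<in> M" "X = R #>\<^bsub>A\<^esub> rep X" by auto
      qed
      define P where "P = (\<lambda>k. c [^] k) ` {0<..<5::nat}"
      have PE: "P = {d \<in> carrier H. H.ord d = 5 \<and> c \<otimes> d = d \<otimes> c}" "card P = 4"
        using prime_order_powers[OF c p5] by (simp_all add: P_def)
      \<comment> \<open>Different cosets give different conjugates of the subgroup generated by
        \<open>c\<close>, each with its own 4 elements of order 5. At most 24 such elements exist,
        so there are at most 6 cosets.\<close>
      define g where "g = (\<lambda>(X, d). inv (rep X) \<otimes> d \<otimes> inv (inv (rep X)))"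
      have "card (carrier L \<times> P) \<le> card {z \<in> carrier H. H.ord z = 5}"
      proof (rule card_inj_on_le[where f = g])
        show "g ` (carrier L \<times> P) \<subseteq> {z \<in> carrier H. H.ord z = 5}"
        proof safe
          fix X d assume X: "X \<in> carrier L" and d: "d \<in> P"
          have "rep X \<in> carrier H" using rep(1)[OF X] Mc by blast
          moreover have "d \<in> carrier H" "H.ord d = 5" using d PE(1) by auto
          ultimately show "g (X, d) \<in> carrier H" "H.ord (g (X, d)) = 5"
            using H.ord_conj[of "inv (rep X)" d] by (simp_all add: g_def)
        qed
        show "inj_on g (carrier L \<times> P)"
        proof (rule inj_onI)
          fix Xd Ye assume Xd: "Xd \<in> carrier L \<times> P" and Ye: "Ye \<in> carrier L \<times> P" and gg: "g Xd = g Ye"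
          obtain X d where Xd': "Xd = (X, d)" by (cases Xd)
          obtain Y e where Ye': "Ye = (Y, e)" by (cases Ye)
          have X: "X \<in> carrier L" and Y: "Y \<in> carrier L" and d: "d \<in> P" and e: "e \<in> P"
            and eq: "g (X, d) = g (Y, e)"
            using Xd Ye gg by (simp_all add: Xd' Ye')
          have dH: "d \<in> carrier H" "e \<in> carrier H" "H.ord d = 5" using d e PE by auto
          have rH: "rep X \<in> carrier H" "rep Y \<in> carrier H" using rep X Y Mc by auto
          define w where "w = rep X \<otimes> inv (rep Y)"
          have wM: "w \<in> M" "w \<in> carrier H" using rep X Y MH rH by (simp_all add: w_def subgroup.m_closed subgroup.m_inv_closed)
          have "rep X \<otimes> g (X, d) \<otimes> inv (rep X) = d"
            using H.conj_conj[of "rep X" "inv (rep X)" d] rH dH by (simp add: g_def)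
          moreover have "rep X \<otimes> g (Y, e) \<otimes> inv (rep X) = w \<otimes> e \<otimes> inv w"
            using H.conj_conj[of "rep X" "inv (rep Y)" e] rH dH by (simp add: g_def w_def)
          ultimately have wd: "w \<otimes> e \<otimes> inv w = d" using eq by simp
          obtain j k :: nat where jk: "e = c [^] j" "d = c [^] k" using d e by (auto simp: P_def)
          have "e \<noteq> \<one>" using e PE by auto
          then obtain i :: nat where i: "c = e [^] i"
            using prime_order_power_generates[OF c p5, of j] jk by auto
          have "w \<otimes> c \<otimes> inv w = d [^] i" using H.conj_pow[OF wM(2) dH(2), of i] wd i by simp
          also have "\<dots> = c [^] (k * i)" using jk c(1) by (simp add: H.nat_pow_pow)
          finally have "w \<in> R" using wM by (auto simp: R_def K_def normalizes_def)
          then have "rep X \<in> R #>\<^bsub>A\<^esub> rep Y"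
            using rH by (auto simp: r_coset_def w_def H.m_assoc intro!: bexI[of _ w])
          then have "R #>\<^bsub>A\<^esub> rep Y = R #>\<^bsub>A\<^esub> rep X"
            using A.repr_independence[of "rep X" R "rep Y"] rep Y RA by simp
          then have XY: "X = Y" using rep(2)[OF X] rep(2)[OF Y] by simp
          have "w = \<one>" using XY rH by (simp add: w_def)
          then have "d = e" using wd dH by simp
          then show "Xd = Ye" using XY Xd' Ye' by simp
        qed
      qed (use finH in simp)
      then show ?thesis using N5 PE(2) by (simp add: card_cartesian_product order_def)
    qed
  qed
  then have "carrier L = {R}" using oneL L.one_closed by (metis card_1_singletonE order_def singletonD)
  then have "R #>\<^bsub>A\<^esub> m = R" using m by (auto simp: Lcar)
  then show ?thesis using eqR[OF m] by (simp add: R_def K_def)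
qed

text \<open>7 has order 4 modulo 5, so 5 divides \<open>7 ^ k - 1\<close> for no \<open>k\<close>
  from 1 to 3.\<close>

lemma order5_irreducible:
  assumes V4: "order V = 7 ^ 4" and p7: "p = 7" and c: "c \<in> carrier H" "H.ord c = 5"
    and S: "subgroup S V" "v \<in> S" "v \<noteq> \<one>\<^bsub>V\<^esub>" and stable: "\<And>s. s \<in> S \<Longrightarrow> act c s \<in> S"
  shows "S = carrier V"
proof -
  have SV: "S \<subseteq> carrier V" using S(1) subgroup.subset by blast
  have finS: "finite S" using SV finV finite_subset by blast
  obtain k where k: "card S = 7 ^ k" using subgroup_card_power[OF S(1)] p7 by blast
  have "card S \<le> 7 ^ 4" using card_mono[OF finV SV] V4 by (simp add: order_def)
  then have "(7::nat) ^ k \<le> 7 ^ 4" using k by simp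
  then have "k \<le> 4" by (rule power_le_imp_le_exp[rotated]) simp
  have "card {\<one>\<^bsub>V\<^esub>, v} \<le> card S"
    using S subgroup.one_closed[OF S(1)] by (intro card_mono[OF finS]) auto
  then have "k \<noteq> 0" using k S(3) by (intro notI) simp
  have "5 dvd card S - 1" using stable_ord_dvd[OF c(1) S(1) stable] c(2) by simp
  then have "5 dvd (7::nat) ^ k - 1" using k by simp
  moreover have "k = 1 \<or> k = 2 \<or> k = 3 \<or> k = 4" using \<open>k \<le> 4\<close> \<open>k \<noteq> 0\<close> by linarith
  ultimately have "k = 4" by auto
  then show ?thesis using card_seteq[OF finV SV] k V4 by (simp add: order_def)
qed

lemma order5_centralizer_commutative:
  assumes V4: "order V = 7 ^ 4" and p7: "p = 7" and c: "c \<in> carrier H" "H.ord c = 5"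
    and h: "h \<in> carrier H" "h \<otimes> c = c \<otimes> h"
    and k: "k \<in> carrier H" "k \<otimes> c = c \<otimes> k"
  shows "h \<otimes> k = k \<otimes> h"
proof -
  obtain v where v: "v \<in> carrier V" "v \<noteq> \<one>\<^bsub>V\<^esub>" using nonzero_exists .
  show ?thesis
    by (rule centralizer_commutative[OF c(1) v _ h k]) (rule order5_irreducible[OF V4 p7 c _ _ v(2)])
qed

text \<open>As \<open>i\<^sup>2 = -1\<close>, the space \<open>V\<close> is a plane over the field of 49 elements generated by \<open>i\<close>.\<close>

lemma order5_quadratic:
  assumes V4: "order V = 7 ^ 4" and p7: "p = 7" and c: "c \<in> carrier H" "H.ord c = 5"
    and i: "i \<in> carrier H" "H.ord i = 4" "i \<otimes> c = c \<otimes> i"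
  shows "\<exists>(k1::int) (k2::int) (m1::int) (m2::int). \<forall>w\<in>carrier V. act c (act c w) =
    (w [^]\<^bsub>V\<^esub> k1 \<otimes>\<^bsub>V\<^esub> act i w [^]\<^bsub>V\<^esub> k2) \<otimes>\<^bsub>V\<^esub> (act c w [^]\<^bsub>V\<^esub> m1 \<otimes>\<^bsub>V\<^esub> act i (act c w) [^]\<^bsub>V\<^esub> m2)"
proof -
  obtain v where v: "v \<in> carrier V" "v \<noteq> \<one>\<^bsub>V\<^esub>" using nonzero_exists .
  have ic: "act i (act c w) = act c (act i w)" if "w \<in> carrier V" for w
    using act_mult[OF i(1) c(1) that] act_mult[OF c(1) i(1) that] i(3) by simp
  have "i [^] (2::nat) \<in> carrier H" "H.ord (i [^] (2::nat)) = 2"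
    using i H.ord_pow[of i 2] by simp_all
  then have ii: "act i (act i w) = inv\<^bsub>V\<^esub> w" if "w \<in> carrier V" for w
    using involution_act[of "i [^] (2::nat)" w] act_mult[OF i(1) i(1) that] that square_eq_mult[OF i(1)] by simp
  have iv: "act i v \<in> carrier V" using i v by simp
  \<comment> \<open>\<open>U\<close> is the line of \<open>v\<close> over the field generated by
    \<open>i\<close>; \<open>S\<close> below is the span of \<open>v\<close> and
    \<open>act c v\<close> over this field.\<close>
  define U where "U = {v [^]\<^bsub>V\<^esub> \<alpha> \<otimes>\<^bsub>V\<^esub> act i v [^]\<^bsub>V\<^esub> \<beta> | (\<alpha>::int) (\<beta>::int). True}"
  have UI: "v [^]\<^bsub>V\<^esub> \<alpha> \<otimes>\<^bsub>V\<^esub> act i v [^]\<^bsub>V\<^esub> \<beta> \<in> U" for \<alpha> \<beta> :: int by (auto simp: U_def)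
  have Usub: "subgroup U V" and vU: "v \<in> U" unfolding U_def by (rule span_subgroup[OF v(1) iv])+
  have Ui: "act i u \<in> U" if u: "u \<in> U" for u
  proof -
    obtain \<alpha> \<beta> :: int where "u = v [^]\<^bsub>V\<^esub> \<alpha> \<otimes>\<^bsub>V\<^esub> act i v [^]\<^bsub>V\<^esub> \<beta>" using u unfolding U_def by blast
    then have "act i u = v [^]\<^bsub>V\<^esub> (- \<beta>) \<otimes>\<^bsub>V\<^esub> act i v [^]\<^bsub>V\<^esub> \<alpha>"
      using v iv i(1) ii[OF v(1)] by (simp add: V.int_pow_neg V.int_pow_inv V.m_comm)
    then show ?thesis using UI by simp
  qed
  have UV: "U \<subseteq> carrier V" using Usub subgroup.subset by blast
  define S where "S = U <#>\<^bsub>V\<^esub> (act c ` U)"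
  have cU: "subgroup (act c ` U) V"
    using group_hom.subgroup_img_is_subgroup[OF act_group_hom[OF c(1)] Usub] .
  have S: "subgroup S V" unfolding S_def by (rule V.mult_subgroups[OF Usub cU])
  have SV: "S \<subseteq> carrier V" using S subgroup.subset by blast
  have finS: "finite S" using SV finV finite_subset by blast
  have SI: "x \<otimes>\<^bsub>V\<^esub> act c y \<in> S" if "x \<in> U" "y \<in> U" for x y using that by (auto simp: S_def set_mult_def)
  have oneU: "\<one>\<^bsub>V\<^esub> \<in> U" using subgroup.one_closed[OF Usub] .
  have US: "U \<subseteq> S"
  proof
    fix u assume "u \<in> U"
    then show "u \<in> S" using SI[of u "\<one>\<^bsub>V\<^esub>"] oneU UV c(1) by auto
  qed
  have cS: "act c u \<in> S" if "u \<in> U" for u using SI[of "\<one>\<^bsub>V\<^esub>" u] oneU UV c(1) that by auto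
  have Si: "act i s \<in> S" if s: "s \<in> S" for s
  proof -
    obtain x y where xy: "x \<in> U" "y \<in> U" "s = x \<otimes>\<^bsub>V\<^esub> act c y" using s by (auto simp: S_def set_mult_def)
    then have xyV: "x \<in> carrier V" "y \<in> carrier V" using UV by auto
    have "act i s = act i x \<otimes>\<^bsub>V\<^esub> act c (act i y)" using xyV i(1) c(1) ic[OF xyV(2)] by (simp add: xy(3))
    then show ?thesis using SI Ui xy by simp
  qed
  \<comment> \<open>Invariance under \<open>i\<close> makes 4 a divisor of \<open>7 ^ k - 1\<close>,
    which excludes odd \<open>k\<close>.\<close>
  have even: "card W \<in> {7 ^ 2, 7 ^ 4}"
    if W: "subgroup W V" "v \<in> W" "\<And>w. w \<in> W \<Longrightarrow> act i w \<in> W" for W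
  proof -
    have WV: "W \<subseteq> carrier V" using W(1) subgroup.subset by blast
    have finW: "finite W" using WV finV finite_subset by blast
    obtain k where k: "card W = 7 ^ k" using subgroup_card_power[OF W(1)] p7 by blast
    have "card W \<le> 7 ^ 4" using card_mono[OF finV WV] V4 by (simp add: order_def)
    then have "(7::nat) ^ k \<le> 7 ^ 4" using k by simp
    then have "k \<le> 4" by (rule power_le_imp_le_exp[rotated]) simp
    have "card {\<one>\<^bsub>V\<^esub>, v} \<le> card W"
      using W subgroup.one_closed[OF W(1)] by (intro card_mono[OF finW]) auto
    then have "k \<noteq> 0" using k v(2) by (intro notI) simp
    have "4 dvd card W - 1" using stable_ord_dvd[OF i(1) W(1) W(3)] i(2) by simp
    then have "4 dvd (7::nat) ^ k - 1" using k by simp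
    moreover have "k = 1 \<or> k = 2 \<or> k = 3 \<or> k = 4" using \<open>k \<le> 4\<close> \<open>k \<noteq> 0\<close> by linarith
    ultimately have "k = 2 \<or> k = 4" by auto
    then show ?thesis using k by auto
  qed
  \<comment> \<open>With \<open>7 ^ 2\<close> elements \<open>S\<close> would equal
    \<open>U\<close>, and \<open>U\<close> would be invariant under \<open>c\<close>.\<close>
  have "S = carrier V"
  proof (cases "card S = 7 ^ 4")
    case True
    then show ?thesis using card_seteq[OF finV SV] V4 by (simp add: order_def)
  next
    case False
    then have c2: "card S = 7 ^ 2" using even[OF S _ Si] vU US by auto
    then have "card S \<le> card U" using even[OF Usub vU Ui] by auto
    then have "U = S" using card_seteq[OF finS US] by blast
    then show ?thesis using order5_irreducible[OF V4 p7 c Usub vU v(2)] cS by blast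
  qed
  then have "act c (act c v) \<in> S" using v c by simp
  then obtain x y where xy: "x \<in> U" "y \<in> U" "act c (act c v) = x \<otimes>\<^bsub>V\<^esub> act c y" by (auto simp: S_def set_mult_def)
  obtain k1 k2 :: int where x: "x = v [^]\<^bsub>V\<^esub> k1 \<otimes>\<^bsub>V\<^esub> act i v [^]\<^bsub>V\<^esub> k2" using xy(1) unfolding U_def by blast
  obtain m1 m2 :: int where y: "y = v [^]\<^bsub>V\<^esub> m1 \<otimes>\<^bsub>V\<^esub> act i v [^]\<^bsub>V\<^esub> m2" using xy(2) unfolding U_def by blast
  \<comment> \<open>The relation found at \<open>v\<close> spreads to all vectors: those satisfying
    it form a subgroup stable under \<open>c\<close>, and \<open>c\<close> acts irreducibly.\<close>
  define Q where "Q w = (w [^]\<^bsub>V\<^esub> k1 \<otimes>\<^bsub>V\<^esub> act i w [^]\<^bsub>V\<^esub> k2) \<otimes>\<^bsub>V\<^esub> (act c w [^]\<^bsub>V\<^esub> m1 \<otimes>\<^bsub>V\<^esub> act i (act c w) [^]\<^bsub>V\<^esub> m2)" for w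
  have Qc: "Q w \<in> carrier V" if "w \<in> carrier V" for w using that i(1) c(1) by (simp add: Q_def)
  have Qhom: "Q (a \<otimes>\<^bsub>V\<^esub> b) = Q a \<otimes>\<^bsub>V\<^esub> Q b" if "a \<in> carrier V" "b \<in> carrier V" for a b
    using that i(1) c(1) by (simp add: Q_def V.int_pow_distrib V.m_ac)
  have Qinv: "Q (inv\<^bsub>V\<^esub> a) = inv\<^bsub>V\<^esub> (Q a)" if "a \<in> carrier V" for a
    using that i(1) c(1) by (simp add: Q_def V.inv_mult V.int_pow_inv)
  have Qv: "act c (act c v) = Q v"
    unfolding xy(3) x y Q_def using v iv c(1) i(1) ic[OF v(1)] by simp
  define T where "T = {w \<in> carrier V. act c (act c w) = Q w}"
  have T: "subgroup T V"
  proof (rule V.subgroupI)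
    show "T \<subseteq> carrier V" by (auto simp: T_def)
    show "T \<noteq> {}" using v Qv by (auto simp: T_def)
    fix a assume a: "a \<in> T"
    then show "inv\<^bsub>V\<^esub> a \<in> T" using c(1) by (simp add: T_def Qinv)
    fix b assume b: "b \<in> T"
    show "a \<otimes>\<^bsub>V\<^esub> b \<in> T" using a b c(1) by (simp add: T_def Qhom)
  qed
  have vT: "v \<in> T" using v Qv by (simp add: T_def)
  have cT: "act c w \<in> T" if w: "w \<in> T" for w
  proof -
    have wV: "w \<in> carrier V" "act c (act c w) = Q w" using w by (auto simp: T_def)
    have "act c (Q w) = Q (act c w)" using wV(1) c(1) i(1) ic by (simp add: Q_def)
    then show ?thesis using wV c(1) by (simp add: T_def)
  qed
  have "T = carrier V" by (rule order5_irreducible[OF V4 p7 c T vT v(2) cT])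
  then have "\<forall>w\<in>carrier V. act c (act c w) = Q w" by (auto simp: T_def)
  then show ?thesis unfolding Q_def by blast
qed

text \<open>The analogue of \<open>plane_conjugates_eq\<close> over the field of 49 elements; its
  coefficients involve \<open>i\<close>, so the conjugating elements have to commute with
  \<open>i\<close>.\<close>

lemma order5_conjugates_eq:
  assumes V4: "order V = 7 ^ 4" and p7: "p = 7" and c: "c \<in> carrier H" "H.ord c = 5"
    and i: "i \<in> carrier H" "H.ord i = 4" "i \<otimes> c = c \<otimes> i"
    and g: "g \<in> carrier H" "i \<otimes> g = g \<otimes> i" and h: "h \<in> carrier H" "i \<otimes> h = h \<otimes> i"
    and d: "d = g \<otimes> c \<otimes> inv g" and e: "e = h \<otimes> c \<otimes> inv h"
    and cd: "c \<otimes> d = d \<otimes> c" "c \<noteq> d" and ce: "c \<otimes> e = e \<otimes> c" "c \<noteq> e"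
  shows "d = e"
proof -
  obtain k1 k2 m1 m2 :: int where q: "\<And>w. w \<in> carrier V \<Longrightarrow> act c (act c w) =
    (w [^]\<^bsub>V\<^esub> k1 \<otimes>\<^bsub>V\<^esub> act i w [^]\<^bsub>V\<^esub> k2) \<otimes>\<^bsub>V\<^esub> (act c w [^]\<^bsub>V\<^esub> m1 \<otimes>\<^bsub>V\<^esub> act i (act c w) [^]\<^bsub>V\<^esub> m2)"
    using order5_quadratic[OF V4 p7 c i] by blast
  have icom: "act i (act k w) = act k (act i w)" if "k \<in> {c, g, h}" "w \<in> carrier V" for k w
  proof -
    have k: "k \<in> carrier H" "i \<otimes> k = k \<otimes> i" using that c g h i by auto
    show ?thesis using act_mult[OF i(1) k(1) that(2)] act_mult[OF k(1) i(1) that(2)] k(2) by simp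
  qed
  show ?thesis
  proof (rule quadratic_conjugates_eq[where L = "\<lambda>w. w [^]\<^bsub>V\<^esub> k1 \<otimes>\<^bsub>V\<^esub> act i w [^]\<^bsub>V\<^esub> k2"
        and M = "\<lambda>w. w [^]\<^bsub>V\<^esub> m1 \<otimes>\<^bsub>V\<^esub> act i w [^]\<^bsub>V\<^esub> m2", OF c(1) g(1) h(1) _ _ _ q d e cd ce])
    fix k w assume k: "k \<in> {c, g, h}" and w: "w \<in> carrier V"
    have "k \<in> carrier H" using k c g h by auto
    then show "act k w [^]\<^bsub>V\<^esub> k1 \<otimes>\<^bsub>V\<^esub> act i (act k w) [^]\<^bsub>V\<^esub> k2 = act k (w [^]\<^bsub>V\<^esub> k1 \<otimes>\<^bsub>V\<^esub> act i w [^]\<^bsub>V\<^esub> k2) \<and>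
      act k w [^]\<^bsub>V\<^esub> m1 \<otimes>\<^bsub>V\<^esub> act i (act k w) [^]\<^bsub>V\<^esub> m2 = act k (w [^]\<^bsub>V\<^esub> m1 \<otimes>\<^bsub>V\<^esub> act i w [^]\<^bsub>V\<^esub> m2)"
      using icom[OF k w] w i(1) by simp
  qed (use i in auto)
qed

text \<open>The commutative centralizer \<open>Z\<close> of \<open>c\<close> has index at most 4
  once the subgroup of order 5 is normal, and \<open>commutative_index\<close> makes it 4. A
  2-element \<open>u\<close> inducing an automorphism of order 4 on that subgroup acts on the cyclic
  2-part of \<open>Z\<close> by an odd exponent \<open>k\<close>; both residues of \<open>k\<close>
  modulo 4 are contradictory.\<close>

lemma dimension_four_impossible:
  assumes V4: "order V = 7 ^ 4" and p7: "p = 7" and solv: "solvable H"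
  shows False
proof -
  have p5: "prime (5::nat)" by simp
  have oH: "order H = 2400" using order_H V4 by simp
  then obtain c where c: "c \<in> carrier H" "H.ord c = 5"
    using H.cauchy[OF finH p5] by auto
  define N5 where "N5 = card {z \<in> carrier H. H.ord z = 5}"
  have N5: "N5 \<le> 24"
  proof -
    \<comment> \<open>\<open>N5\<close> divides 2400 and is 4 modulo 5, so it is prime to 25 and
      divides 96; this leaves 4 and 24.\<close>
    have "N5 dvd 96 * 5 ^ 2" using card_ord_dvd[OF c] oH by (simp add: N5_def)
    moreover have m: "N5 mod 5 = 4" using card_prime_order_mod[OF c p5] by (simp add: N5_def)
    then have "\<not> 5 dvd N5" by presburger
    then have "coprime N5 5" using prime_imp_coprime[OF p5] coprime_commute by blast
    then have "coprime N5 (5 ^ 2)" by (simp only: coprime_power_right_iff simp_thms)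
    ultimately have d: "N5 dvd 96" using coprime_dvd_mult_left_iff by blast
    then have "N5 \<le> 96" by (intro dvd_imp_le) auto
    show ?thesis
    proof (rule ccontr)
      assume "\<not> N5 \<le> 24"
      then have "N5 = 29 \<or> N5 = 34 \<or> N5 = 39 \<or> N5 = 44 \<or> N5 = 49 \<or> N5 = 54 \<or> N5 = 59 \<or>
        N5 = 64 \<or> N5 = 69 \<or> N5 = 74 \<or> N5 = 79 \<or> N5 = 84 \<or> N5 = 89 \<or> N5 = 94"
        using \<open>N5 \<le> 96\<close> m by presburger
      then show False using d by auto
    qed
  qed
  have "\<forall>d\<in>{z \<in> carrier H. H.ord z = 5}. \<forall>h\<in>carrier H. normalizes h d"
  proof (rule H.derived_series_induct[OF solv, of "\<lambda>M. \<forall>d\<in>{z \<in> carrier H. H.ord z = 5}. \<forall>h\<in>M. normalizes h d"])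
    show "\<forall>d\<in>{z \<in> carrier H. H.ord z = 5}. \<forall>h\<in>{\<one>}. normalizes h d"
      by (auto simp: normalizes_def intro!: exI[of _ 1])
    fix M assume M: "M \<lhd> H" "\<forall>d\<in>{z \<in> carrier H. H.ord z = 5}. \<forall>h\<in>derived H M. normalizes h d"
    then show "\<forall>d\<in>{z \<in> carrier H. H.ord z = 5}. \<forall>h\<in>M. normalizes h d"
      using normalizes_step[OF M(1)] N5 unfolding N5_def by simp
  qed
  then have norm: "normalizes h c" if "h \<in> carrier H" for h using c that by blast
  define P where "P = (\<lambda>k. c [^] k) ` {0<..<5::nat}"
  have PE: "P = {d \<in> carrier H. H.ord d = 5 \<and> c \<otimes> d = d \<otimes> c}" "card P = 4"
    using prime_order_powers[OF c p5] by (simp_all add: P_def)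
  have all5: "d \<in> P" if "d \<in> carrier H" "H.ord d = 5" for d
    using normalizes_same_prime_order[OF c p5 that norm[OF that(1)]] by (simp add: P_def)
  have cpow: "c [^] m = c [^] (m mod 5)" for m :: nat
    using H.pow_mod_exponent[OF c(1)] H.pow_ord_eq_1[OF c(1)] c(2) by metis
  have cinj: "m = n" if "c [^] m = c [^] n" "m < 5" "n < 5" for m n :: nat
    using H.ord_inj[OF c(1)] c(2) that unfolding inj_on_def by simp
  define Z where "Z = {h \<in> carrier H. h \<otimes> c = c \<otimes> h}"
  have Z: "subgroup Z H" unfolding Z_def by (rule H.centralizer_subgroup[OF c(1)])
  have Zcomm: "x \<otimes> y = y \<otimes> x" if "x \<in> Z" "y \<in> Z" for x y
    using order5_centralizer_commutative[OF V4 p7 c] that by (simp add: Z_def)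
  have Zconj: "h \<in> Z \<longleftrightarrow> h \<otimes> c \<otimes> inv h = c" if "h \<in> carrier H" for h
    using H.conj_commute_iff[OF that c(1), of c] that c(1) by (auto simp: Z_def)
  define j where "j = card ((\<lambda>h. h \<otimes> c \<otimes> inv h) ` carrier H)"
  have HZ: "order H = j * card Z"
    using H.card_conjugates[OF finH c(1) H.subgroup_self] by (simp add: order_def j_def Z_def)
  have clsub: "(\<lambda>h. h \<otimes> c \<otimes> inv h) ` carrier H \<subseteq> P"
    using all5 H.ord_conj c by auto
  have finP: "finite P" by (simp add: P_def)
  have j4: "j \<le> 4" using card_mono[OF finP clsub] PE(2) by (simp add: j_def)
  have "j > 0" using HZ oH by (intro gr0I) simp
  \<comment> \<open>An element of order 3 acts on \<open>c\<close> by an exponent whose cube is 1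
    modulo 5. The exponent is then 1, so the element lies in \<open>Z\<close>.\<close>
  have "3 dvd card Z"
  proof -
    obtain b where b: "b \<in> carrier H" "H.ord b = 3" using H.cauchy[OF finH, of 3] oH by auto
    have "b \<otimes> c \<otimes> inv b \<in> P" using clsub b(1) by blast
    then obtain k where k: "0 < k" "k < 5" "b \<otimes> c \<otimes> inv b = c [^] (k::nat)"
      by (auto simp: P_def)
    have "c [^] (k ^ 3) = c" using H.conj_power_iterate[OF b(1) c(1) k(3), of 3] H.pow_ord_eq_1[OF b(1)] b(2) c(1) by simp
    then have "c [^] (k ^ 3 mod 5) = c [^] (1::nat)" using cpow[of "k ^ 3"] c(1) by simp
    then have "k ^ 3 mod 5 = 1" using cinj[of "k ^ 3 mod 5" 1] by simp
    moreover have "k = 1 \<or> k = 2 \<or> k = 3 \<or> k = 4" using k by auto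
    ultimately have "k = 1" by auto
    then have "b \<in> Z" using Zconj[OF b(1)] k(3) c(1) by simp
    then have "group.ord (H\<lparr>carrier := Z\<rparr>) b dvd order (H\<lparr>carrier := Z\<rparr>)"
      using group.ord_dvd_group_order[OF H.subgroup_imp_group[OF Z]] by simp
    then show ?thesis using H.ord_subgroup[OF Z] b(2) by (simp add: order_def)
  qed
  moreover have "5 dvd card Z" "2 dvd card Z"
  proof -
    have "j = 1 \<or> j = 2 \<or> j = 3 \<or> j = 4" using j4 \<open>j > 0\<close> by linarith
    then have "card Z = 2400 \<or> card Z = 1200 \<or> card Z = 800 \<or> card Z = 600" using HZ oH by auto
    then show "5 dvd card Z" "2 dvd card Z" by auto
  qed
  ultimately have Z30: "30 dvd card Z" by presburger
  have inZ: "g \<in> Z" if g: "g \<in> carrier H" "H.ord g = card Z" for g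
  proof -
    \<comment> \<open>\<open>g [^] q\<close> has order 5 and generates the same subgroup as
      \<open>c\<close>, so \<open>c\<close> is a power of \<open>g\<close>.\<close>
    obtain q where q: "card Z = 5 * q" using \<open>5 dvd card Z\<close> by blast
    have "q \<noteq> 0" using q HZ oH by (intro notI) simp
    define d where "d = g [^] q"
    have "H.ord d = 5" using H.ord_pow[OF g(1), of q] g(2) q \<open>q \<noteq> 0\<close> by (simp add: d_def)
    then have d: "d \<in> P" "d \<noteq> \<one>" using all5 g by (auto simp: d_def)
    then obtain k :: nat where k: "d = c [^] k" by (auto simp: P_def)
    obtain l :: nat where l: "c = d [^] l" using prime_order_power_generates[OF c p5, of k] d(2) k by auto
    then have "c = g [^] (q * l)" using g(1) by (simp add: d_def H.nat_pow_pow)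
    then show ?thesis using H.group_commutes_pow[of g g "q * l"] g(1) by (simp add: Z_def)
  qed
  have "4 dvd j" and ex: "\<exists>g\<in>Z. H.ord g = card Z"
    using commutative_index[OF Z Zcomm Z30 HZ inZ] by blast+
  then have j: "j = 4" using j4 \<open>j > 0\<close> by presburger
  then have cZ: "card Z = 600" using HZ oH by simp
  have "(\<lambda>h. h \<otimes> c \<otimes> inv h) ` carrier H = P"
    using card_seteq[OF finP clsub] PE(2) j by (simp add: j_def)
  moreover have "c [^] (2::nat) \<in> P" by (auto simp: P_def)
  ultimately have "c [^] (2::nat) \<in> (\<lambda>h. h \<otimes> c \<otimes> inv h) ` carrier H" by simp
  then obtain h where h: "h \<in> carrier H" "h \<otimes> c \<otimes> inv h = c [^] (2::nat)" by (elim imageE) simp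
  \<comment> \<open>75 is the odd part of 2400 = 32 * 75, so the order of \<open>u\<close> divides
    32. As 2^75 is 3 modulo 5, \<open>u\<close> still generates the automorphisms of the subgroup of
    order 5.\<close>
  define u where "u = h [^] (75::nat)"
  have u: "u \<in> carrier H" using h by (simp add: u_def)
  have uc: "u \<otimes> c \<otimes> inv u = c [^] (3::nat)"
  proof -
    have "(2::nat) ^ 75 mod 5 = 3" by simp
    then show ?thesis using H.conj_power_iterate[OF h(1) c(1) h(2), of 75] cpow[of "2 ^ 75"] by (simp add: u_def)
  qed
  have uuc: "u [^] n \<otimes> c \<otimes> inv (u [^] n) = c [^] (3 ^ n mod 5 :: nat)" for n :: nat
    using H.conj_power_iterate[OF u c(1) uc, of n] cpow[of "3 ^ n"] by simp
  define w where "w = u [^] (2::nat)"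
  have w: "w \<in> carrier H" "w = u \<otimes> u" using u square_eq_mult by (simp_all add: w_def)
  have wc: "w \<otimes> c \<otimes> inv w = c [^] (4::nat)" using uuc[of 2] by (simp add: w_def)
  have wZ: "w \<notin> Z" using Zconj[OF w(1)] wc cinj[of 4 1] c(1) by auto
  obtain z0 where z0: "z0 \<in> Z" "H.ord z0 = 600" using ex cZ by auto
  have z0c: "z0 \<in> carrier H" using z0 by (simp add: Z_def)
  have Zpow: "\<exists>n::nat. x = z0 [^] n" if x: "x \<in> Z" for x
  proof -
    have "generate H {z0} \<subseteq> Z" using H.generate_subgroup_incl[of "{z0}" Z] z0 Z by simp
    moreover have "card (generate H {z0}) = 600" using H.generate_pow_card[OF z0c] z0(2) by simp
    moreover have "finite Z" using finH by (simp add: Z_def)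
    ultimately have "generate H {z0} = Z" using card_seteq[of Z "generate H {z0}"] cZ by simp
    then show ?thesis using x H.generate_pow_on_finite_carrier[OF finH z0c] by auto
  qed
  \<comment> \<open>Since 600 = 8 * 75, \<open>z\<close> generates the 2-part of the cyclic group
    \<open>Z\<close>.\<close>
  define z where "z = z0 [^] (75::nat)"
  have z: "z \<in> carrier H" "H.ord z = 8" using z0c z0(2) H.ord_pow[OF z0c, of 75] by (simp_all add: z_def)
  have zZ: "z [^] (n::nat) \<in> Z" for n
  proof -
    have "z0 [^] m \<in> Z" for m :: nat
      by (induction m) (use z0(1) Z in \<open>auto simp: subgroup.m_closed subgroup.one_closed\<close>)
    then show ?thesis using z0c by (simp add: z_def H.nat_pow_pow)
  qed
  have pow8: "\<exists>n::nat. x = z [^] n" if x: "x \<in> Z" "x [^] (8::nat) = \<one>" for x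
  proof -
    obtain n :: nat where n: "x = z0 [^] n" using Zpow x(1) by blast
    then have "600 dvd n * 8" using x(2) H.pow_eq_id[OF z0c, of "n * 8"] z0 z0c by (simp add: H.nat_pow_pow)
    then obtain l where "n * 8 = 600 * l" by (elim dvdE)
    then have "n = 75 * l" by simp
    then show ?thesis using n z0c by (intro exI[of _ l]) (simp add: z_def H.nat_pow_pow)
  qed
  have zpow: "z [^] m = z [^] (m mod 8)" for m :: nat
    using H.pow_mod_exponent[OF z(1)] H.pow_ord_eq_1[OF z(1)] z(2) by metis
  define t where "t = z [^] (4::nat)"
  have t: "t \<in> carrier H" "H.ord t = 2" using z H.ord_pow[OF z(1), of 4] by (simp_all add: t_def)
  have tZ: "t \<in> Z" unfolding t_def by (rule zZ)
  \<comment> \<open>The conjugate of \<open>z\<close> commutes with \<open>c [^] 3\<close>, of which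
    \<open>c\<close> is the square. So it lies in \<open>Z\<close>, and having eighth power one it
    is a power of \<open>z\<close>.\<close>
  obtain k :: nat where k: "u \<otimes> z \<otimes> inv u = z [^] k"
  proof -
    define x where "x = u \<otimes> z \<otimes> inv u"
    have xc: "x \<in> carrier H" using u z by (simp add: x_def)
    have "z \<otimes> c = c \<otimes> z" using zZ[of 1] z by (simp add: Z_def)
    then have "x \<otimes> c [^] (3::nat) = c [^] (3::nat) \<otimes> x"
      using H.conj_hom[OF u z(1) c(1)] H.conj_hom[OF u c(1) z(1)] uc by (simp add: x_def)
    then have "x \<otimes> (c [^] (3::nat)) [^] (2::nat) = (c [^] (3::nat)) [^] (2::nat) \<otimes> x"
      using H.group_commutes_pow[of "c [^] (3::nat)" x 2] xc c(1) by simp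
    moreover have "(c [^] (3::nat)) [^] (2::nat) = c" using cpow[of 6] c(1) by (simp add: H.nat_pow_pow)
    ultimately have "x \<in> Z" using xc by (simp add: Z_def)
    moreover have "x [^] (8::nat) = \<one>"
      using H.conj_pow[OF u z(1), of 8] H.pow_ord_eq_1[OF z(1)] z(2) u by (simp add: x_def)
    ultimately show ?thesis using pow8 that unfolding x_def by blast
  qed
  have "odd k"
  proof
    assume "even k"
    then have "8 dvd k * 4" by presburger
    then have "(z [^] k) [^] (4::nat) = \<one>" using H.pow_eq_id[OF z(1), of "k * 4"] z by (simp add: H.nat_pow_pow)
    then have "H.ord (u \<otimes> z \<otimes> inv u) dvd 4" using H.pow_eq_id[of "z [^] k" 4] k z by simp
    then show False using H.ord_conj[OF u z(1)] z(2) by simp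
  qed
  then have "k mod 4 = 1 \<or> k mod 4 = 3" by presburger
  then show False
  proof
    \<comment> \<open>Here \<open>u\<close> fixes \<open>i\<close>, the square of \<open>z\<close>.
      So \<open>c [^] 3\<close> and \<open>c [^] 4\<close> are conjugates of \<open>c\<close> by
      \<open>u\<close> and by \<open>w\<close>, both commuting with \<open>i\<close>, and would have
      to be equal.\<close>
    assume k1: "k mod 4 = 1"
    define i where "i = z [^] (2::nat)"
    have i: "i \<in> carrier H" "H.ord i = 4" using z H.ord_pow[OF z(1), of 2] by (simp_all add: i_def)
    have iZ: "i \<otimes> c = c \<otimes> i" using zZ[of 2] by (simp add: i_def Z_def)
    have "2 * k mod 8 = 2" using k1 by presburger
    then have "u \<otimes> i \<otimes> inv u = i"
      using H.conj_pow[OF u z(1), of 2] k z(1) zpow[of "k * 2"] by (simp add: i_def H.nat_pow_pow mult.commute)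
    then have iu: "i \<otimes> u = u \<otimes> i" using H.conj_commute_iff[OF u i(1), of i] by simp
    have iw: "i \<otimes> w = w \<otimes> i"
    proof -
      have "i \<otimes> w = (u \<otimes> i) \<otimes> u" unfolding iu[symmetric] w(2) using i u by (simp add: H.m_assoc)
      also have "\<dots> = u \<otimes> (i \<otimes> u)" using i u by (simp add: H.m_assoc)
      also have "\<dots> = u \<otimes> (u \<otimes> i)" by (simp only: iu)
      finally show ?thesis using i u by (simp add: w(2) H.m_assoc)
    qed
    have comm: "c \<otimes> c [^] n = c [^] n \<otimes> c" for n :: nat
      using H.group_commutes_pow[of c c n] c by simp
    have ne: "c \<noteq> c [^] n" if "n < 5" "n \<noteq> 1" for n :: nat
      using cinj[of 1 n] that c(1) by auto
    have "c [^] (3::nat) = c [^] (4::nat)"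
      by (rule order5_conjugates_eq[OF V4 p7 c i iZ u iu w(1) iw uc[symmetric] wc[symmetric] comm _ comm]) (rule ne; simp)+
    then show False using cinj[of 3 4] by simp
  next
    \<comment> \<open>Here \<open>w\<close> commutes with \<open>z\<close>, as the square of
      \<open>k\<close> is 1 modulo 8. The fourth power of \<open>u\<close> is some
      \<open>z [^] n\<close> fixed by \<open>u\<close>; since \<open>k - 1\<close> is twice an odd
      number, 4 divides \<open>n\<close>, and therefore \<open>w \<otimes> w\<close> has square
      one.\<close>
    assume k3: "k mod 4 = 3"
    have wz: "w \<otimes> z \<otimes> inv w = z"
    proof -
      have "k mod 8 = 3 \<or> k mod 8 = 7" using k3 by presburger
      then have "(k mod 8) ^ 2 mod 8 = 1" by auto
      then have "k ^ 2 mod 8 = 1" by (simp add: power_mod)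
      then show ?thesis using H.conj_power_iterate[OF u z(1) k, of 2] zpow[of "k ^ 2"] z(1) by (simp add: w_def)
    qed
    have u4: "u [^] (4::nat) = w \<otimes> w"
      using u H.nat_pow_mult[OF u, of 2 2] by (simp add: w_def)
    have "u [^] (4::nat) \<in> Z" using Zconj[of "u [^] (4::nat)"] uuc[of 4] u c(1) by simp
    moreover have "(u [^] (4::nat)) [^] (8::nat) = \<one>"
      using H.pow_order_eq_1[OF h(1)] oH h(1) by (simp add: u_def H.nat_pow_pow)
    ultimately obtain n :: nat where n: "u [^] (4::nat) = z [^] n" using pow8 by blast
    have "u \<otimes> u [^] (4::nat) = u [^] (4::nat) \<otimes> u" using H.group_commutes_pow[of u u 4] u by simp
    then have "u \<otimes> z [^] n \<otimes> inv u = z [^] n"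
      using H.conj_commute_iff[OF u, of "z [^] n" "z [^] n"] z(1) n by simp
    then have "z [^] (k * n) = z [^] n"
      using H.conj_pow[OF u z(1), of n] k z(1) by (simp add: H.nat_pow_pow)
    then have "z [^] int (k * n) = z [^] int n" unfolding int_pow_int .
    then have "int 8 dvd int n - int (k * n)" using H.int_pow_eq[OF z(1)] z(2) by metis
    moreover obtain q where "k = 4 * q + 3" using k3 by (metis mult_div_mod_eq)
    then have "int n - int (k * n) = - (2 * (int n * (2 * int q + 1)))" by (simp add: algebra_simps)
    ultimately have "2 * 4 dvd 2 * (int n * (2 * int q + 1))" by simp
    then have "4 dvd int n * (2 * int q + 1)" by (simp only: dvd_times_left_cancel_iff)
    moreover have "coprime (4::int) (2 * int q + 1)"
    proof -
      have "coprime (2 ^ 2) (2 * int q + 1)" by (simp only: coprime_power_left_iff) simp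
      then show ?thesis by simp
    qed
    ultimately have "4 dvd int n" by (simp add: coprime_dvd_mult_left_iff)
    then have "4 dvd n" by presburger
    then have "8 dvd n * 2" by presburger
    then have "(w \<otimes> w) \<otimes> (w \<otimes> w) = \<one>"
      using H.pow_eq_id[OF z(1), of "n * 2"] z square_eq_mult[of "z [^] n"] n u4 by (simp add: H.nat_pow_pow)
    then have "w \<otimes> w = \<one> \<or> w \<otimes> w = t" using square_eq_one[OF t] w(1) by simp
    then show False
    proof
      assume "w \<otimes> w = \<one>"
      then have "w = \<one> \<or> w = t" using square_eq_one[OF t w(1)] by blast
      then show False using wZ tZ subgroup.one_closed[OF Z] by auto
    next
      assume wt: "w \<otimes> w = t"
      \<comment> \<open>\<open>w\<close> and \<open>i\<close> commute and both have square
        \<open>t\<close>, so their product has square one and is \<open>\<one>\<close> or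
        \<open>t\<close>. That puts \<open>w\<close> into \<open>Z\<close>, although it inverts
        \<open>c\<close>.\<close>
      define i where "i = z [^] (2::nat)"
      have i: "i \<in> carrier H" "i \<otimes> i = t" "i \<in> Z"
        using z H.nat_pow_mult[OF z(1), of 2 2] zZ by (simp_all add: i_def t_def)
      have "w \<otimes> i \<otimes> inv w = i" using H.conj_pow[OF w(1) z(1), of 2] wz by (simp add: i_def)
      then have wi: "w \<otimes> i = i \<otimes> w" using H.conj_commute_iff[OF w(1) i(1), of i] by simp
      have "(w \<otimes> i) \<otimes> (w \<otimes> i) = w \<otimes> (i \<otimes> w) \<otimes> i" using w(1) i(1) by (simp add: H.m_assoc)
      also have "\<dots> = (w \<otimes> w) \<otimes> (i \<otimes> i)" unfolding wi[symmetric] using w(1) i(1) by (simp add: H.m_assoc)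
      also have "\<dots> = \<one>" using wt i(2) H.pow_ord_eq_1[OF t(1)] t square_eq_mult[OF t(1)] by simp
      finally have "w \<otimes> i = \<one> \<or> w \<otimes> i = t" using square_eq_one[OF t] w(1) i(1) by simp
      then have "w \<otimes> i \<in> Z" using tZ subgroup.one_closed[OF Z] by auto
      then have "(w \<otimes> i) \<otimes> inv i \<in> Z" using i(3) Z by (simp add: subgroup.m_closed subgroup.m_inv_closed)
      then show False using wZ w(1) i(1) by (simp add: H.m_assoc)
    qed
  qed
qed

theorem no_solvable_poc_action: "solvable H \<Longrightarrow> False"
proof -
  assume solv: "solvable H"
  obtain m where m: "order V = p ^ m" using order_V by blast
  have "m \<noteq> 0" using m order_H order_H_pos by (intro notI) simp
  moreover have "order H = p ^ m - 1" using m order_H by simp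
  ultimately have "m = 1 \<or> m = 2 \<or> m = 4 \<and> p = 7"
    using prime_power_minus_one_smooth[OF prime_p, of m] smooth dvd30 by auto
  then show False
    using m not_line plane_impossible[OF _ solv] dimension_four_impossible[OF _ _ solv] by auto
qed

end

section \<open>Frobenius groups with complement of even order\<close>

text \<open>\<open>conj_mem\<close> is the Frobenius condition in elementwise form. The involution
  \<open>t\<close> is what makes the kernel accessible by counting.\<close>

locale even_frobenius = group G for G (structure) +
  fixes H t
  assumes finG: "finite (carrier G)" and H: "subgroup H G"
    and conj_mem: "g \<in> carrier G \<Longrightarrow> h \<in> H \<Longrightarrow> h \<noteq> \<one> \<Longrightarrow> g \<otimes> h \<otimes> inv g \<in> H \<Longrightarrow> g \<in> H"
    and t: "t \<in> H" "ord t = 2"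
begin

lemma H_sub: "H \<subseteq> carrier G" using H subgroup.subset by blast

lemma H_closed [simp]: "x \<in> H \<Longrightarrow> x \<in> carrier G" using H_sub by blast

definition Y where "Y = {g \<otimes> h \<otimes> inv g | g h. g \<in> carrier G \<and> h \<in> H \<and> h \<noteq> \<one>}"

text \<open>The Frobenius kernel as a mere set: the identity and the elements in no conjugate of
  \<open>H\<close>.\<close>

definition K where "K = carrier G - Y"

text \<open>The fibre of \<open>(g, h) \<mapsto> g h g\<^sup>-\<^sup>1\<close> through \<open>(g, h)\<close> consists of the \<open>(g k, k\<^sup>-\<^sup>1 h k)\<close> with \<open>k \<in> H\<close>.\<close>

lemma card_conjugates_of_subset:
  assumes A: "A \<subseteq> H - {\<one>}" and inv_A: "\<And>h a. h \<in> H \<Longrightarrow> a \<in> A \<Longrightarrow> h \<otimes> a \<otimes> inv h \<in> A"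
  shows "card {g \<otimes> a \<otimes> inv g | g a. g \<in> carrier G \<and> a \<in> A} * card H = order G * card A"
proof -
  define f where "f = (\<lambda>(g, a). g \<otimes> a \<otimes> inv g)"
  have AH: "A \<subseteq> H" "\<one> \<notin> A" using A by auto
  have finA: "finite A" using AH H_sub finG finite_subset by metis
  have "card (carrier G \<times> A) = card (f ` (carrier G \<times> A)) * card H"
  proof (rule card_fibres)
    show "finite (carrier G \<times> A)" using finG finA by simp
    fix x assume "x \<in> carrier G \<times> A"
    then obtain g a where x: "x = (g, a)" and g: "g \<in> carrier G" and a: "a \<in> A" by auto
    have aH: "a \<in> H" "a \<noteq> \<one>" "a \<in> carrier G" using a AH by auto
    have "bij_betw (\<lambda>k. (g \<otimes> k, inv k \<otimes> a \<otimes> k)) H {y \<in> carrier G \<times> A. f y = f x}"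
      unfolding bij_betw_def
    proof
      show "inj_on (\<lambda>k. (g \<otimes> k, inv k \<otimes> a \<otimes> k)) H"
      proof (rule inj_onI)
        fix k l assume kl: "k \<in> H" "l \<in> H" "(g \<otimes> k, inv k \<otimes> a \<otimes> k) = (g \<otimes> l, inv l \<otimes> a \<otimes> l)"
        then have "inv g \<otimes> (g \<otimes> k) = inv g \<otimes> (g \<otimes> l)" by simp
        then show "k = l" using kl g by (simp add: m_assoc[symmetric])
      qed
      show "(\<lambda>k. (g \<otimes> k, inv k \<otimes> a \<otimes> k)) ` H = {y \<in> carrier G \<times> A. f y = f x}" (is "?L = ?R")
      proof
        show "?L \<subseteq> ?R"
        proof
          fix y assume "y \<in> ?L"
          then obtain k where k: "k \<in> H" "y = (g \<otimes> k, inv k \<otimes> a \<otimes> k)" by blast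
          have "inv k \<otimes> a \<otimes> k \<in> A" using inv_A[of "inv k" a] k(1) a H by (simp add: subgroup.m_inv_closed)
          moreover have "f y = f x"
            using conj_conj[of "g \<otimes> k" "inv k" a] k g aH by (simp add: f_def x m_assoc)
          ultimately show "y \<in> ?R" using k g by simp
        qed
        show "?R \<subseteq> ?L"
        proof
          fix y assume "y \<in> ?R"
          then obtain g' a' where y: "y = (g', a')" "g' \<in> carrier G" "a' \<in> A" "g' \<otimes> a' \<otimes> inv g' = g \<otimes> a \<otimes> inv g"
            by (auto simp: f_def x)
          have a'H: "a' \<in> H" "a' \<noteq> \<one>" "a' \<in> carrier G" using y AH by auto
          define k where "k = inv g \<otimes> g'"
          have kc: "k \<in> carrier G" using g y by (simp add: k_def)
          have "k \<otimes> a' \<otimes> inv k = inv g \<otimes> (g' \<otimes> a' \<otimes> inv g') \<otimes> inv (inv g)"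
            using conj_conj[of "inv g" g' a'] g y(2) a'H by (simp add: k_def)
          also have "\<dots> = a" unfolding y(4) using conj_conj[of "inv g" g a] g aH by simp
          finally have ka: "k \<otimes> a' \<otimes> inv k = a" .
          then have kH: "k \<in> H" using conj_mem[OF kc a'H(1,2)] aH by simp
          have "a' = inv k \<otimes> a \<otimes> k" using conj_conj[of "inv k" k a'] kc a'H ka by simp
          moreover have "g' = g \<otimes> k" using g y(2) by (simp add: k_def m_assoc[symmetric])
          ultimately show "y \<in> ?L" using kH y(1) by blast
        qed
      qed
    qed
    then show "card {y \<in> carrier G \<times> A. f y = f x} = card H" by (rule bij_betw_same_card[symmetric])
  qed
  moreover have "f ` (carrier G \<times> A) = {g \<otimes> a \<otimes> inv g | g a. g \<in> carrier G \<and> a \<in> A}"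
    by (auto simp: f_def image_iff)
  ultimately show ?thesis by (simp add: card_cartesian_product order_def)
qed

lemma card_H_pos: "card H > 0"
  using H H_sub finG finite_subset subgroup.one_closed card_gt_0_iff by (metis empty_iff)

lemma Y_sub: "Y \<subseteq> carrier G" by (auto simp: Y_def)

text \<open>The conjugates of \<open>H\<close> have |G|(|H| - 1)/|H| nonidentity elements in all,
  leaving |G|/|H| others.\<close>

lemma card_K: "card K * card H = order G"
proof -
  have "Y = {g \<otimes> a \<otimes> inv g | g a. g \<in> carrier G \<and> a \<in> H - {\<one>}}" by (auto simp: Y_def)
  moreover have "h \<otimes> a \<otimes> inv h \<in> H - {\<one>}" if "h \<in> H" "a \<in> H - {\<one>}" for h a
    using that H conj_inj[of h a \<one>] by (auto simp: subgroup.m_closed subgroup.m_inv_closed)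
  ultimately have "card Y * card H = order G * card (H - {\<one>})"
    using card_conjugates_of_subset[of "H - {\<one>}"] by simp
  moreover have "card (H - {\<one>}) = card H - 1" using subgroup.one_closed[OF H] by simp
  ultimately have Y: "card Y * card H = order G * (card H - 1)" by simp
  have "card K = order G - card Y"
    unfolding K_def order_def using Y_sub finG finite_subset by (intro card_Diff_subset) blast+
  then have "card K * card H = order G * card H - order G * (card H - 1)"
    by (simp add: diff_mult_distrib Y)
  also have "\<dots> = order G" using card_H_pos by (cases "card H") auto
  finally show ?thesis .
qed

lemma conj_Y:
  assumes "x \<in> Y" "g \<in> carrier G"
  shows "g \<otimes> x \<otimes> inv g \<in> Y"
proof -
  obtain a h where "x = a \<otimes> h \<otimes> inv a" "a \<in> carrier G" "h \<in> H" "h \<noteq> \<one>" using assms(1) by (auto simp: Y_def)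
  then have "g \<otimes> x \<otimes> inv g = (g \<otimes> a) \<otimes> h \<otimes> inv (g \<otimes> a)" "g \<otimes> a \<in> carrier G"
    using assms(2) conj_conj[of g a h] by auto
  then show ?thesis using \<open>h \<in> H\<close> \<open>h \<noteq> \<one>\<close> unfolding Y_def by blast
qed

lemma conj_K:
  assumes "x \<in> K" "g \<in> carrier G"
  shows "g \<otimes> x \<otimes> inv g \<in> K"
proof -
  have x: "x \<in> carrier G" "x \<notin> Y" using assms by (auto simp: K_def)
  have "g \<otimes> x \<otimes> inv g \<notin> Y"
  proof
    assume "g \<otimes> x \<otimes> inv g \<in> Y"
    then have "inv g \<otimes> (g \<otimes> x \<otimes> inv g) \<otimes> inv (inv g) \<in> Y" using assms(2) by (rule conj_Y[OF _ inv_closed])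
    then show False using x assms(2) conj_conj[of "inv g" g x] by simp
  qed
  then show ?thesis using x assms(2) by (simp add: K_def)
qed

lemma t_inv: "inv t = t" "t \<noteq> \<one>" "t \<in> carrier G"
proof -
  show tc: "t \<in> carrier G" using t by simp
  have "t \<otimes> t = \<one>" using pow_ord_eq_1[OF tc] t(2) tc by (simp add: numeral_2_eq_2)
  then show "inv t = t" using tc inv_equality by blast
  show "t \<noteq> \<one>" using t(2) by auto
qed

text \<open>Both factors invert the product, so they normalize the conjugate of \<open>H\<close> containing it.\<close>

lemma involution_product_mem_K:
  assumes g: "g \<in> carrier G" and g': "g' \<in> carrier G" and ne: "inv g \<otimes> g' \<notin> H"
  shows "(g \<otimes> t \<otimes> inv g) \<otimes> (g' \<otimes> t \<otimes> inv g') \<in> K"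
proof (rule ccontr)
  define s where "s = g \<otimes> t \<otimes> inv g"
  define s' where "s' = g' \<otimes> t \<otimes> inv g'"
  have sc: "s \<in> carrier G" "s' \<in> carrier G" using g g' t_inv by (simp_all add: s_def s'_def)
  have sinv: "inv s = s" "inv s' = s'"
    using g g' t_inv by (simp_all add: s_def s'_def inv_mult_group m_assoc)
  assume "\<not> ?thesis"
  then have "s \<otimes> s' \<in> Y" using sc by (simp add: K_def s_def s'_def)
  then obtain x h where x: "s \<otimes> s' = x \<otimes> h \<otimes> inv x" "x \<in> carrier G" "h \<in> H" "h \<noteq> \<one>" by (auto simp: Y_def)
  have hc: "h \<in> carrier G" using x by simp
  have inv_prod: "inv (s \<otimes> s') = s' \<otimes> s" using sc sinv by (simp add: inv_mult_group)
  \<comment> \<open>Conjugated by \<open>inv x\<close>, the involution \<open>u\<close> inverts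
    \<open>h\<close> and so lies in \<open>H\<close>. It is also the conjugate of \<open>t\<close>
    by \<open>inv x \<otimes> a\<close>, which puts this element into \<open>H\<close>. Applied to
    \<open>g\<close> and \<open>g'\<close>, this contradicts \<open>ne\<close>.\<close>
  have key: "inv x \<otimes> a \<in> H" if a: "a \<in> carrier G" and u: "u = a \<otimes> t \<otimes> inv a" and conj: "u \<otimes> (s \<otimes> s') \<otimes> inv u = s' \<otimes> s" for a u
  proof -
    have uc: "u \<in> carrier G" using a t_inv by (simp add: u)
    define y where "y = inv x \<otimes> u \<otimes> x"
    have yc: "y \<in> carrier G" using x uc by (simp add: y_def)
    have "y \<otimes> h \<otimes> inv y = (inv x \<otimes> u) \<otimes> (x \<otimes> h \<otimes> inv x) \<otimes> inv (inv x \<otimes> u)"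
      using conj_conj[of "inv x \<otimes> u" x h] x(2) uc hc by (simp add: y_def)
    also have "\<dots> = inv x \<otimes> (u \<otimes> (s \<otimes> s') \<otimes> inv u) \<otimes> inv (inv x)"
      unfolding x(1)[symmetric] using conj_conj[of "inv x" u "s \<otimes> s'"] x(2) uc sc by simp
    also have "\<dots> = inv x \<otimes> inv (x \<otimes> h \<otimes> inv x) \<otimes> inv (inv x)"
    proof -
      have "u \<otimes> (s \<otimes> s') \<otimes> inv u = inv (s \<otimes> s')" using conj inv_prod by simp
      then show ?thesis by (simp only: x(1))
    qed
    also have "\<dots> = inv x \<otimes> (x \<otimes> inv h \<otimes> inv x) \<otimes> inv (inv x)"
      using x(2) hc by (simp add: inv_mult_group m_assoc)
    also have "\<dots> = inv h" using conj_conj[of "inv x" x "inv h"] x(2) hc by simp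
    finally have "y \<otimes> h \<otimes> inv y \<in> H" using x(3) H by (simp add: subgroup.m_inv_closed)
    then have "y \<in> H" using conj_mem[OF yc x(3,4)] by blast
    moreover have "y = (inv x \<otimes> a) \<otimes> t \<otimes> inv (inv x \<otimes> a)"
      using conj_conj[of "inv x" a t] x(2) a t_inv by (simp add: y_def u)
    ultimately show ?thesis using conj_mem[of "inv x \<otimes> a" t] t(1) t_inv(2) x(2) a by simp
  qed
  have "s \<otimes> s = \<one>" "s' \<otimes> s' = \<one>" using sinv sc r_inv by metis+
  have "inv x \<otimes> g \<in> H"
  proof (rule key[OF g s_def])
    have "s \<otimes> (s \<otimes> s') \<otimes> inv s = (s \<otimes> s) \<otimes> s' \<otimes> s" unfolding sinv using sc by (simp add: m_assoc)
    then show "s \<otimes> (s \<otimes> s') \<otimes> inv s = s' \<otimes> s" using \<open>s \<otimes> s = \<one>\<close> sc by simp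
  qed
  moreover have "inv x \<otimes> g' \<in> H"
  proof (rule key[OF g' s'_def])
    have "s' \<otimes> (s \<otimes> s') \<otimes> inv s' = s' \<otimes> s \<otimes> (s' \<otimes> s')" unfolding sinv using sc by (simp add: m_assoc)
    then show "s' \<otimes> (s \<otimes> s') \<otimes> inv s' = s' \<otimes> s" using \<open>s' \<otimes> s' = \<one>\<close> sc by simp
  qed
  ultimately have "inv (inv x \<otimes> g) \<otimes> (inv x \<otimes> g') \<in> H" using H by (simp add: subgroup.m_closed subgroup.m_inv_closed)
  moreover have "inv (inv x \<otimes> g) \<otimes> (inv x \<otimes> g') = inv g \<otimes> g'"
  proof -
    have "inv g \<otimes> (x \<otimes> (inv x \<otimes> g')) = inv g \<otimes> g'" using x(2) g g' by (simp add: m_assoc[symmetric])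
    then show ?thesis using x(2) g g' by (simp add: inv_mult_group m_assoc)
  qed
  ultimately show False using ne by simp
qed

text \<open>With one involution chosen in each conjugate of \<open>H\<close>, the products of a fixed one of them with all
  of them exhaust \<open>K\<close>, by counting.\<close>

lemma K_products:
  obtains I where "I \<noteq> {}" "\<And>s. s \<in> I \<Longrightarrow> s \<in> carrier G \<and> inv s = s" "\<And>s. s \<in> I \<Longrightarrow> K = (\<lambda>s'. s \<otimes> s') ` I"
proof -
  \<comment> \<open>\<open>r\<close> chooses a representative of the left coset of \<open>g\<close>;
    elements of one coset give the same predicate and hence the same choice.\<close>
  define r where "r g = (SOME x. x \<in> carrier G \<and> inv g \<otimes> x \<in> H)" for g
  have r: "r g \<in> carrier G" "inv g \<otimes> r g \<in> H" if g: "g \<in> carrier G" for g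
  proof -
    have "g \<in> carrier G \<and> inv g \<otimes> g \<in> H" using g subgroup.one_closed[OF H] by simp
    then have "r g \<in> carrier G \<and> inv g \<otimes> r g \<in> H" unfolding r_def by (rule someI)
    then show "r g \<in> carrier G" "inv g \<otimes> r g \<in> H" by auto
  qed
  have rel: "inv g \<otimes> x \<in> H \<longleftrightarrow> inv g' \<otimes> x \<in> H"
    if "inv g \<otimes> g' \<in> H" "g \<in> carrier G" "g' \<in> carrier G" "x \<in> carrier G" for g g' x
  proof -
    have "inv g \<otimes> x = (inv g \<otimes> g') \<otimes> (inv g' \<otimes> x)"
      using that by (simp add: m_assoc) (simp add: m_assoc[symmetric])
    moreover have "inv g' \<otimes> x = inv (inv g \<otimes> g') \<otimes> (inv g \<otimes> x)"
    proof -
      have "g \<otimes> (inv g \<otimes> x) = x" using that by (simp add: m_assoc[symmetric])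
      then show ?thesis using that by (simp add: inv_mult_group m_assoc)
    qed
    ultimately show ?thesis using that(1) H by (metis subgroup.m_closed subgroup.m_inv_closed)
  qed
  have rr: "r g = r g'" if "inv g \<otimes> g' \<in> H" "g \<in> carrier G" "g' \<in> carrier G" for g g'
  proof -
    have "(\<lambda>x. x \<in> carrier G \<and> inv g \<otimes> x \<in> H) = (\<lambda>x. x \<in> carrier G \<and> inv g' \<otimes> x \<in> H)"
      using rel[OF that] by blast
    then show ?thesis by (simp add: r_def)
  qed
  define R where "R = r ` carrier G"
  have RG: "R \<subseteq> carrier G" using r by (auto simp: R_def)
  have Req: "x = y" if xy: "x \<in> R" "y \<in> R" "inv x \<otimes> y \<in> H" for x y
  proof -
    obtain g g' where g: "g \<in> carrier G" "x = r g" and g': "g' \<in> carrier G" "y = r g'"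
      using xy(1,2) by (auto simp: R_def)
    have "x = r x" using rr[OF r(2)[OF g(1)] g(1) r(1)[OF g(1)]] g(2) by simp
    also have "\<dots> = r y" by (rule rr[OF xy(3)]) (use xy RG in auto)
    also have "\<dots> = y" using rr[OF r(2)[OF g'(1)] g'(1) r(1)[OF g'(1)]] g'(2) by simp
    finally show ?thesis .
  qed
  have cR: "order G = card R * card H"
    unfolding R_def order_def
  proof (rule card_fibres[OF finG])
    fix g assume g: "g \<in> carrier G"
    have "bij_betw (\<lambda>h. g \<otimes> h) H {x \<in> carrier G. r x = r g}"
    proof (rule bij_betwI[where g = "\<lambda>x. inv g \<otimes> x"])
      show "(\<otimes>) g \<in> H \<rightarrow> {x \<in> carrier G. r x = r g}"
        using rr[of g] g by (auto simp: m_assoc[symmetric] intro!: sym[OF rr])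
      show "(\<otimes>) (inv g) \<in> {x \<in> carrier G. r x = r g} \<rightarrow> H"
      proof
        fix x assume "x \<in> {x \<in> carrier G. r x = r g}"
        then have x: "x \<in> carrier G" "r x = r g" by auto
        have "inv x \<otimes> r g \<in> H" using r(2)[OF x(1)] x(2) by simp
        then have "inv (r g) \<otimes> x \<in> H"
          using subgroup.m_inv_closed[OF H, of "inv x \<otimes> r g"] x(1) r(1)[OF g] by (simp add: inv_mult_group)
        then show "inv g \<otimes> x \<in> H" using rel[OF r(2)[OF g] g r(1)[OF g] x(1)] by simp
      qed
    qed (use g in \<open>auto simp: m_assoc[symmetric]\<close>)
    then show "card {x \<in> carrier G. r x = r g} = card H" by (rule bij_betw_same_card[symmetric])
  qed
  define I where "I = (\<lambda>g. g \<otimes> t \<otimes> inv g) ` R"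
  have inj: "inj_on (\<lambda>g. g \<otimes> t \<otimes> inv g) R"
  proof (rule inj_onI)
    fix x y assume x: "x \<in> R" and y: "y \<in> R" and eq: "x \<otimes> t \<otimes> inv x = y \<otimes> t \<otimes> inv y"
    have xc: "x \<in> carrier G" "y \<in> carrier G" using x y RG by auto
    have "(inv x \<otimes> y) \<otimes> t \<otimes> inv (inv x \<otimes> y) = inv x \<otimes> (x \<otimes> t \<otimes> inv x) \<otimes> inv (inv x)"
      using conj_conj[of "inv x" y t] xc t_inv eq by simp
    also have "\<dots> = t" using conj_conj[of "inv x" x t] xc t_inv by simp
    finally have "inv x \<otimes> y \<in> H" using conj_mem[of "inv x \<otimes> y" t] t t_inv xc by simp
    then show "x = y" using Req x y by blast
  qed
  have KI: "K = (\<lambda>s'. s \<otimes> s') ` I" if s: "s \<in> I" for s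
  proof -
    obtain g where g: "g \<in> R" "s = g \<otimes> t \<otimes> inv g" using s by (auto simp: I_def)
    have gc: "g \<in> carrier G" using g RG by auto
    have sc: "s \<in> carrier G" "inv s = s" using gc t_inv by (simp_all add: g(2) inv_mult_group m_assoc)
    have sub: "(\<lambda>s'. s \<otimes> s') ` I \<subseteq> K"
    proof
      fix x assume "x \<in> (\<lambda>s'. s \<otimes> s') ` I"
      then obtain g' where g': "g' \<in> R" "x = s \<otimes> (g' \<otimes> t \<otimes> inv g')" by (auto simp: I_def)
      show "x \<in> K"
      proof (cases "g = g'")
        case True
        then have "x = \<one>" using g' g sc r_inv[OF sc(1)] by simp
        moreover have "\<one> \<notin> Y"
        proof
          assume "\<one> \<in> Y"
          then obtain a h where ah: "\<one> = a \<otimes> h \<otimes> inv a" "a \<in> carrier G" "h \<in> H" "h \<noteq> \<one>"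
            by (auto simp: Y_def)
          have "a \<otimes> \<one> \<otimes> inv a = \<one>" using ah(2) by simp
          then have "a \<otimes> h \<otimes> inv a = a \<otimes> \<one> \<otimes> inv a" using ah(1) by (rule trans[OF sym sym, rotated])
          then show False using conj_inj[OF ah(2) _ one_closed, of h] ah(3,4) by simp
        qed
        ultimately show ?thesis by (simp add: K_def)
      next
        case False
        then show ?thesis using involution_product_mem_K[of g g'] Req[of g g'] g g' RG by blast
      qed
    qed
    have IG: "I \<subseteq> carrier G" using RG t_inv by (auto simp: I_def)
    have "inj_on (\<lambda>s'. s \<otimes> s') I"
    proof (rule inj_onI)
      fix a b assume ab: "a \<in> I" "b \<in> I" "s \<otimes> a = s \<otimes> b"
      have canc: "inv s \<otimes> (s \<otimes> x) = x" if "x \<in> I" for x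
        using that IG sc(1) by (auto simp: m_assoc[symmetric])
      show "a = b" using canc[OF ab(1)] unfolding ab(3) canc[OF ab(2)] by (rule sym)
    qed
    then have "card ((\<lambda>s'. s \<otimes> s') ` I) = card I" by (rule card_image)
    also have "\<dots> = card R" unfolding I_def by (rule card_image[OF inj])
    finally have "card ((\<lambda>s'. s \<otimes> s') ` I) = card R" .
    \<comment> \<open>Both numbers are the index of \<open>H\<close>, so the inclusion of the
      products in \<open>K\<close> is an equality.\<close>
    moreover have "card K = card R" using card_K cR card_H_pos by simp
    moreover have "finite K" using finG by (simp add: K_def)
    ultimately show ?thesis using card_seteq[OF _ sub] by simp
  qed
  have "I \<noteq> {}" by (auto simp: I_def R_def)
  moreover have "s \<in> carrier G \<and> inv s = s" if "s \<in> I" for s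
    using that RG t_inv by (auto simp: I_def inv_mult_group m_assoc)
  ultimately show ?thesis using that KI by blast
qed

text \<open>Every member of \<open>I\<close> may serve as left factor, so two elements of
  \<open>K\<close> can be written as \<open>s0 \<otimes> s1\<close> and
  \<open>s1 \<otimes> s2\<close>, and their product telescopes. Conjugation by \<open>s0\<close>
  inverts \<open>K\<close>; inversion is then a homomorphism on \<open>K\<close>, which makes
  \<open>K\<close> commutative.\<close>

lemma kernel: "subgroup K G" and kernel_comm: "a \<in> K \<Longrightarrow> b \<in> K \<Longrightarrow> a \<otimes> b = b \<otimes> a"
proof -
  obtain I where I: "I \<noteq> {}" "\<And>s. s \<in> I \<Longrightarrow> s \<in> carrier G \<and> inv s = s" "\<And>s. s \<in> I \<Longrightarrow> K = (\<lambda>s'. s \<otimes> s') ` I"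
    using K_products by blast
  obtain s0 where s0: "s0 \<in> I" using I(1) by blast
  have prod: "s \<otimes> s' \<in> K" if "s \<in> I" "s' \<in> I" for s s' using I(3)[OF that(1)] that(2) by blast
  have KG: "K \<subseteq> carrier G" by (auto simp: K_def)
  show sub: "subgroup K G"
  proof (rule subgroupI[OF KG])
    show "K \<noteq> {}" using prod s0 by blast
    fix a assume "a \<in> K"
    then obtain s1 where s1: "s1 \<in> I" "a = s0 \<otimes> s1" using I(3)[OF s0] by blast
    have "inv a = s1 \<otimes> s0" using s1 s0 I(2) by (simp add: inv_mult_group)
    then show "inv a \<in> K" using prod s1 s0 by simp
    fix b assume "b \<in> K"
    then obtain s2 where s2: "s2 \<in> I" "b = s1 \<otimes> s2" using I(3)[OF s1(1)] by blast
    have "s1 \<otimes> (s1 \<otimes> s2) = s2" using I(2)[OF s1(1)] I(2)[OF s2(1)] r_inv[of s1] by (simp add: m_assoc[symmetric])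
    then have "a \<otimes> b = s0 \<otimes> s2" using s1 s2 I(2) s0 by (simp add: m_assoc)
    then show "a \<otimes> b \<in> K" using prod s0 s2 by simp
  qed
  have sc: "s0 \<in> carrier G" "inv s0 = s0" using I(2) s0 by auto
  have inverts: "s0 \<otimes> a \<otimes> inv s0 = inv a" if a: "a \<in> K" for a
  proof -
    obtain s1 where s1: "s1 \<in> I" "a = s0 \<otimes> s1" using I(3)[OF s0] a by blast
    have s1c: "s1 \<in> carrier G" "inv s1 = s1" using I(2) s1 by auto
    have "s0 \<otimes> s0 = \<one>" using r_inv[OF sc(1)] sc(2) by simp
    moreover have "s0 \<otimes> (s0 \<otimes> s1) \<otimes> inv s0 = (s0 \<otimes> s0) \<otimes> s1 \<otimes> s0"
      unfolding sc(2) using sc(1) s1c(1) by (simp add: m_assoc)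
    ultimately have "s0 \<otimes> (s0 \<otimes> s1) \<otimes> inv s0 = s1 \<otimes> s0" using s1c(1) by simp
    then show ?thesis using s1(2) sc s1c by (simp add: inv_mult_group)
  qed
  show "a \<otimes> b = b \<otimes> a" if ab: "a \<in> K" "b \<in> K"
  proof -
    have abc: "a \<in> carrier G" "b \<in> carrier G" using ab KG by auto
    have "inv (a \<otimes> b) = inv a \<otimes> inv b"
      using inverts[OF subgroup.m_closed[OF sub ab]] conj_hom[OF sc(1) abc] inverts ab by simp
    then have "inv (inv (a \<otimes> b)) = inv (inv a \<otimes> inv b)" by simp
    then show ?thesis using abc by (simp add: inv_mult_group)
  qed
qed

section \<open>The action of the complement on the kernel\<close>

lemma K_closed [simp]: "k \<in> K \<Longrightarrow> k \<in> carrier G" by (simp add: K_def)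

lemma H_inter_K: "x \<in> H \<Longrightarrow> x \<in> K \<Longrightarrow> x = \<one>"
proof (rule ccontr)
  assume x: "x \<in> H" "x \<in> K" "x \<noteq> \<one>"
  then have "\<one> \<otimes> x \<otimes> inv \<one> \<in> Y" unfolding Y_def by blast
  then show False using x by (simp add: K_def)
qed

text \<open>If \<open>h\<close> fixes \<open>k\<close>, then \<open>k\<close> fixes
  \<open>h\<close>, and \<open>conj_mem\<close> puts \<open>k\<close> into \<open>H\<close> unless
  \<open>h\<close> is the identity.\<close>

lemma H_acts_freely:
  assumes "h \<in> H" "k \<in> K" "h \<otimes> k \<otimes> inv h = k"
  shows "h = \<one> \<or> k = \<one>"
proof (rule ccontr)
  assume "\<not> ?thesis"
  then have ne: "h \<noteq> \<one>" "k \<noteq> \<one>" by auto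
  have "h \<otimes> k = k \<otimes> h" using conj_commute_iff[of h k k] assms by simp
  then have "k \<otimes> h \<otimes> inv k = h" using conj_commute_iff[of k h h] assms by simp
  then have "k \<in> H" using conj_mem[of k h] assms ne by simp
  then show False using H_inter_K assms(2) ne by blast
qed

lemma finK: "finite K"
  using finG by (simp add: K_def)

lemma card_H_dvd: "card H dvd card K - 1"
proof -
  have "order (G\<lparr>carrier := H\<rparr>) dvd card (K - {\<one>})"
  proof (rule free_action_order_dvd[where act = "\<lambda>h k. h \<otimes> k \<otimes> inv h"])
    show "group (G\<lparr>carrier := H\<rparr>)" using subgroup_imp_group[OF H] .
    show "finite (K - {\<one>})" using finK by simp
    fix g x assume g: "g \<in> carrier (G\<lparr>carrier := H\<rparr>)" and x: "x \<in> K - {\<one>}"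
    then show "g \<otimes> x \<otimes> inv g \<in> K - {\<one>}" using conj_K conj_inj[of g x \<one>] by auto
    show "g \<otimes> x \<otimes> inv g = x \<Longrightarrow> g = \<one>\<^bsub>G\<lparr>carrier := H\<rparr>\<^esub>" using H_acts_freely g x by auto
    fix h assume h: "h \<in> carrier (G\<lparr>carrier := H\<rparr>)"
    show "g \<otimes>\<^bsub>G\<lparr>carrier := H\<rparr>\<^esub> h \<otimes> x \<otimes> inv (g \<otimes>\<^bsub>G\<lparr>carrier := H\<rparr>\<^esub> h) = g \<otimes> (h \<otimes> x \<otimes> inv h) \<otimes> inv g"
      using conj_conj[of g h x] g h x by simp
  qed auto
  then show ?thesis using subgroup.one_closed[OF kernel] finK by (simp add: order_def)
qed

lemma coprime_H_K: "coprime (card H) (card K)"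
proof (rule coprimeI)
  fix d assume d: "d dvd card H" "d dvd card K"
  then have "d dvd card K - 1" using card_H_dvd dvd_trans by blast
  have "card K > 0" using subgroup.one_closed[OF kernel] finK by (auto simp: card_gt_0_iff)
  then have e: "card K - (card K - 1) = 1" by simp
  have "d dvd card K - (card K - 1)" by (rule dvd_diff_nat[OF d(2) \<open>d dvd card K - 1\<close>])
  then show "is_unit d" by (simp only: e)
qed

section \<open>Order classes of \<open>G\<close> in terms of complement and kernel\<close>

lemma ord_dvd_card:
  assumes "subgroup A G" "x \<in> A"
  shows "ord x dvd card A"
  using group.ord_dvd_group_order[OF subgroup_imp_group[OF assms(1)], of x] assms ord_subgroup[OF assms(1), of x]
  by (simp add: order_def)

lemma ord_cases:
  assumes "x \<in> carrier G"
  shows "x \<in> K \<and> ord x dvd card K \<or> x \<in> Y \<and> ord x dvd card H"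
proof (cases "x \<in> Y")
  case True
  then obtain g h where x: "x = g \<otimes> h \<otimes> inv g" "g \<in> carrier G" "h \<in> H" by (auto simp: Y_def)
  then have "ord x = ord h" using ord_conj by simp
  then show ?thesis using ord_dvd_card[OF H x(3)] True by simp
qed (use assms ord_dvd_card[OF kernel, of x] in \<open>simp add: K_def\<close>)

text \<open>By coprimality no element of order \<open>d\<close> lies in \<open>K\<close>, so all of
  them are conjugates of elements of \<open>H\<close>.\<close>

lemma complement_card_ord:
  assumes "h \<in> H" "ord h = d" "d \<noteq> 1"
  shows "card {x \<in> carrier G. ord x = d} = card K * card {h \<in> H. ord h = d}"
proof -
  let ?A = "{h \<in> H. ord h = d}"
  have dH: "d dvd card H" using ord_dvd_card[OF H assms(1)] assms(2) by simp
  have A: "?A \<subseteq> H - {\<one>}" using assms(3) by auto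
  have "{x \<in> carrier G. ord x = d} = {g \<otimes> a \<otimes> inv g | g a. g \<in> carrier G \<and> a \<in> ?A}" (is "?L = ?R")
  proof
    show "?L \<subseteq> ?R"
    proof
      fix x assume "x \<in> ?L"
      then have x: "x \<in> carrier G" "ord x = d" by auto
      have "x \<in> Y"
      proof (rule ccontr)
        assume "x \<notin> Y"
        then have "d dvd card K" using ord_cases[OF x(1)] x(2) by blast
        then show False using dH coprime_H_K assms(3) by (metis coprime_def nat_dvd_1_iff_1)
      qed
      then obtain g h where g: "x = g \<otimes> h \<otimes> inv g" "g \<in> carrier G" "h \<in> H" by (auto simp: Y_def)
      then have "ord h = d" using ord_conj[of g h] x(2) by simp
      then show "x \<in> ?R" using g by blast
    qed
    show "?R \<subseteq> ?L" using ord_conj by auto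
  qed
  moreover have "h \<otimes> a \<otimes> inv h \<in> ?A" if "h \<in> H" "a \<in> ?A" for h a
    using that H ord_conj by (simp add: subgroup.m_closed subgroup.m_inv_closed)
  ultimately have "card {x \<in> carrier G. ord x = d} * card H = order G * card ?A"
    using card_conjugates_of_subset[OF A] by simp
  then have "card {x \<in> carrier G. ord x = d} * card H = (card K * card ?A) * card H"
    unfolding card_K[symmetric] by (simp only: ac_simps)
  then show ?thesis using card_H_pos by simp
qed

lemma complement_perfect_order_classes:
  assumes "perfect_order_classes G"
  shows "perfect_order_classes (G\<lparr>carrier := H\<rparr>)"
  unfolding perfect_order_classes_def
proof (intro allI impI)
  fix n :: nat assume n: "n > 0"
  have eq: "{x \<in> carrier (G\<lparr>carrier := H\<rparr>). group.ord (G\<lparr>carrier := H\<rparr>) x = n} = {h \<in> H. ord h = n}"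
    using ord_subgroup[OF H] by simp
  have "card {h \<in> H. ord h = n} = 0 \<or> card {h \<in> H. ord h = n} dvd card H"
  proof (cases "{h \<in> H. ord h = n} = {}")
    case False
    then obtain h where h: "h \<in> H" "ord h = n" by blast
    show ?thesis
    \<comment> \<open>The identity is shared by all conjugates of \<open>H\<close>, so its class is
      not multiplied by \<open>card K\<close>.\<close>
    proof (cases "n = 1")
      case True
      then have "{h \<in> H. ord h = n} = {\<one>}" using ord_eq_1 subgroup.one_closed[OF H] by auto
      then show ?thesis by simp
    next
      case False
      have fin: "finite {h \<in> H. ord h = n}" "finite {x \<in> carrier G. ord x = n}"
        using finG finite_subset[OF H_sub] by auto
      have "h \<in> {x \<in> carrier G. ord x = n}" using h by simp
      then have "card {x \<in> carrier G. ord x = n} \<noteq> 0" using fin(2) by (metis card_eq_0_iff empty_iff)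
      then have "card K * card {h \<in> H. ord h = n} dvd card K * card H"
        using assms[unfolded perfect_order_classes_def, rule_format, OF n]
          complement_card_ord[OF h False] card_K by simp
      moreover have "card K \<noteq> 0" using subgroup.one_closed[OF kernel] finK by auto
      ultimately show ?thesis by simp
    qed
  next
    case True
    then have "card {h \<in> H. ord h = n} = 0" by (simp only: card.empty)
    then show ?thesis ..
  qed
  then show "card {x \<in> carrier (G\<lparr>carrier := H\<rparr>). group.ord (G\<lparr>carrier := H\<rparr>) x = n} = 0 \<or>
    card {x \<in> carrier (G\<lparr>carrier := H\<rparr>). group.ord (G\<lparr>carrier := H\<rparr>) x = n} dvd order (G\<lparr>carrier := H\<rparr>)"
    unfolding eq by (simp add: order_def)
qed

definition V where "V q = {k \<in> K. k [^] (q::nat) = \<one>}"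

lemma V_subgroup: "subgroup (V q) G"
proof (rule subgroupI)
  show "V q \<subseteq> carrier G" by (auto simp: V_def)
  show "V q \<noteq> {}" using subgroup.one_closed[OF kernel] by (auto simp: V_def)
  fix a assume a: "a \<in> V q"
  then show "inv a \<in> V q" using subgroup.m_inv_closed[OF kernel] by (auto simp: V_def nat_pow_inv)
  fix b assume "b \<in> V q"
  then show "a \<otimes> b \<in> V q"
    using a subgroup.m_closed[OF kernel] kernel_comm[of a b] by (auto simp: V_def pow_mult_distrib)
qed

lemma V_minus_one:
  assumes q: "prime q" "q dvd card K"
  shows "{x \<in> carrier G. ord x = q} = V q - {\<one>}"
proof -
  have "x \<in> K" if "x \<in> carrier G" "ord x = q" for x
  proof (rule ccontr)
    assume "x \<notin> K"
    then have "q dvd card H" using ord_cases[OF that(1)] that(2) by blast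
    then have "q dvd 1" using coprime_H_K q(2) by (meson coprime_def)
    then show False using q(1) by simp
  qed
  then show ?thesis using ord_prime_iff[OF _ q(1)] by (auto simp: V_def)
qed

lemma V_free_action:
  assumes q: "prime q" "q dvd card K"
  shows "free_action (G\<lparr>carrier := H\<rparr>) (G\<lparr>carrier := V q\<rparr>) (\<lambda>h v. h \<otimes> v \<otimes> inv h) q"
proof -
  have VK: "V q \<subseteq> K" by (auto simp: V_def)
  interpret A: group "G\<lparr>carrier := H\<rparr>" using subgroup_imp_group[OF H] .
  interpret B: comm_group "G\<lparr>carrier := V q\<rparr>"
    by (rule group.group_comm_groupI[OF subgroup_imp_group[OF V_subgroup]]) (use VK kernel_comm in auto)
  have "\<exists>x\<in>carrier (G\<lparr>carrier := K\<rparr>). group.ord (G\<lparr>carrier := K\<rparr>) x = q"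
    by (rule group.cauchy[OF subgroup_imp_group[OF kernel]]) (use finK q in \<open>auto simp: order_def\<close>)
  then obtain x where x: "x \<in> K" "ord x = q" using ord_subgroup[OF kernel] by auto
  show ?thesis
  proof unfold_locales
    show "finite (carrier (G\<lparr>carrier := H\<rparr>))" using finG finite_subset[OF H_sub] by simp
    show "finite (carrier (G\<lparr>carrier := V q\<rparr>))" using finite_subset[OF VK finK] by simp
    show "prime q" by (rule q(1))
    show "v [^]\<^bsub>G\<lparr>carrier := V q\<rparr>\<^esub> q = \<one>\<^bsub>G\<lparr>carrier := V q\<rparr>\<^esub>"
      if v: "v \<in> carrier (G\<lparr>carrier := V q\<rparr>)" for v
    proof -
      have "v [^]\<^bsub>G\<lparr>carrier := V q\<rparr>\<^esub> q = v [^] q" by (rule nat_pow_consistent[symmetric])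
      moreover have "v \<in> V q" using v by simp
      then have "v [^] q = \<one>" unfolding V_def by blast
      moreover have "\<one>\<^bsub>G\<lparr>carrier := V q\<rparr>\<^esub> = \<one>" by simp
      ultimately show ?thesis by (simp only:)
    qed
    have "x \<in> {x \<in> carrier G. ord x = q}" using x by simp
    then have "x \<in> V q - {\<one>}" unfolding V_minus_one[OF q] .
    then show "carrier (G\<lparr>carrier := V q\<rparr>) \<noteq> {\<one>\<^bsub>G\<lparr>carrier := V q\<rparr>\<^esub>}" by auto
    show "\<one>\<^bsub>G\<lparr>carrier := H\<rparr>\<^esub> \<otimes> v \<otimes> inv \<one>\<^bsub>G\<lparr>carrier := H\<rparr>\<^esub> = v"
      if "v \<in> carrier (G\<lparr>carrier := V q\<rparr>)" for v
      using that VK by auto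
    fix h v assume h: "h \<in> carrier (G\<lparr>carrier := H\<rparr>)" and v: "v \<in> carrier (G\<lparr>carrier := V q\<rparr>)"
    have hv: "h \<in> carrier G" "h \<in> H" "v \<in> carrier G" "v \<in> K" "v [^] q = \<one>" using h v VK by (auto simp: V_def)
    show "h \<otimes> v \<otimes> inv h \<in> carrier (G\<lparr>carrier := V q\<rparr>)"
      using conj_K[OF hv(4,1)] conj_pow[OF hv(1,3), of q] hv by (simp add: V_def)
    show "h \<otimes> v \<otimes> inv h = v \<Longrightarrow> h = \<one>\<^bsub>G\<lparr>carrier := H\<rparr>\<^esub> \<or> v = \<one>\<^bsub>G\<lparr>carrier := V q\<rparr>\<^esub>"
      using H_acts_freely[OF hv(2,4)] by simp
    { fix w assume "w \<in> carrier (G\<lparr>carrier := V q\<rparr>)"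
      then have "w \<in> carrier G" using VK by auto
      then show "h \<otimes> (v \<otimes>\<^bsub>G\<lparr>carrier := V q\<rparr>\<^esub> w) \<otimes> inv h = h \<otimes> v \<otimes> inv h \<otimes>\<^bsub>G\<lparr>carrier := V q\<rparr>\<^esub> (h \<otimes> w \<otimes> inv h)"
        using conj_hom[OF hv(1,3), of w] by simp }
    { fix k assume "k \<in> carrier (G\<lparr>carrier := H\<rparr>)"
      then have "k \<in> carrier G" by simp
      then show "h \<otimes>\<^bsub>G\<lparr>carrier := H\<rparr>\<^esub> k \<otimes> v \<otimes> inv (h \<otimes>\<^bsub>G\<lparr>carrier := H\<rparr>\<^esub> k) = h \<otimes> (k \<otimes> v \<otimes> inv k) \<otimes> inv h"
        using conj_conj[OF hv(1) _ hv(3), of k] by simp }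
  qed
qed

lemma card_ord_prime:
  assumes q: "prime q" "q dvd card K"
  shows "card {x \<in> carrier G. ord x = q} = card (V q) - 1" and "card H dvd card (V q) - 1"
    and "card (V q) - 1 \<noteq> 0"
proof -
  interpret A: free_action "G\<lparr>carrier := H\<rparr>" "G\<lparr>carrier := V q\<rparr>" "\<lambda>h v. h \<otimes> v \<otimes> inv h" q
    by (rule V_free_action[OF q])
  have fin: "finite (V q)" using A.finV by simp
  show 1: "card {x \<in> carrier G. ord x = q} = card (V q) - 1"
    unfolding V_minus_one[OF q] using fin subgroup.one_closed[OF V_subgroup] by simp
  show "card H dvd card (V q) - 1" using A.order_H_dvd by (simp add: order_def)
  obtain v where "v \<in> V q" "v \<noteq> \<one>" using A.nonzero_exists by auto
  then have "{x \<in> carrier G. ord x = q} \<noteq> {}" unfolding V_minus_one[OF q] by blast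
  then have "card {x \<in> carrier G. ord x = q} \<noteq> 0" using finG by simp
  then show "card (V q) - 1 \<noteq> 0" using 1 by simp
qed

text \<open>For two primes \<open>p\<close>, \<open>q\<close> dividing \<open>|K|\<close>, the number of elements of order \<open>pq\<close> would be divisible
  by \<open>|H|\<^sup>2\<close>.\<close>

lemma kernel_prime_unique:
  assumes poc: "perfect_order_classes G" and p: "prime p" "p dvd card K" and q: "prime q" "q dvd card K"
  shows "p = q"
proof (rule ccontr)
  assume "p \<noteq> q"
  let ?N = "\<lambda>n. card {x \<in> carrier G. ord x = n}"
  have N: "?N (p * q) = ?N p * ?N q"
  proof (rule card_ord_mult)
    show "coprime p q" using primes_coprime[OF p(1) q(1) \<open>p \<noteq> q\<close>] .
    show "x \<otimes> y = y \<otimes> x" if "x \<in> carrier G" "y \<in> carrier G" "ord x = p" "ord y = q" for x y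
      using that V_minus_one[OF p] V_minus_one[OF q] kernel_comm unfolding V_def by blast
  qed
  have "?N (p * q) \<noteq> 0" using N card_ord_prime[OF p] card_ord_prime[OF q] by simp
  moreover have "p * q > 0" using p(1) q(1) by (simp add: prime_gt_0_nat)
  ultimately have "?N (p * q) dvd order G" using poc[unfolded perfect_order_classes_def, rule_format, of "p * q"] by simp
  moreover have "card H * card H dvd ?N (p * q)"
    unfolding N using card_ord_prime[OF p] card_ord_prime[OF q] by (simp add: mult_dvd_mono)
  ultimately have "card H * card H dvd card K * card H" using card_K dvd_trans by metis
  \<comment> \<open>Coprimality of the two orders now makes \<open>H\<close> trivial, although it
    contains \<open>t\<close>.\<close>
  then have "card H dvd card K" using card_H_pos by simp
  then have "card H = 1" using coprime_H_K by (metis coprime_absorb_left nat_dvd_1_iff_1)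
  then have "t = \<one>" using t(1) subgroup.one_closed[OF H] by (metis card_1_singletonE singletonD)
  then show False using t_inv(2) by simp
qed

text \<open>The number of elements of order \<open>p\<close> divides \<open>card K * card H\<close>
  and is prime to \<open>card K\<close>, a power of \<open>p\<close>; so it divides
  \<open>card H\<close>. Freeness gives the converse divisibility.\<close>

lemma card_V_eq:
  assumes poc: "perfect_order_classes G" and p: "prime p" "p dvd card K"
  shows "card H = card (V p) - 1"
proof -
  interpret A: free_action "G\<lparr>carrier := H\<rparr>" "G\<lparr>carrier := V p\<rparr>" "\<lambda>h v. h \<otimes> v \<otimes> inv h" p
    by (rule V_free_action[OF p])
  have "card K > 0" using subgroup.one_closed[OF kernel] finK by (auto simp: card_gt_0_iff)
  then obtain k where k: "card K = p ^ k"
    using only_prime_divisor_imp_power[of "card K" p] kernel_prime_unique[OF poc p] p(1) by metis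
  obtain m where m: "card (V p) = p ^ m" using A.order_V by (auto simp: order_def)
  have "card (V p) - 1 dvd card K * card H"
    using poc[unfolded perfect_order_classes_def, rule_format, of p]
      card_ord_prime(1,3)[OF p] card_K prime_gt_0_nat[OF p(1)] by simp
  moreover have "coprime (card (V p) - 1) (card K)"
  proof -
    have "m \<noteq> 0" using card_ord_prime(3)[OF p] m by (intro notI) simp
    have "\<not> p dvd card (V p) - 1"
    proof
      assume "p dvd card (V p) - 1"
      moreover have "p dvd card (V p)" using m \<open>m \<noteq> 0\<close> by simp
      ultimately have "p dvd card (V p) - (card (V p) - 1)" by (rule dvd_diff_nat[rotated])
      moreover have "card (V p) - (card (V p) - 1) = 1" using card_ord_prime(3)[OF p] by simp
      ultimately show False using p(1) by simp
    qed
    then have "coprime p (card (V p) - 1)" by (rule prime_imp_coprime[OF p(1)])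
    then show ?thesis unfolding k by (simp add: coprime_commute)
  qed
  ultimately have "card (V p) - 1 dvd card H" by (simp add: coprime_dvd_mult_right_iff)
  then show ?thesis using card_ord_prime(2)[OF p] dvd_antisym by blast
qed

end

theorem theoremE:
  fixes G :: "('a, 'b) monoid_scheme" and H :: "'a set"
  assumes "group G" and "finite (carrier G)"
    and "solvable G"
    and "frobenius_group G"
    and "frobenius_complement H G"
    and "prime_set_group {2, 3, 5} (G\<lparr>carrier := H\<rparr>)"
    and "30 dvd order (G\<lparr>carrier := H\<rparr>)"
  shows "\<not> perfect_order_classes G"
proof
  assume poc: "perfect_order_classes G"
  interpret group G by fact
  have H: "subgroup H G" and HG: "H \<noteq> carrier G"
    and frob: "\<And>g. g \<in> carrier G - H \<Longrightarrow> H \<inter> conj_subgroup G H g = {\<one>\<^bsub>G\<^esub>}"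
    using assms(5) by (auto simp: frobenius_complement_def)
  have HsubG: "H \<subseteq> carrier G" using subgroup.subset[OF H] .
  have "2 dvd order (G\<lparr>carrier := H\<rparr>)" using assms(7) by (auto intro: dvd_trans[of _ 30])
  then obtain t where "t \<in> H" "group.ord (G\<lparr>carrier := H\<rparr>) t = 2"
    using group.cauchy[OF subgroup_imp_group[OF H], of 2] finite_subset[OF HsubG assms(2)] by auto
  then have t: "t \<in> H" "ord t = 2" using ord_subgroup[OF H] by simp_all
  interpret F: even_frobenius G H t
  proof (intro even_frobenius.intro even_frobenius_axioms.intro)
    fix g h assume g: "g \<in> carrier G" and h: "h \<in> H" "h \<noteq> \<one>\<^bsub>G\<^esub>" "g \<otimes>\<^bsub>G\<^esub> h \<otimes>\<^bsub>G\<^esub> inv\<^bsub>G\<^esub> g \<in> H"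
    show "g \<in> H"
    proof (rule ccontr)
      assume "g \<notin> H"
      have hc: "h \<in> carrier G" using h HsubG by blast
      \<comment> \<open>So \<open>h\<close> lies both in \<open>H\<close> and in its conjugate by
        \<open>g\<close>.\<close>
      have "inv\<^bsub>G\<^esub> g \<otimes>\<^bsub>G\<^esub> (g \<otimes>\<^bsub>G\<^esub> h \<otimes>\<^bsub>G\<^esub> inv\<^bsub>G\<^esub> g) \<otimes>\<^bsub>G\<^esub> g = h"
        using conj_conj[of "inv\<^bsub>G\<^esub> g" g h] g hc by simp
      then have "h \<in> conj_subgroup G H g"
        unfolding conj_subgroup_def l_coset_def r_coset_def using h(3) by force
      then show False using frob[of g] g h \<open>g \<notin> H\<close> by blast
    qed
  qed (use assms(1,2) H t in auto)
  \<comment> \<open>The complement is proper, so the kernel is nontrivial and has a prime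
    divisor.\<close>
  have "card F.K \<noteq> 1"
  proof
    assume "card F.K = 1"
    then have "card H = card (carrier G)" using F.card_K by (simp add: order_def)
    then show False using card_seteq[OF assms(2) HsubG] HG by simp
  qed
  then obtain p where p: "prime p" "p dvd card F.K" using prime_factor_nat by blast
  interpret A: poc_action "G\<lparr>carrier := H\<rparr>" "G\<lparr>carrier := F.V p\<rparr>" "\<lambda>h v. h \<otimes>\<^bsub>G\<^esub> v \<otimes>\<^bsub>G\<^esub> inv\<^bsub>G\<^esub> h" p
  proof (rule poc_action.intro[OF F.V_free_action[OF p]], unfold_locales)
    show "order (G\<lparr>carrier := H\<rparr>) = order (G\<lparr>carrier := F.V p\<rparr>) - 1"
      using F.card_V_eq[OF poc p] by (simp add: order_def)
    show "r \<in> {2, 3, 5}" if "prime r" "r dvd order (G\<lparr>carrier := H\<rparr>)" for r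
      using assms(6) that by (auto simp: prime_set_group_def)
    show "30 dvd order (G\<lparr>carrier := H\<rparr>)" by fact
    show "perfect_order_classes (G\<lparr>carrier := H\<rparr>)" by (rule F.complement_perfect_order_classes[OF poc])
  qed
  have "solvable_seq G H" by (rule solvable_subgroup[OF H assms(3)])
  then obtain n where n: "(derived G ^^ n) H = {\<one>\<^bsub>G\<^esub>}" using solvable_imp_trivial_derived_seq by blast
  \<comment> \<open>The derived series of \<open>H\<close> is the same computed in \<open>H\<close>
    or in \<open>G\<close>, as all its terms stay inside \<open>H\<close>.\<close>
  have "(derived (G\<lparr>carrier := H\<rparr>) ^^ j) H = (derived G ^^ j) H \<and> (derived G ^^ j) H \<subseteq> H" for j
  proof (induction j)
    case (Suc j)
    then show ?case using derived_consistent[OF _ H] derived_incl[OF _ H] by simp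
  qed simp
  then have "solvable (G\<lparr>carrier := H\<rparr>)"
    using n A.H.solvable_iff_trivial_derived_seq by auto
  then show False by (rule A.no_solvable_poc_action)
qed

end
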